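(* Let $(\sigma^t)_{t\ge 0}$ be the zero-temperature stochastic homogeneous Ising ferromagnet on $\mathbf{Z}^2$ started from the symmetric Bernoulli product measure. For $L<\infty$ let $C_L^+(t)$ (resp. $C_L^-(t)$) denote the event that $\sigma^t$ is constant and equal to $+1$ (resp. to $-1$) on the square $Q_L=\{-L,\dots,L\}^2$. Then for any $L<\infty$, $$\liminf_{t\to\infty}P(C_L^+(t))=\liminf_{t\to\infty}P(C_L^-(t))\ge \tfrac14 .$$
   Context: Model. The state space is $\mathcal{S}=\{-1,+1\}^{\mathbf{Z}^2}$. The initial state $\sigma^0$ has law $\mu^0$, the product measure under which the spins $\sigma^0_x$ are i.i.d. and equal to $+1$ or $-1$ with probability $1/2$ each. The continuous-time dynamics are: to each site $x\in\mathbf{Z}^2$ is attached an independent rate-$1$ Poisson process of "clock rings", with an independent fair coin toss attached to each ring. When the clock at $x$ rings, let $k$ be the number of the $4$ nearest neighbors $y$ of $x$ (Euclidean distance $\|x-y\|=1$) with $\sigma_y\ne\sigma_x$: if $k\ge 3$ the spin at $x$ flips ($\sigma_x\to-\sigma_x$); if $k=2$ it flips with probability $1/2$, according to the coin toss; if $k\le 1$ it does not flip. $P=\mu^0\times P_{dyn}$ is the joint law of the initial configuration and the clock rings and coin tosses. *)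

theory Defs
  imports "HOL-Probability.Probability"
begin

type_synonym site = "int \<times> int"
type_synonym config = "site \<Rightarrow> int"

text \<open>For each site and each \<open>n\<close>: the waiting time between the \<open>(n - 1)\<close>-st and the \<open>n\<close>-th
  clock ring at that site (counted from \<open>0\<close>, the first one starting at time \<open>0\<close>), together
  with the coin attached to the \<open>n\<close>-th ring.\<close>
type_synonym clocks = "site \<Rightarrow> nat \<Rightarrow> real \<times> bool"

definition state_space :: "config measure" where
  "state_space = PiM UNIV (\<lambda>_. count_space {-1, 1})"

definition initial_law :: "config measure" where
  "initial_law = PiM UNIV (\<lambda>_. uniform_count_measure {-1, 1})"

text \<open>A rate-1 Poisson process is realised by i.i.d. waiting times of exponential law
  with parameter 1.\<close>
definition dyn_law :: "clocks measure" where
  "dyn_law = PiM UNIV (\<lambda>_. PiM UNIV (\<lambda>_.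
     density lborel (\<lambda>s. ennreal (exponential_density 1 s)) \<Otimes>\<^sub>M uniform_count_measure UNIV))"

definition ising_law :: "(config \<times> clocks) measure" where
  "ising_law = initial_law \<Otimes>\<^sub>M dyn_law"

definition ring_time :: "clocks \<Rightarrow> site \<Rightarrow> nat \<Rightarrow> real" where
  "ring_time w x n = (\<Sum>i\<le>n. fst (w x i))"

definition coin :: "clocks \<Rightarrow> site \<Rightarrow> nat \<Rightarrow> bool" where
  "coin w x n = snd (w x n)"

definition euclidean_point :: "site \<Rightarrow> real \<times> real" where
  "euclidean_point x = (real_of_int (fst x), real_of_int (snd x))"

definition neighbours :: "site \<Rightarrow> site set" where
  "neighbours x = {y. dist (euclidean_point x) (euclidean_point y) = 1}"

lemma neighbours_eq:
  "neighbours (a, b) = {(a + 1, b), (a - 1, b), (a, b + 1), (a, b - 1)}"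
proof -
  have *: "dist (euclidean_point (a, b)) (euclidean_point (c, d)) = 1
      \<longleftrightarrow> (c - a)\<^sup>2 + (d - b)\<^sup>2 = 1" for c d
  proof -
    have "dist (euclidean_point (a, b)) (euclidean_point (c, d))
        = sqrt (real_of_int ((c - a)\<^sup>2 + (d - b)\<^sup>2))"
      by (simp add: euclidean_point_def dist_Pair_Pair dist_real_def power2_commute)
    then show ?thesis
      by (simp only: real_sqrt_eq_1_iff of_int_eq_1_iff)
  qed
  have "u\<^sup>2 + v\<^sup>2 = 1 \<longleftrightarrow> (u, v) \<in> {(1, 0), (-1, 0), (0, 1), (0, -1)}" for u v :: int
  proof
    assume uv: "u\<^sup>2 + v\<^sup>2 = 1"
    then have "u\<^sup>2 \<le> 1\<^sup>2" "v\<^sup>2 \<le> 1\<^sup>2"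
      by (smt (verit) zero_le_power2 one_power2)+
    then have "\<bar>u\<bar> \<le> 1" "\<bar>v\<bar> \<le> 1"
      by (simp_all add: abs_square_le_1)
    then have "u \<in> {-1, 0, 1}" "v \<in> {-1, 0, 1}"
      by auto
    with uv show "(u, v) \<in> {(1, 0), (-1, 0), (0, 1), (0, -1)}"
      by auto
  qed auto
  then have "(c - a)\<^sup>2 + (d - b)\<^sup>2 = 1
      \<longleftrightarrow> (c, d) \<in> {(a + 1, b), (a - 1, b), (a, b + 1), (a, b - 1)}" for c d
    by auto
  with * show ?thesis
    unfolding neighbours_def by (simp add: set_eq_iff)
qed

definition disagreements :: "config \<Rightarrow> site \<Rightarrow> nat" where
  "disagreements s x = card {y \<in> neighbours x. s y \<noteq> s x}"

definition updated_spin :: "bool \<Rightarrow> config \<Rightarrow> site \<Rightarrow> int" where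
  "updated_spin c s x =
     (if disagreements s x \<ge> 3 \<or> (disagreements s x = 2 \<and> c) then - s x else s x)"

text \<open>\<open>s\<close> is a trajectory (right-continuous in time) driven by the initial state \<open>\<eta>\<close> and the
  clock rings and coins \<open>w\<close>. The filter \<open>at_left\<close> expresses that the update at a ring uses
  the configuration just before the ring. Since clocks and initial state almost surely
  determine at most one such \<open>s\<close> (Harris' graphical construction), this specifies the process
  up to a null set.\<close>
definition ising_trajectory :: "config \<Rightarrow> clocks \<Rightarrow> (real \<Rightarrow> config) \<Rightarrow> bool" where
  "ising_trajectory \<eta> w s \<longleftrightarrow>
     s 0 = \<eta> \<and>
     (\<forall>x t u. 0 \<le> t \<and> t \<le> u \<and> (\<forall>n. ring_time w x n \<notin> {t<..u}) \<longrightarrow> s u x = s t x) \<and>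
     (\<forall>x n. \<forall>\<^sub>F u in at_left (ring_time w x n).
        s (ring_time w x n) x = updated_spin (coin w x n) (s u) x)"

definition ising_process :: "(real \<Rightarrow> config \<times> clocks \<Rightarrow> config) \<Rightarrow> bool" where
  "ising_process \<sigma> \<longleftrightarrow>
     (\<forall>t\<ge>0. \<sigma> t \<in> ising_law \<rightarrow>\<^sub>M state_space) \<and>
     (AE \<omega> in ising_law. ising_trajectory (fst \<omega>) (snd \<omega>) (\<lambda>t. \<sigma> t \<omega>))"

definition square :: "nat \<Rightarrow> site set" where
  "square L = {- int L..int L} \<times> {- int L..int L}"

definition const_on_square ::
  "(real \<Rightarrow> config \<times> clocks \<Rightarrow> config) \<Rightarrow> nat \<Rightarrow> int \<Rightarrow> real \<Rightarrow> (config \<times> clocks) set" where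
  "const_on_square \<sigma> L a t = {\<omega> \<in> space ising_law. \<forall>x\<in>square L. \<sigma> t \<omega> x = a}"

lemma prob_space_initial_law: "prob_space initial_law"
  unfolding initial_law_def
  by (intro prob_space_PiM prob_space_uniform_count_measure) auto

lemma prob_space_dyn_law: "prob_space dyn_law"
  unfolding dyn_law_def
  by (intro prob_space_PiM prob_space_pair prob_space_uniform_count_measure
        prob_space_exponential_density) auto

lemma prob_space_ising_law: "prob_space ising_law"
  unfolding ising_law_def
  by (intro prob_space_pair prob_space_initial_law prob_space_dyn_law)

lemma sets_const_on_square:
  assumes "ising_process \<sigma>" and "t \<ge> 0"
  shows "const_on_square \<sigma> L a t \<in> sets ising_law"
proof -
  have \<sigma>: "\<sigma> t \<in> ising_law \<rightarrow>\<^sub>M state_space"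
    using assms by (auto simp: ising_process_def)
  have "(\<lambda>\<omega>. \<sigma> t \<omega> x) \<in> ising_law \<rightarrow>\<^sub>M count_space {-1, 1}" for x
    using measurable_compose[OF \<sigma>[unfolded state_space_def] measurable_component_singleton[of x]]
    by simp
  then have "(\<lambda>\<omega>. \<sigma> t \<omega> x) -` ({a} \<inter> {-1, 1}) \<inter> space ising_law \<in> sets ising_law" for x
    by (rule measurable_sets) auto
  moreover have "(\<lambda>\<omega>. \<sigma> t \<omega> x) -` ({a} \<inter> {-1, 1}) \<inter> space ising_law
      = {\<omega> \<in> space ising_law. \<sigma> t \<omega> x = a}" for x
  proof -
    have "\<sigma> t \<omega> x \<in> {-1, 1}" if "\<omega> \<in> space ising_law" for \<omega>
      using measurable_space[OF \<sigma> that] by (auto simp: state_space_def space_PiM)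
    then show ?thesis by fastforce
  qed
  ultimately show ?thesis
    unfolding const_on_square_def square_def
    by (intro sets.sets_Collect_finite_All) auto
qed

end

theory Submission
  imports Defs
begin

text \<open>
  Every update at a tie is energy neutral, and the expected energy per site decreases in time, so
  energy lowering flips become rare. An event from which a rare local event can be reached by one
  legal flip is rare as well; hence, for large times, no sequence of legal flips inside a fixed
  window lowers the energy, up to small probability.

  This makes corners of domain walls rare. Suppose the origin is a corner, and so are a site to
  the right of it and a site above it, all three with a plus sign and minus signs above and to the
  right. Then either a tongue of plus sites can be eaten up, or a staircase of plus sites connects
  the two other corners, and filling the region below it lowers the energy next to the origin. So
  the origin is the last corner on one of two rays, and by translation invariance this has
  probability at most \<open>2 / (M + 1)\<close> for rays of length \<open>M\<close>.

  Without corners, inside a square all rows or all columns are constant. Then there is a row of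
  plus signs or a column of minus signs, so by symmetry a row of plus signs has probability about
  at least \<open>1/2\<close>. By positive association there are simultaneously a row and a column of plus
  signs with probability about at least \<open>1/4\<close>, and then the whole square is plus.

  The law of the infinite system is accessed by Harris' construction: within a short time the sites
  whose clock rings form finite clusters only, so locally every trajectory is a finite sequence of
  updates, which is the limit of a system in a finite box and in discrete time.
\<close>

section \<open>Updates as operators on local functions\<close>

text \<open>One principle is used twice. Let \<open>u f t\<close> be the expectation of f at time t.
  The forward equation has a second order error uniform in time; hence, if \<open>u f\<close>
  converges along dyadic times, the expectation of the generator of f tends to 0. For the energy per
  site, convergence is monotonicity, which translation invariance provides, and energy drops become
  rare. For the indicator f of an event that is already rare, convergence is free, and the generator
  is at least half the indicator of being one legal flip away minus a multiple of f, so rarity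
  spreads to predecessors. Spatial averages enter only as sums of equal probabilities over
  translates, without an ergodic theorem. The obstacle is that the process is given only through
  trajectories that almost surely obey their clocks. Symmetry is drawn from pathwise uniqueness;
  association and the forward equation are proved for kernels on a finite box with a dyadic mesh and
  then transferred. The mesh required depends on the box and on the realisation, so the mesh tends
  to 0 before the box grows.\<close>

definition spins :: "config set" where
  "spins = {\<eta>. \<forall>x. \<eta> x = 1 \<or> \<eta> x = -1}"

definition update :: "site \<Rightarrow> bool \<Rightarrow> config \<Rightarrow> config" where
  "update x c \<eta> = \<eta>(x := updated_spin c \<eta> x)"

text \<open>The transition operator of one time slot at x: q is the probability that the clock
  rings, and the coin is fair.\<close>

definition resample :: "real \<Rightarrow> site \<Rightarrow> (config \<Rightarrow> real) \<Rightarrow> config \<Rightarrow> real" where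
  "resample q x f \<eta> = (1 - q) * f \<eta> + q * ((f (update x True \<eta>) + f (update x False \<eta>)) / 2)"

text \<open>The head of the list is updated first in time although its operator is outermost: the
  value at \<eta> is the expectation of f after processing the sites from left to right, starting in
  \<eta>.\<close>

primrec resamples :: "real \<Rightarrow> site list \<Rightarrow> (config \<Rightarrow> real) \<Rightarrow> config \<Rightarrow> real" where
  "resamples q [] f = f"
| "resamples q (x # xs) f = resample q x (resamples q xs f)"

definition cylinder :: "site set \<Rightarrow> (config \<Rightarrow> 'b) \<Rightarrow> bool" where
  "cylinder S f \<longleftrightarrow> (\<forall>\<eta> \<zeta>. (\<forall>x\<in>S. \<eta> x = \<zeta> x) \<longrightarrow> f \<eta> = f \<zeta>)"

text \<open>The order is tested on genuine spin configurations only, since attractiveness of the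
  update relies on the values 1 and -1.\<close>

definition increasing :: "(config \<Rightarrow> real) \<Rightarrow> bool" where
  "increasing f \<longleftrightarrow> (\<forall>\<eta>\<in>spins. \<forall>\<zeta>\<in>spins. \<eta> \<le> \<zeta> \<longrightarrow> f \<eta> \<le> f \<zeta>)"

definition drift :: "site \<Rightarrow> (config \<Rightarrow> real) \<Rightarrow> config \<Rightarrow> real" where
  "drift x f \<eta> = (f (update x True \<eta>) + f (update x False \<eta>)) / 2 - f \<eta>"

text \<open>For f depending on S only this is the full generator of the rate 1 dynamics, because
  sites outside S have zero drift.\<close>

definition generator :: "site set \<Rightarrow> (config \<Rightarrow> real) \<Rightarrow> config \<Rightarrow> real" where
  "generator S f \<eta> = (\<Sum>x\<in>S. drift x f \<eta>)"

lemma cylinderD: "cylinder S f \<Longrightarrow> (\<And>x. x \<in> S \<Longrightarrow> \<eta> x = \<zeta> x) \<Longrightarrow> f \<eta> = f \<zeta>"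
  unfolding cylinder_def by blast

lemma spinsD: "\<eta> \<in> spins \<Longrightarrow> \<eta> x = 1 \<or> \<eta> x = -1"
  unfolding spins_def by blast

lemma neighbours_alt:
  "neighbours x = {(fst x + 1, snd x), (fst x - 1, snd x), (fst x, snd x + 1), (fst x, snd x - 1)}"
  using neighbours_eq[of "fst x" "snd x"] by simp

lemma finite_neighbours [simp]: "finite (neighbours x)"
  by (simp add: neighbours_alt)

lemma card_neighbours: "card (neighbours x) = 4"
  by (simp add: neighbours_alt)

lemma not_in_neighbours [simp]: "x \<notin> neighbours x"
  by (cases x) (auto simp: neighbours_alt)

lemma updated_spin_spins: "\<eta> \<in> spins \<Longrightarrow> updated_spin c \<eta> x = 1 \<or> updated_spin c \<eta> x = -1"
  using spinsD[of \<eta> x] by (auto simp: updated_spin_def)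

lemma update_spins: "\<eta> \<in> spins \<Longrightarrow> update x c \<eta> \<in> spins"
  using updated_spin_spins[of \<eta>] by (auto simp: update_def spins_def)

lemma update_other: "y \<noteq> x \<Longrightarrow> update x c \<eta> y = \<eta> y"
  by (simp add: update_def)

lemma updated_spin_cong:
  assumes "\<eta> x = \<zeta> x" "\<And>y. y \<in> neighbours x \<Longrightarrow> \<eta> y = \<zeta> y"
  shows "updated_spin c \<eta> x = updated_spin c \<zeta> x"
proof -
  have "disagreements \<eta> x = disagreements \<zeta> x"
    unfolding disagreements_def by (rule arg_cong[where f = card]) (use assms in auto)
  then show ?thesis using assms by (simp add: updated_spin_def)
qed

section \<open>Attractiveness and positive association of the update\<close>

definition plus_neighbours :: "config \<Rightarrow> site \<Rightarrow> nat" where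
  "plus_neighbours \<eta> x = card {y \<in> neighbours x. \<eta> y = 1}"

lemma disagreements_plus:
  assumes "\<eta> \<in> spins"
  shows "\<eta> x = -1 \<Longrightarrow> disagreements \<eta> x = plus_neighbours \<eta> x"
    and "\<eta> x = 1 \<Longrightarrow> disagreements \<eta> x = 4 - plus_neighbours \<eta> x"
    and "plus_neighbours \<eta> x \<le> 4"
proof -
  show "plus_neighbours \<eta> x \<le> 4"
    unfolding plus_neighbours_def card_neighbours[of x, symmetric] by (intro card_mono) auto
  show "\<eta> x = -1 \<Longrightarrow> disagreements \<eta> x = plus_neighbours \<eta> x"
    unfolding disagreements_def plus_neighbours_def
    by (rule arg_cong[where f = card]) (use assms in \<open>auto simp: spins_def\<close>)
  have "{y \<in> neighbours x. \<eta> y \<noteq> 1} = neighbours x - {y \<in> neighbours x. \<eta> y = 1}"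
    by auto
  then have "card {y \<in> neighbours x. \<eta> y \<noteq> 1} = 4 - card {y \<in> neighbours x. \<eta> y = 1}"
    by (simp add: card_Diff_subset card_neighbours)
  then show "\<eta> x = 1 \<Longrightarrow> disagreements \<eta> x = 4 - plus_neighbours \<eta> x"
    by (simp add: disagreements_def plus_neighbours_def)
qed

text \<open>With a common coin the update is not monotone: at a tie the same coin sends a plus spin
  down and a minus spin up. Only the sum over both coins matters, and it is also the sum over two
  threshold rules, plus when at least 2, respectively at least 3, neighbours are plus. Each of these
  is monotone and ignores the old spin.\<close>

lemma update_average:
  fixes f :: "config \<Rightarrow> real"
  assumes "\<eta> \<in> spins"
  shows "f (update x True \<eta>) + f (update x False \<eta>) =
    f (\<eta>(x := (if plus_neighbours \<eta> x \<ge> 2 then 1 else -1))) +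
    f (\<eta>(x := (if plus_neighbours \<eta> x \<ge> 3 then 1 else -1)))"
proof -
  note d = disagreements_plus[OF assms, of x]
  from spinsD[OF assms, of x] show ?thesis
  proof
    assume x: "\<eta> x = 1"
    show ?thesis using d x
      by (cases "plus_neighbours \<eta> x = 2") (auto simp: update_def updated_spin_def)
  next
    assume x: "\<eta> x = -1"
    show ?thesis using d x
      by (cases "plus_neighbours \<eta> x = 2") (auto simp: update_def updated_spin_def)
  qed
qed

lemma plus_neighbours_mono:
  assumes "\<eta> \<le> \<zeta>" "\<zeta> \<in> spins"
  shows "plus_neighbours \<eta> x \<le> plus_neighbours \<zeta> x"
  unfolding plus_neighbours_def
proof (intro card_mono subsetI)
  fix y assume y: "y \<in> {y \<in> neighbours x. \<eta> y = 1}"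
  have "\<eta> y \<le> \<zeta> y" using assms(1) by (rule le_funD)
  with y spinsD[OF assms(2), of y] show "y \<in> {y \<in> neighbours x. \<zeta> y = 1}" by auto
qed auto

text \<open>Both threshold rules of \<open>update_average\<close> preserve the order, hence so does
  their average.\<close>

lemma increasing_resample:
  assumes f: "increasing f" and q: "0 \<le> q" "q \<le> 1"
  shows "increasing (resample q x f)"
  unfolding increasing_def
proof (intro ballI impI)
  fix \<eta> \<zeta> assume s: "\<eta> \<in> spins" "\<zeta> \<in> spins" and le: "\<eta> \<le> \<zeta>"
  note pm = plus_neighbours_mono[OF le s(2), of x]
  have 1: "f (\<eta>(x := a)) \<le> f (\<zeta>(x := b))" if "a \<le> b" "a = 1 \<or> a = -1" "b = 1 \<or> b = -1" for a b
  proof -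
    have "\<eta>(x := a) \<in> spins" "\<zeta>(x := b) \<in> spins" "\<eta>(x := a) \<le> \<zeta>(x := b)"
      using s le that by (auto simp: spins_def le_fun_def)
    then show ?thesis using f unfolding increasing_def by blast
  qed
  have 2: "f \<eta> \<le> f \<zeta>" using f s le unfolding increasing_def by blast
  have 3: "f (update x True \<eta>) + f (update x False \<eta>) \<le> f (update x True \<zeta>) + f (update x False \<zeta>)"
    unfolding update_average[OF s(1)] update_average[OF s(2)]
    by (intro add_mono 1) (use pm in auto)
  show "resample q x f \<eta> \<le> resample q x f \<zeta>"
    unfolding resample_def
    by (rule add_mono[OF mult_left_mono[OF 2] mult_left_mono[OF divide_right_mono[OF 3]]])
      (use q in auto)
qed

lemma increasing_resamples:
  "increasing f \<Longrightarrow> 0 \<le> q \<Longrightarrow> q \<le> 1 \<Longrightarrow> increasing (resamples q xs f)"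
  by (induction xs) (auto intro: increasing_resample)

text \<open>The covariance on three points is the sum over pairs of
  \<open>p_i * p_j * (a_i - a_j) * (b_i - b_j)\<close>.\<close>

lemma chebyshev_three:
  fixes p0 p1 p2 a0 a1 a2 b0 b1 b2 :: real
  assumes p: "0 \<le> p0" "0 \<le> p1" "0 \<le> p2" "p0 + p1 + p2 = 1"
    and ab: "(a0 - a1) * (b0 - b1) \<ge> 0" "(a0 - a2) * (b0 - b2) \<ge> 0" "(a1 - a2) * (b1 - b2) \<ge> 0"
  shows "(p0 * a0 + p1 * a1 + p2 * a2) * (p0 * b0 + p1 * b1 + p2 * b2)
    \<le> p0 * (a0 * b0) + p1 * (a1 * b1) + p2 * (a2 * b2)"
proof -
  have "p0 * (a0 * b0) + p1 * (a1 * b1) + p2 * (a2 * b2)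
    - (p0 * a0 + p1 * a1 + p2 * a2) * (p0 * b0 + p1 * b1 + p2 * b2)
    = p0 * p1 * ((a0 - a1) * (b0 - b1)) + p0 * p2 * ((a0 - a2) * (b0 - b2))
      + p1 * p2 * ((a1 - a2) * (b1 - b2))"
  proof -
    have p0: "p0 = 1 - p1 - p2" using p by simp
    show ?thesis unfolding p0 by (simp add: algebra_simps)
  qed
  moreover have "\<dots> \<ge> 0"
    by (intro add_nonneg_nonneg mult_nonneg_nonneg[OF _ ab(1)] mult_nonneg_nonneg[OF _ ab(2)]
      mult_nonneg_nonneg[OF _ ab(3)] mult_nonneg_nonneg p)
  ultimately show ?thesis by linarith
qed

text \<open>The possible outcomes of an update differ at a single site, so they form a chain.\<close>

lemma increasing_single_site:
  assumes "increasing f" "increasing g" "\<eta> \<in> spins" "\<zeta> \<in> spins" "\<And>y. y \<noteq> x \<Longrightarrow> \<eta> y = \<zeta> y"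
  shows "(f \<eta> - f \<zeta>) * (g \<eta> - g \<zeta>) \<ge> 0"
proof -
  have "\<eta> \<le> \<zeta> \<or> \<zeta> \<le> \<eta>"
    using assms(5) by (metis le_fun_def linear order_refl)
  then show ?thesis
  proof
    assume "\<eta> \<le> \<zeta>"
    then have "f \<eta> \<le> f \<zeta>" "g \<eta> \<le> g \<zeta>" using assms unfolding increasing_def by auto
    then show ?thesis by (intro mult_nonpos_nonpos) auto
  next
    assume "\<zeta> \<le> \<eta>"
    then have "f \<zeta> \<le> f \<eta>" "g \<zeta> \<le> g \<eta>" using assms unfolding increasing_def by auto
    then show ?thesis by (intro mult_nonneg_nonneg) auto
  qed
qed

lemma resample_mult:
  assumes f: "increasing f" "increasing g" and q: "0 \<le> q" "q \<le> 1" and \<eta>: "\<eta> \<in> spins"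
  shows "resample q x f \<eta> * resample q x g \<eta> \<le> resample q x (\<lambda>\<eta>. f \<eta> * g \<eta>) \<eta>"
proof -
  have "((1 - q) * f \<eta> + q / 2 * f (update x True \<eta>) + q / 2 * f (update x False \<eta>)) *
    ((1 - q) * g \<eta> + q / 2 * g (update x True \<eta>) + q / 2 * g (update x False \<eta>))
    \<le> (1 - q) * (f \<eta> * g \<eta>) + q / 2 * (f (update x True \<eta>) * g (update x True \<eta>))
      + q / 2 * (f (update x False \<eta>) * g (update x False \<eta>))"
    by (rule chebyshev_three; (rule increasing_single_site[OF f, where x = x])?)
      (use q in \<open>auto intro!: \<eta> update_spins simp: update_other\<close>)
  then show ?thesis by (simp add: resample_def field_simps)
qed

lemma resample_mono:
  assumes "\<And>\<eta>. \<eta> \<in> spins \<Longrightarrow> f \<eta> \<le> g \<eta>" "0 \<le> q" "q \<le> 1" "\<eta> \<in> spins"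
  shows "resample q x f \<eta> \<le> resample q x g \<eta>"
  unfolding resample_def using assms update_spins
  by (intro add_mono mult_left_mono divide_right_mono) auto

text \<open>Harris' inequality for the discrete dynamics from a fixed start. The inequality for the
  later updates is inserted under the first kernel, whose own inequality applies because the later
  kernels keep f and g increasing.\<close>

lemma resamples_mult:
  assumes f: "increasing f" "increasing g" and q: "0 \<le> q" "q \<le> 1"
  shows "\<eta> \<in> spins \<Longrightarrow> resamples q xs f \<eta> * resamples q xs g \<eta> \<le> resamples q xs (\<lambda>\<eta>. f \<eta> * g \<eta>) \<eta>"
proof (induction xs arbitrary: \<eta>)
  case (Cons x xs)
  have "resample q x (resamples q xs f) \<eta> * resample q x (resamples q xs g) \<eta>
    \<le> resample q x (\<lambda>\<eta>. resamples q xs f \<eta> * resamples q xs g \<eta>) \<eta>"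
    using f q Cons by (intro resample_mult increasing_resamples)
  also have "\<dots> \<le> resample q x (resamples q xs (\<lambda>\<eta>. f \<eta> * g \<eta>)) \<eta>"
    using q Cons by (intro resample_mono) auto
  finally show ?case by simp
qed auto

section \<open>Locality and first order expansion of the update operators\<close>

lemma resamples_append: "resamples q (xs @ ys) f = resamples q xs (resamples q ys f)"
  by (induction xs) auto

lemma resample_eq_drift: "resample q x f \<eta> = f \<eta> + q * drift x f \<eta>"
  by (simp add: resample_def drift_def algebra_simps)

lemma resamples_add: "resamples q xs (\<lambda>\<eta>. f \<eta> + g \<eta>) = (\<lambda>\<eta>. resamples q xs f \<eta> + resamples q xs g \<eta>)"
  by (induction xs) (auto simp: resample_def fun_eq_iff algebra_simps add_divide_distrib)

lemma resamples_cmult: "resamples q xs (\<lambda>\<eta>. c * f \<eta>) = (\<lambda>\<eta>. c * resamples q xs f \<eta>)"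
  by (induction xs) (auto simp: resample_def fun_eq_iff algebra_simps add_divide_distrib)

lemma cylinder_mono: "cylinder S f \<Longrightarrow> S \<subseteq> S' \<Longrightarrow> cylinder S' f"
  unfolding cylinder_def by blast

lemma drift_outside: "cylinder S f \<Longrightarrow> x \<notin> S \<Longrightarrow> drift x f \<eta> = 0"
proof -
  assume "cylinder S f" "x \<notin> S"
  then have "f (update x c \<eta>) = f \<eta>" for c
    unfolding cylinder_def by (metis update_def fun_upd_other)
  then show ?thesis by (simp add: drift_def)
qed

lemma cylinder_update:
  assumes "cylinder S f"
  shows "cylinder (S \<union> ({x} \<union> neighbours x)) (\<lambda>\<eta>. f (update x c \<eta>))"
  unfolding cylinder_def
proof (intro allI impI)
  fix \<eta> \<zeta> :: config assume a: "\<forall>y\<in>S \<union> ({x} \<union> neighbours x). \<eta> y = \<zeta> y"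
  have "updated_spin c \<eta> x = updated_spin c \<zeta> x"
    using a by (intro updated_spin_cong) auto
  then have "\<forall>y\<in>S. update x c \<eta> y = update x c \<zeta> y"
    using a by (simp add: update_def)
  then show "f (update x c \<eta>) = f (update x c \<zeta>)"
    using assms unfolding cylinder_def by blast
qed

lemma cylinder_comb:
  "cylinder S f \<Longrightarrow> cylinder S g \<Longrightarrow> cylinder S (\<lambda>\<eta>. F (f \<eta>) (g \<eta>))"
  unfolding cylinder_def by metis

lemma cylinder_drift:
  assumes "cylinder S f" shows "cylinder (S \<union> ({x} \<union> neighbours x)) (drift x f)"
  unfolding cylinder_def
proof (intro allI impI)
  fix \<eta> \<zeta> :: config assume a: "\<forall>y\<in>S \<union> ({x} \<union> neighbours x). \<eta> y = \<zeta> y"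
  then have "f (update x c \<eta>) = f (update x c \<zeta>)" for c
    using cylinder_update[OF assms, of x c] unfolding cylinder_def by blast
  moreover have "f \<eta> = f \<zeta>" using a assms unfolding cylinder_def by blast
  ultimately show "drift x f \<eta> = drift x f \<zeta>" by (simp add: drift_def)
qed

lemma cylinder_resample:
  assumes "cylinder S f" shows "cylinder (S \<union> ({x} \<union> neighbours x)) (resample q x f)"
  using cylinder_drift[OF assms, of x] cylinder_mono[OF assms, of "S \<union> ({x} \<union> neighbours x)"]
  unfolding cylinder_def resample_eq_drift by (metis Un_upper1)

lemma cylinder_resamples:
  assumes "finite S" "cylinder S f" shows "\<exists>S'. finite S' \<and> cylinder S' (resamples q xs f)"
proof (induction xs)
  case Nil
  then show ?case using assms by auto
next
  case (Cons x xs)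
  then obtain S' where "finite S'" "cylinder S' (resamples q xs f)" by blast
  from this(2) have "cylinder (S' \<union> ({x} \<union> neighbours x)) (resamples q (x # xs) f)"
    unfolding resamples.simps by (intro cylinder_resample)
  moreover have "finite (S' \<union> ({x} \<union> neighbours x))"
    using \<open>finite S'\<close> by simp
  ultimately show ?case by (intro exI[of _ "S' \<union> ({x} \<union> neighbours x)"] conjI)
qed

lemma drift_bound:
  fixes C :: real
  shows "(\<And>\<eta>. \<bar>f \<eta>\<bar> \<le> C) \<Longrightarrow> \<bar>drift x f \<eta>\<bar> \<le> 2 * C"
proof -
  assume a: "\<And>\<eta>. \<bar>f \<eta>\<bar> \<le> C"
  show ?thesis
    using a[of \<eta>] a[of "update x True \<eta>"] a[of "update x False \<eta>"] unfolding drift_def by (simp add: abs_le_iff field_simps)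
qed

lemma resample_bound:
  fixes q C :: real
  assumes "\<And>\<eta>. \<bar>f \<eta>\<bar> \<le> C" "0 \<le> q" "q \<le> 1" shows "\<bar>resample q x f \<eta>\<bar> \<le> C"
proof -
  have "\<bar>(f (update x True \<eta>) + f (update x False \<eta>)) / 2\<bar> \<le> C"
    using assms(1)[of "update x True \<eta>"] assms(1)[of "update x False \<eta>"] by (simp add: abs_le_iff field_simps)
  then have *: "\<bar>(1 - q) * f \<eta>\<bar> + \<bar>q * ((f (update x True \<eta>) + f (update x False \<eta>)) / 2)\<bar> \<le> (1 - q) * C + q * C"
    unfolding abs_mult using assms by (intro add_mono mult_mono) auto
  have "\<bar>resample q x f \<eta>\<bar> \<le> \<bar>(1 - q) * f \<eta>\<bar> + \<bar>q * ((f (update x True \<eta>) + f (update x False \<eta>)) / 2)\<bar>"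
    unfolding resample_def by (rule abs_triangle_ineq)
  also note *
  also have "(1 - q) * C + q * C = C" by (simp add: algebra_simps)
  finally show ?thesis .
qed

lemma resamples_bound:
  fixes q C :: real
  assumes "\<And>\<eta>. \<bar>f \<eta>\<bar> \<le> C" "0 \<le> q" "q \<le> 1" shows "\<bar>resamples q xs f \<eta>\<bar> \<le> C"
  by (induction xs arbitrary: \<eta>) (auto intro: resample_bound assms)

text \<open>Each listed site in S shifts the expectation by at most q times the bound
  \<open>2 * C\<close> on a drift; the other sites are invisible to f.\<close>

lemma resamples_diff_bound:
  fixes q C :: real
  assumes "finite S" "cylinder S f" and C: "\<And>\<eta>. \<bar>f \<eta>\<bar> \<le> C" and q: "0 \<le> q" "q \<le> 1"
  shows "distinct xs \<Longrightarrow> \<bar>resamples q xs f \<eta> - f \<eta>\<bar> \<le> q * (card (set xs \<inter> S) * (2 * C))"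
\<comment> \<open>Peeling from the right, because the last site acts on f itself and its effect is
  the explicit function \<open>drift x f\<close>.\<close>
proof (induction xs arbitrary: \<eta> rule: rev_induct)
  case (snoc x xs)
  have C0: "0 \<le> C" using C[of \<eta>] by linarith
  have "resamples q (xs @ [x]) f = (\<lambda>\<eta>. resamples q xs f \<eta> + q * resamples q xs (drift x f) \<eta>)"
    unfolding resamples_append using resamples_add resamples_cmult
    by (simp add: resample_eq_drift[abs_def])
  then have e: "resamples q (xs @ [x]) f \<eta> - f \<eta> = (resamples q xs f \<eta> - f \<eta>) + q * resamples q xs (drift x f) \<eta>"
    by simp
  show ?case
  proof (cases "x \<in> S")
    case True
    have "\<bar>resamples q xs (drift x f) \<eta>\<bar> \<le> 2 * C"
      using q by (intro resamples_bound drift_bound C)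
    then have "\<bar>q * resamples q xs (drift x f) \<eta>\<bar> \<le> q * (2 * C)"
      using q by (simp add: abs_mult mult_left_mono)
    moreover have "\<bar>resamples q xs f \<eta> - f \<eta>\<bar> \<le> q * (card (set xs \<inter> S) * (2 * C))"
      using snoc by auto
    moreover have "card (set (xs @ [x]) \<inter> S) = Suc (card (set xs \<inter> S))"
      using snoc True assms(1) by (simp add: Int_insert_left)
    ultimately show ?thesis unfolding e by (simp add: algebra_simps abs_le_iff)
  next
    case False
    have "drift x f = (\<lambda>_. 0)" using drift_outside[OF assms(2) False] by auto
    moreover have "resamples q xs (\<lambda>_. 0) = (\<lambda>_. 0)"
      using resamples_cmult[of q xs 0 f] by simp
    ultimately have "resamples q (xs @ [x]) f \<eta> - f \<eta> = resamples q xs f \<eta> - f \<eta>"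
      unfolding e by simp
    moreover have "set (xs @ [x]) \<inter> S = set xs \<inter> S" using False by auto
    ultimately show ?thesis using snoc by auto
  qed
qed auto

text \<open>First order expansion; the error does not depend on the list of updated sites because
  sites outside the support of the function contribute nothing.\<close>

lemma resamples_generator:
  fixes q C :: real
  assumes S: "finite S" "cylinder S f" and C: "\<And>\<eta>. \<bar>f \<eta>\<bar> \<le> C" and q: "0 \<le> q" "q \<le> 1"
  shows "distinct xs \<Longrightarrow> \<bar>resamples q xs f \<eta> - f \<eta> - q * generator (set xs \<inter> S) f \<eta>\<bar>
    \<le> q\<^sup>2 * (card (set xs \<inter> S) * ((card S + 5) * (4 * C)))"
proof (induction xs arbitrary: \<eta> rule: rev_induct)
  case (snoc x xs)
  have C0: "0 \<le> C" using C[of \<eta>] by linarith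
  have "resamples q (xs @ [x]) f = (\<lambda>\<eta>. resamples q xs f \<eta> + q * resamples q xs (drift x f) \<eta>)"
    unfolding resamples_append using resamples_add resamples_cmult
    by (simp add: resample_eq_drift[abs_def])
  then have e: "resamples q (xs @ [x]) f \<eta> - f \<eta> = (resamples q xs f \<eta> - f \<eta>) + q * resamples q xs (drift x f) \<eta>"
    by simp
  show ?case
  proof (cases "x \<in> S")
    case True
    \<comment> \<open>\<open>drift x f\<close> sees at most five sites more than f and is bounded by
      \<open>2 * C\<close>; hence \<open>card S + 5\<close> and \<open>4 * C\<close>.\<close>
    let ?S = "S \<union> ({x} \<union> neighbours x)"
    have "card (set xs \<inter> ?S) \<le> card ?S" using S by (intro card_mono) auto
    also have "\<dots> \<le> card S + card ({x} \<union> neighbours x)" by (rule card_Un_le)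
    also have "card ({x} \<union> neighbours x) = 5" by (simp add: card_neighbours)
    finally have card: "card (set xs \<inter> ?S) \<le> card S + 5" .
    have "\<bar>resamples q xs (drift x f) \<eta> - drift x f \<eta>\<bar> \<le> q * (card (set xs \<inter> ?S) * (2 * (2 * C)))"
      using S q snoc by (intro resamples_diff_bound cylinder_drift drift_bound C) auto
    also have "\<dots> \<le> q * ((card S + 5) * (4 * C))"
      using card q C0 by (intro mult_left_mono) (auto intro!: mult_right_mono)
    finally have "\<bar>q * (resamples q xs (drift x f) \<eta> - drift x f \<eta>)\<bar> \<le> q * (q * ((card S + 5) * (4 * C)))"
      unfolding abs_mult using q by (intro mult_mono) auto
    moreover have "\<bar>resamples q xs f \<eta> - f \<eta> - q * generator (set xs \<inter> S) f \<eta>\<bar>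
      \<le> q\<^sup>2 * (card (set xs \<inter> S) * ((card S + 5) * (4 * C)))"
      using snoc by auto
    moreover have i: "set (xs @ [x]) \<inter> S = insert x (set xs \<inter> S)" using True by auto
    moreover have "generator (set (xs @ [x]) \<inter> S) f \<eta> = drift x f \<eta> + generator (set xs \<inter> S) f \<eta>"
      unfolding i generator_def using snoc S by simp
    moreover have "card (set (xs @ [x]) \<inter> S) = Suc (card (set xs \<inter> S))"
      unfolding i using snoc S by simp
    ultimately show ?thesis unfolding e by (simp add: algebra_simps abs_le_iff power2_eq_square)
  next
    case False
    have "drift x f = (\<lambda>_. 0)" using drift_outside[OF assms(2) False] by auto
    moreover have "resamples q xs (\<lambda>_. 0) = (\<lambda>_. 0)"
      using resamples_cmult[of q xs 0 f] by simp
    ultimately have "resamples q (xs @ [x]) f \<eta> - f \<eta> = resamples q xs f \<eta> - f \<eta>"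
      unfolding e by simp
    moreover have "set (xs @ [x]) \<inter> S = set xs \<inter> S" using False by auto
    ultimately show ?thesis using snoc by auto
  qed
qed (auto simp: generator_def)

lemma cylinder_generator:
  assumes "cylinder S f"
  shows "cylinder (\<Union>x\<in>S. {x} \<union> neighbours x) (generator S f)"
  unfolding cylinder_def
proof (intro allI impI)
  fix \<eta> \<zeta> :: config assume a: "\<forall>y\<in>\<Union>x\<in>S. {x} \<union> neighbours x. \<eta> y = \<zeta> y"
  have S: "\<forall>y\<in>S. \<eta> y = \<zeta> y" using a by auto
  have "drift x f \<eta> = drift x f \<zeta>" if "x \<in> S" for x
  proof -
    have "\<forall>y\<in>S \<union> ({x} \<union> neighbours x). \<eta> y = \<zeta> y"
      using a S that by (metis UN_I UnE)
    then show ?thesis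
      by (intro cylinderD[OF cylinder_drift[OF assms, of x]]) blast
  qed
  then show "generator S f \<eta> = generator S f \<zeta>"
    unfolding generator_def by (intro sum.cong) auto
qed

lemma generator_bound:
  fixes C :: real
  assumes "\<And>\<eta>. \<bar>f \<eta>\<bar> \<le> C" shows "\<bar>generator S f \<eta>\<bar> \<le> card S * (2 * C)"
proof -
  have "\<bar>generator S f \<eta>\<bar> \<le> (\<Sum>x\<in>S. \<bar>drift x f \<eta>\<bar>)"
    unfolding generator_def by (rule sum_abs)
  also have "\<dots> \<le> (\<Sum>x\<in>S. 2 * C)" using drift_bound[OF assms] by (intro sum_mono)
  finally show ?thesis by simp
qed

section \<open>Reducible configurations\<close>

definition flip :: "site \<Rightarrow> config \<Rightarrow> config" where
  "flip x \<eta> = \<eta>(x := - \<eta> x)"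

text \<open>A flip at a site with k disagreeing neighbours changes the number of disagreeing pairs
  by 4 - 2 k, so 2 is the threshold for a flip of positive rate and 3 the threshold for a loss of
  energy.\<close>

inductive reducible :: "site set \<Rightarrow> config \<Rightarrow> bool" for W where
  drop: "x \<in> W \<Longrightarrow> disagreements \<eta> x \<ge> 3 \<Longrightarrow> reducible W \<eta>"
| move: "x \<in> W \<Longrightarrow> disagreements \<eta> x \<ge> 2 \<Longrightarrow> reducible W (flip x \<eta>) \<Longrightarrow> reducible W \<eta>"

lemma disagreements_ge:
  assumes "N \<subseteq> neighbours x" "\<And>y. y \<in> N \<Longrightarrow> \<eta> y \<noteq> \<eta> x"
  shows "card N \<le> disagreements \<eta> x"
  unfolding disagreements_def by (intro card_mono) (use assms in auto)

text \<open>Flipping the sites of \<open>K\<close> in increasing order of \<open>r\<close>: every site has at least two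
  disagreeing neighbours when its turn comes, and the site \<open>c\<close> has three.\<close>

lemma reducible_sequence:
  fixes r :: "site \<Rightarrow> int"
  assumes "finite K" "K \<subseteq> W" "\<eta> \<in> spins"
    and "\<And>x. x \<in> K \<Longrightarrow> \<eta> x = a"
    and "\<And>x. x \<in> K \<Longrightarrow> \<exists>N\<subseteq>neighbours x. 2 \<le> card N \<and> (\<forall>y\<in>N. \<eta> y = - a \<or> (y \<in> K \<and> r y < r x))"
    and "c \<in> K" "\<exists>N\<subseteq>neighbours c. 3 \<le> card N \<and> (\<forall>y\<in>N. \<eta> y = - a \<or> (y \<in> K \<and> r y < r c))"
  shows "reducible W \<eta>"
  using assms
proof (induction "card K" arbitrary: K \<eta>)
  case 0
  then show ?case by simp
next
  case (Suc n)
  have aa: "- a \<noteq> a" using spinsD[OF \<open>\<eta> \<in> spins\<close>, of c] Suc.prems(4)[OF \<open>c \<in> K\<close>] by auto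
  \<comment> \<open>A site of least rank has no predecessor in K, so its witnesses carry the
    opposite sign already.\<close>
  obtain x where x: "x \<in> K" "\<And>y. y \<in> K \<Longrightarrow> r x \<le> r y"
    using arg_min_if_finite(1)[OF Suc.prems(1), of r] arg_min_least[OF Suc.prems(1), of _ r] \<open>c \<in> K\<close>
    by (metis empty_iff)
  have *: "card N \<le> disagreements \<eta> x"
    if "N \<subseteq> neighbours x" "\<forall>y\<in>N. \<eta> y = - a \<or> (y \<in> K \<and> r y < r x)" for N
  proof (rule disagreements_ge[OF that(1)])
    fix y assume "y \<in> N"
    then have "\<eta> y = - a" using that(2) x(2)[of y] by auto
    then show "\<eta> y \<noteq> \<eta> x" using aa Suc.prems(4)[OF x(1)] by simp
  qed
  show ?case
  proof (cases "x = c")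
    case True
    then obtain N where "N \<subseteq> neighbours x" "3 \<le> card N"
      "\<forall>y\<in>N. \<eta> y = - a \<or> (y \<in> K \<and> r y < r x)" using Suc.prems(7) by blast
    then have "3 \<le> disagreements \<eta> x" using * by fastforce
    then show ?thesis using x(1) \<open>K \<subseteq> W\<close> by (metis reducible.drop subsetD)
  next
    case False
    obtain N where "N \<subseteq> neighbours x" "2 \<le> card N"
      "\<forall>y\<in>N. \<eta> y = - a \<or> (y \<in> K \<and> r y < r x)" using Suc.prems(5)[OF x(1)] by blast
    then have 2: "2 \<le> disagreements \<eta> x" using * by fastforce
    have s: "flip x \<eta> \<in> spins" using \<open>\<eta> \<in> spins\<close> unfolding flip_def spins_def by auto
    \<comment> \<open>Flipping x moves it from the second alternative to the first, so the
      hypotheses survive for \<open>K - {x}\<close>.\<close>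
    have good: "flip x \<eta> z = - a \<or> (z \<in> K - {x} \<and> r z < r y)"
      if "\<eta> z = - a \<or> (z \<in> K \<and> r z < r y)" for y z
      using that aa Suc.prems(4)[OF x(1)] by (cases "z = x") (auto simp: flip_def)
    have "reducible W (flip x \<eta>)"
    proof (rule Suc.hyps(1))
      show "n = card (K - {x})" using Suc.hyps(2) x(1) Suc.prems(1) by simp
      show "flip x \<eta> y = a" if "y \<in> K - {x}" for y
        using that Suc.prems(4) by (auto simp: flip_def)
      show "\<exists>N\<subseteq>neighbours y. 2 \<le> card N \<and> (\<forall>z\<in>N. flip x \<eta> z = - a \<or> (z \<in> K - {x} \<and> r z < r y))"
        if "y \<in> K - {x}" for y
      proof -
        have "y \<in> K" using that by simp
        from Suc.prems(5)[OF this] obtain N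
          where N: "N \<subseteq> neighbours y" "2 \<le> card N" "\<forall>z\<in>N. \<eta> z = - a \<or> (z \<in> K \<and> r z < r y)"
          by metis
        have "\<forall>z\<in>N. flip x \<eta> z = - a \<or> (z \<in> K - {x} \<and> r z < r y)"
          using good N(3) by simp
        with N(1,2) show ?thesis by (intro exI[of _ N] conjI)
      qed
      show "\<exists>N\<subseteq>neighbours c. 3 \<le> card N \<and> (\<forall>z\<in>N. flip x \<eta> z = - a \<or> (z \<in> K - {x} \<and> r z < r c))"
      proof -
        obtain N where N: "N \<subseteq> neighbours c" "3 \<le> card N" "\<forall>z\<in>N. \<eta> z = - a \<or> (z \<in> K \<and> r z < r c)"
          using Suc.prems(7) by metis
        have "\<forall>z\<in>N. flip x \<eta> z = - a \<or> (z \<in> K - {x} \<and> r z < r c)"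
          using good N(3) by simp
        with N(1,2) show ?thesis by (intro exI[of _ N] conjI)
      qed
      show "c \<in> K - {x}" using \<open>c \<in> K\<close> False by simp
      show "finite (K - {x})" using Suc.prems(1) by simp
      show "K - {x} \<subseteq> W" using Suc.prems(2) by blast
    qed (rule s)
    then show ?thesis using x(1) \<open>K \<subseteq> W\<close> 2 by (metis reducible.move subsetD)
  qed
qed

section \<open>Corners and staircases of plus sites\<close>

definition corner :: "config \<Rightarrow> site \<Rightarrow> bool" where
  "corner \<eta> z \<longleftrightarrow> \<eta> z = 1 \<and> \<eta> (fst z + 1, snd z) = -1 \<and> \<eta> (fst z, snd z + 1) = -1"

definition staircase :: "config \<Rightarrow> nat \<Rightarrow> (nat \<Rightarrow> site) \<Rightarrow> bool" where
  "staircase \<eta> n f \<longleftrightarrow> (\<forall>k\<le>n. \<eta> (f k) = 1) \<and>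
     (\<forall>k<n. f (Suc k) = (fst (f k) + 1, snd (f k)) \<or> f (Suc k) = (fst (f k), snd (f k) - 1))"

text \<open>Both kinds of step raise the coordinate difference by one, so two staircases can be
  compared diagonal by diagonal.\<close>

lemma staircase_diff:
  "staircase \<eta> n f \<Longrightarrow> k \<le> n \<Longrightarrow> fst (f k) - snd (f k) = fst (f 0) - snd (f 0) + int k"
proof (induction k)
  case (Suc k)
  then have "f (Suc k) = (fst (f k) + 1, snd (f k)) \<or> f (Suc k) = (fst (f k), snd (f k) - 1)"
    unfolding staircase_def by simp
  then show ?case using Suc by (elim disjE) simp_all
qed simp

lemma staircase_mono:
  assumes "staircase \<eta> n f" "k \<le> l" "l \<le> n"
  shows "fst (f k) \<le> fst (f l)" "snd (f l) \<le> snd (f k)"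
proof -
  have "fst (f k) \<le> fst (f l) \<and> snd (f l) \<le> snd (f k)"
    using assms(2,3)
  proof (induction rule: dec_induct)
    case (step m)
    then have "f (Suc m) = (fst (f m) + 1, snd (f m)) \<or> f (Suc m) = (fst (f m), snd (f m) - 1)"
      using assms(1) unfolding staircase_def by simp
    then show ?case using step by (elim disjE) simp_all
  qed simp
  then show "fst (f k) \<le> fst (f l)" "snd (f l) \<le> snd (f k)" by auto
qed

text \<open>Filling the region between the two coordinate axes and a staircase, starting from the
  staircase: the site \<open>(1, 0)\<close> has the plus site \<open>(0, 0)\<close> as a third disagreeing neighbour.\<close>

lemma reducible_below_staircase:
  assumes \<eta>: "\<eta> \<in> spins" and f: "staircase \<eta> n f"
    and f0: "fst (f 0) = 0" and fn: "snd (f n) = 0" "fst (f n) \<le> M" "snd (f 0) \<le> M"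
    and O: "\<eta> (0, 0) = 1" "\<eta> (1, 0) = -1" and pos: "fst (f n) \<ge> 1"
  shows "reducible ({0..M} \<times> {0..M}) \<eta>"
proof -
  define below where "below z \<longleftrightarrow> (\<exists>k\<le>n. fst z \<le> fst (f k) \<and> snd z \<le> snd (f k))" for z :: site
  define K where "K = {z. 0 \<le> fst z \<and> 0 \<le> snd z \<and> \<eta> z = -1 \<and> below z}"
  have KW: "K \<subseteq> {0..M} \<times> {0..M}"
  proof
    fix z assume "z \<in> K"
    then obtain k where k: "k \<le> n" "fst z \<le> fst (f k)" "snd z \<le> snd (f k)" "0 \<le> fst z" "0 \<le> snd z"
      unfolding K_def below_def by blast
    have "fst (f k) \<le> fst (f n)" "snd (f k) \<le> snd (f 0)"
      using staircase_mono[OF f] k by auto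
    with k fn show "z \<in> {0..M} \<times> {0..M}" by (cases z) auto
  qed
  \<comment> \<open>The last staircase site dominating z has the height of z: either it is the end
    point at height 0, or the next step goes down past z. Since its spin differs from that of z, it
    lies strictly to the right of z.\<close>
  have right: "below (fst z + 1, snd z)" if z: "z \<in> K" for z
  proof -
    have ex: "\<exists>k. k \<le> n \<and> fst z \<le> fst (f k) \<and> snd z \<le> snd (f k)" using z unfolding K_def below_def by auto
    define k where "k = (GREATEST k. k \<le> n \<and> fst z \<le> fst (f k) \<and> snd z \<le> snd (f k))"
    have k: "k \<le> n" "fst z \<le> fst (f k)" "snd z \<le> snd (f k)"
      using GreatestI_ex_nat[OF ex, of n] unfolding k_def by auto
    have "z \<noteq> f k" using z k(1) f unfolding K_def staircase_def by auto
    show ?thesis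
    proof (cases "k = n")
      case True
      then have "snd z = snd (f k)" using k fn z unfolding K_def by auto
      with \<open>z \<noteq> f k\<close> have "fst z \<noteq> fst (f k)" by (metis prod_eqI)
      then show ?thesis unfolding below_def using k by (intro exI[of _ k]) auto
    next
      case False
      then have "k < n" using k by simp
      have "\<not> (fst z \<le> fst (f (Suc k)) \<and> snd z \<le> snd (f (Suc k)))"
      proof
        assume "fst z \<le> fst (f (Suc k)) \<and> snd z \<le> snd (f (Suc k))"
        then have "Suc k \<le> n \<and> fst z \<le> fst (f (Suc k)) \<and> snd z \<le> snd (f (Suc k))"
          using \<open>k < n\<close> by simp
        from Greatest_le_nat[where P = "\<lambda>k. k \<le> n \<and> fst z \<le> fst (f k) \<and> snd z \<le> snd (f k)"
          and b = n, OF this]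
        have "Suc k \<le> k" unfolding k_def[symmetric] by simp
        then show False by simp
      qed
      moreover have "f (Suc k) = (fst (f k) + 1, snd (f k)) \<or> f (Suc k) = (fst (f k), snd (f k) - 1)"
        using f \<open>k < n\<close> unfolding staircase_def by auto
      ultimately have "snd z = snd (f k)" using k by (elim disjE) simp_all
      with \<open>z \<noteq> f k\<close> have "fst z \<noteq> fst (f k)" by (metis prod_eqI)
      then show ?thesis unfolding below_def using k by (intro exI[of _ k]) auto
    qed
  qed
  \<comment> \<open>The first staircase site dominating z lies in the column of z, either because
    the staircase starts on the axis or because that site was reached by a step to the
    right.\<close>
  have up: "below (fst z, snd z + 1)" if z: "z \<in> K" for z
  proof -
    have ex: "\<exists>k. k \<le> n \<and> fst z \<le> fst (f k) \<and> snd z \<le> snd (f k)" using z unfolding K_def below_def by auto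
    define k where "k = (LEAST k. k \<le> n \<and> fst z \<le> fst (f k) \<and> snd z \<le> snd (f k))"
    have k: "k \<le> n" "fst z \<le> fst (f k)" "snd z \<le> snd (f k)"
      using LeastI_ex[OF ex] unfolding k_def by auto
    have "z \<noteq> f k" using z k(1) f unfolding K_def staircase_def by auto
    show ?thesis
    proof (cases k)
      case 0
      then have "fst z = fst (f k)" using k f0 z unfolding K_def by auto
      with \<open>z \<noteq> f k\<close> have "snd z \<noteq> snd (f k)" by (metis prod_eqI)
      then show ?thesis unfolding below_def using k by (intro exI[of _ k]) auto
    next
      case (Suc l)
      have "\<not> (fst z \<le> fst (f l) \<and> snd z \<le> snd (f l))"
        using not_less_Least[of l "\<lambda>k. k \<le> n \<and> fst z \<le> fst (f k) \<and> snd z \<le> snd (f k)"] k Suc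
        unfolding k_def[symmetric] by auto
      moreover have "f (Suc l) = (fst (f l) + 1, snd (f l)) \<or> f (Suc l) = (fst (f l), snd (f l) - 1)"
        using f k Suc unfolding staircase_def by auto
      ultimately have "fst z = fst (f k)" using k Suc by (elim disjE) simp_all
      with \<open>z \<noteq> f k\<close> have "snd z \<noteq> snd (f k)" by (metis prod_eqI)
      then show ?thesis unfolding below_def using k by (intro exI[of _ k]) auto
    qed
  qed
  \<comment> \<open>Filling proceeds from the outer antidiagonals towards the origin, so the right
    and upper neighbours of a site are plus when its turn comes.\<close>
  let ?r = "\<lambda>z. - (fst z + snd z)"
  have good: "\<eta> y = - (-1) \<or> (y \<in> K \<and> ?r y < ?r z)"
    if "z \<in> K" "y = (fst z + 1, snd z) \<or> y = (fst z, snd z + 1)" for y z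
  proof -
    have "below y" "0 \<le> fst y" "0 \<le> snd y" "?r y < ?r z"
      using that right[of z] up[of z] unfolding K_def by auto
    then show ?thesis using spinsD[OF \<eta>, of y] unfolding K_def by auto
  qed
  have O': "(1, 0) \<in> K"
    unfolding K_def below_def using O pos fn by auto
  show ?thesis
  proof (rule reducible_sequence[where K = K and a = "-1" and c = "(1, 0)" and r = ?r])
    show "finite K" using KW by (rule finite_subset) auto
    fix z assume z: "z \<in> K"
    show "\<exists>N\<subseteq>neighbours z. 2 \<le> card N \<and> (\<forall>y\<in>N. \<eta> y = - (-1) \<or> (y \<in> K \<and> ?r y < ?r z))"
      using good[OF z]
      by (intro exI[of _ "{(fst z + 1, snd z), (fst z, snd z + 1)}"]) (auto simp: neighbours_alt)
  next
    show "\<exists>N\<subseteq>neighbours (1, 0). 3 \<le> card N \<and> (\<forall>y\<in>N. \<eta> y = - (-1) \<or> (y \<in> K \<and> ?r y < ?r (1, 0)))"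
      using good[OF O'] O
      by (intro exI[of _ "{(2, 0), (1, 1), (0, 0)}"]) (auto simp: neighbours_alt)
    show "\<eta> z = -1" if "z \<in> K" for z using that by (simp add: K_def)
  qed (fact KW \<eta> O')+
qed

lemma staircase_Cons:
  assumes "staircase \<eta> n f" "\<eta> z = 1" "f 0 = (fst z + 1, snd z) \<or> f 0 = (fst z, snd z - 1)"
  shows "staircase \<eta> (Suc n) (case_nat z f)"
  unfolding staircase_def
proof (intro conjI allI impI)
  fix k assume "k \<le> Suc n" then show "\<eta> (case_nat z f k) = 1"
    using assms unfolding staircase_def by (cases k) auto
next
  fix k assume "k < Suc n"
  then show "case_nat z f (Suc k) = (fst (case_nat z f k) + 1, snd (case_nat z f k)) \<or>
    case_nat z f (Suc k) = (fst (case_nat z f k), snd (case_nat z f k) - 1)"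
    using assms unfolding staircase_def by (cases k) auto
qed

lemma staircase_snoc:
  assumes "staircase \<eta> n f" "\<eta> z = 1" "z = (fst (f n) + 1, snd (f n)) \<or> z = (fst (f n), snd (f n) - 1)"
  shows "staircase \<eta> (Suc n) (f(Suc n := z))"
  using assms unfolding staircase_def by (auto simp: le_Suc_eq less_Suc_eq)

text \<open>If the plus path cannot be prolonged beyond the box, then the plus sites of the box
  from which a staircase leads to \<open>Q\<close> can be flipped one after the other.\<close>

lemma staircase_from_boundary:
  assumes \<eta>: "\<eta> \<in> spins" and W: "{a..b} \<times> {c..d} \<subseteq> W" and Q: "Q \<in> {a..b} \<times> {c..d}"
    "\<eta> Q = 1" "\<eta> (fst Q + 1, snd Q) = -1" and irr: "\<not> reducible W \<eta>"
  obtains n f where "staircase \<eta> n f" "f n = Q"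
    "fst (f 0) = a - 1 \<and> snd (f 0) \<in> {c..d} \<or> snd (f 0) = d + 1 \<and> fst (f 0) \<in> {a..b}"
proof (rule ccontr)
  note * = that
  assume neg: "\<not> thesis"
  define K where "K = {z \<in> {a..b} \<times> {c..d}. \<exists>n f. staircase \<eta> n f \<and> f 0 = z \<and> f n = Q}"
  \<comment> \<open>A plus site to the left of z or above it prolongs the staircase. As no staircase
    to Q starts on the boundary, this site is in the box, hence in K, with smaller rank.\<close>
  have good: "\<eta> y = - 1 \<or> (y \<in> K \<and> fst y - snd y < fst z - snd z)"
    if z: "z \<in> K" and y: "y = (fst z - 1, snd z) \<or> y = (fst z, snd z + 1)" for y z
  proof (cases "\<eta> y = 1")
    case True
    obtain n f where f: "staircase \<eta> n f" "f 0 = z" "f n = Q" using z unfolding K_def by auto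
    have s: "staircase \<eta> (Suc n) (case_nat y f)"
      by (rule staircase_Cons) (use f True y in auto)
    have "\<not> (fst y = a - 1 \<and> snd y \<in> {c..d} \<or> snd y = d + 1 \<and> fst y \<in> {a..b})"
      using neg *[OF s] f by auto
    then have "y \<in> {a..b} \<times> {c..d}" using y z unfolding K_def by (cases z; cases y) auto
    then have "y \<in> K" unfolding K_def using s f by (auto intro!: exI[of _ "Suc n"] exI[of _ "case_nat y f"])
    then show ?thesis using y by auto
  qed (use spinsD[OF \<eta>, of y] in auto)
  have QK: "Q \<in> K" unfolding K_def using Q by (auto simp: staircase_def intro!: exI[of _ 0] exI[of _ "\<lambda>_. Q"])
  have "reducible W \<eta>"
  proof (rule reducible_sequence[where K = K and a = 1 and c = Q and r = "\<lambda>z. fst z - snd z"])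
    show "finite K" unfolding K_def by (rule finite_subset[of _ "{a..b} \<times> {c..d}"]) auto
    show "\<eta> z = 1" if "z \<in> K" for z using that unfolding K_def staircase_def by auto
    fix z assume z: "z \<in> K"
    show "\<exists>N\<subseteq>neighbours z. 2 \<le> card N \<and> (\<forall>y\<in>N. \<eta> y = - 1 \<or> (y \<in> K \<and> fst y - snd y < fst z - snd z))"
      using good[OF z]
      by (intro exI[of _ "{(fst z - 1, snd z), (fst z, snd z + 1)}"]) (auto simp: neighbours_alt)
  next
    \<comment> \<open>The minus site to the right of Q supplies the third disagreement.\<close>
    show "\<exists>N\<subseteq>neighbours Q. 3 \<le> card N \<and> (\<forall>y\<in>N. \<eta> y = - 1 \<or> (y \<in> K \<and> fst y - snd y < fst Q - snd Q))"
      using good[OF QK] Q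
      by (intro exI[of _ "{(fst Q - 1, snd Q), (fst Q, snd Q + 1), (fst Q + 1, snd Q)}"])
        (auto simp: neighbours_alt)
    show "K \<subseteq> W" using W unfolding K_def by blast
  qed (fact \<eta> QK)+
  with irr show False by simp
qed

text \<open>The mirror image under exchange of the coordinates, which reverses staircases: they now
  grow forward from P, and the minus site above P supplies the third disagreement.\<close>

lemma staircase_to_boundary:
  assumes \<eta>: "\<eta> \<in> spins" and W: "{a..b} \<times> {c..d} \<subseteq> W" and P: "P \<in> {a..b} \<times> {c..d}"
    "\<eta> P = 1" "\<eta> (fst P, snd P + 1) = -1" and irr: "\<not> reducible W \<eta>"
  obtains n f where "staircase \<eta> n f" "f 0 = P"
    "snd (f n) = c - 1 \<and> fst (f n) \<in> {a..b} \<or> fst (f n) = b + 1 \<and> snd (f n) \<in> {c..d}"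
proof (rule ccontr)
  note * = that
  assume neg: "\<not> thesis"
  define K where "K = {z \<in> {a..b} \<times> {c..d}. \<exists>n f. staircase \<eta> n f \<and> f 0 = P \<and> f n = z}"
  have good: "\<eta> y = - 1 \<or> (y \<in> K \<and> snd y - fst y < snd z - fst z)"
    if z: "z \<in> K" and y: "y = (fst z + 1, snd z) \<or> y = (fst z, snd z - 1)" for y z
  proof (cases "\<eta> y = 1")
    case True
    obtain n f where f: "staircase \<eta> n f" "f 0 = P" "f n = z" using z unfolding K_def by auto
    have s: "staircase \<eta> (Suc n) (f(Suc n := y))"
      by (rule staircase_snoc) (use f True y in auto)
    have "\<not> (snd y = c - 1 \<and> fst y \<in> {a..b} \<or> fst y = b + 1 \<and> snd y \<in> {c..d})"
      using neg *[OF s] f by auto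
    then have "y \<in> {a..b} \<times> {c..d}" using y z unfolding K_def by (cases z; cases y) auto
    then have "y \<in> K" unfolding K_def using s f by (auto intro!: exI[of _ "Suc n"] exI[of _ "f(Suc n := y)"])
    then show ?thesis using y by auto
  qed (use spinsD[OF \<eta>, of y] in auto)
  have PK: "P \<in> K" unfolding K_def using P by (auto simp: staircase_def intro!: exI[of _ 0] exI[of _ "\<lambda>_. P"])
  have "reducible W \<eta>"
  proof (rule reducible_sequence[where K = K and a = 1 and c = P and r = "\<lambda>z. snd z - fst z"])
    show "finite K" unfolding K_def by (rule finite_subset[of _ "{a..b} \<times> {c..d}"]) auto
    show "\<eta> z = 1" if "z \<in> K" for z using that unfolding K_def staircase_def by auto
    fix z assume z: "z \<in> K"
    show "\<exists>N\<subseteq>neighbours z. 2 \<le> card N \<and> (\<forall>y\<in>N. \<eta> y = - 1 \<or> (y \<in> K \<and> snd y - fst y < snd z - fst z))"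
      using good[OF z]
      by (intro exI[of _ "{(fst z + 1, snd z), (fst z, snd z - 1)}"]) (auto simp: neighbours_alt)
  next
    show "\<exists>N\<subseteq>neighbours P. 3 \<le> card N \<and> (\<forall>y\<in>N. \<eta> y = - 1 \<or> (y \<in> K \<and> snd y - fst y < snd P - fst P))"
      using good[OF PK] P
      by (intro exI[of _ "{(fst P + 1, snd P), (fst P, snd P - 1), (fst P, snd P + 1)}"])
        (auto simp: neighbours_alt)
    show "K \<subseteq> W" using W unfolding K_def by blast
  qed (fact \<eta> PK)+
  with irr show False by simp
qed

text \<open>A discrete intermediate value argument. On diagonals of constant coordinate difference,
  the first coordinate of f minus that of g changes by at most one per step; it is nonpositive where
  g starts and nonnegative where f ends. So the paths share a site, and h follows f up to it and g
  afterwards.\<close>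

lemma staircases_cross:
  assumes f: "staircase \<eta> n f" "f 0 = (0, i)" "f n = (j, y)" "y \<le> i"
    and g: "staircase \<eta> m g" "g 0 = (x, i)" "g m = (j, 0)" "0 \<le> x" "0 \<le> y"
  obtains N h where "staircase \<eta> N h" "h 0 = (0, i)" "h N = (j, 0)"
proof -
  have df: "fst (f k) - snd (f k) = int k - i" if "k \<le> n" for k
    using staircase_diff[OF f(1) that] f by simp
  have dg: "fst (g k) - snd (g k) = x - i + int k" if "k \<le> m" for k
    using staircase_diff[OF g(1) that] g by simp
  have xj: "x \<le> j" using staircase_mono(1)[OF g(1), of 0 m] g by simp
  \<comment> \<open>The path g starts x diagonals later than f, so \<open>f (X + l)\<close> and
    \<open>g l\<close> lie on the same diagonal.\<close>
  define X where "X = nat x"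
  have X: "int X = x" using g by (simp add: X_def)
  have n: "int n = j - y + i" using df[of n] f by simp
  have m: "int m = j - x + i" using dg[of m] g by simp
  have Xn: "X \<le> n" using X n xj f by linarith
  have nm: "n - X \<le> m" using X n m Xn g by linarith
  define e where "e l = fst (f (X + l)) - fst (g l)" for l
  have step: "\<bar>e (Suc l) - e l\<bar> \<le> 1" if "l < n - X" for l
  proof -
    have "f (Suc (X + l)) = (fst (f (X + l)) + 1, snd (f (X + l))) \<or> f (Suc (X + l)) = (fst (f (X + l)), snd (f (X + l)) - 1)"
      using f(1) that unfolding staircase_def by auto
    moreover have "g (Suc l) = (fst (g l) + 1, snd (g l)) \<or> g (Suc l) = (fst (g l), snd (g l) - 1)"
      using g(1) that nm unfolding staircase_def by auto
    ultimately show ?thesis unfolding e_def by (elim disjE) simp_all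
  qed
  have "\<exists>l\<ge>0. l \<le> n - X \<and> e l = 0"
  proof (rule nat_intermed_int_val)
    show "\<forall>l. 0 \<le> l \<and> l < n - X \<longrightarrow> \<bar>e (Suc l) - e l\<bar> \<le> 1" using step by auto
    have "snd (f X) \<le> i" using staircase_mono(2)[OF f(1), of 0 X] Xn f by simp
    then show "e 0 \<le> 0" unfolding e_def using df[OF Xn] g X by simp
    have "fst (g (n - X)) \<le> j" using staircase_mono(1)[OF g(1), of "n - X" m] nm g by simp
    then show "0 \<le> e (n - X)" unfolding e_def using Xn f by simp
  qed simp
  then obtain l where l: "l \<le> n - X" "fst (f (X + l)) = fst (g l)" unfolding e_def by auto
  have "snd (f (X + l)) = snd (g l)" using df[of "X + l"] dg[of l] l X nm Xn by linarith
  with l have eq: "f (X + l) = g l" by (metis prod_eqI)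
  define h where "h k = (if k \<le> X + l then f k else g (k - X))" for k
  have "staircase \<eta> (X + m) h"
    unfolding staircase_def
  proof (intro conjI allI impI)
    fix k assume "k \<le> X + m"
    then show "\<eta> (h k) = 1" using f(1) g(1) l Xn unfolding h_def staircase_def by auto
  next
    fix k assume k: "k < X + m"
    show "h (Suc k) = (fst (h k) + 1, snd (h k)) \<or> h (Suc k) = (fst (h k), snd (h k) - 1)"
    proof (cases "k < X + l")
      case True
      then have "k < n" using l Xn by simp
      with True show ?thesis using f(1) unfolding h_def staircase_def by auto
    next
      case False
      have "h k = g (k - X)" using False eq unfolding h_def by (cases "k = X + l") auto
      moreover have "h (Suc k) = g (Suc (k - X))" using False unfolding h_def by (simp add: Suc_diff_le)
      moreover have "k - X < m" using k False by linarith
      ultimately show ?thesis using g(1) unfolding staircase_def by auto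
    qed
  qed
  moreover have "h 0 = (0, i)" using f by (simp add: h_def)
  moreover have "h (X + m) = (j, 0)"
    using g l nm eq by (cases "m = l") (auto simp: h_def)
  ultimately show ?thesis using that by blast
qed

text \<open>A staircase from the left axis to the bottom axis already makes the box reducible. If
  the box were irreducible, the staircase ending in the right corner would have to enter from row i
  and the one starting in the upper corner would have to leave through column j. These two cross,
  which produces the excluded staircase after all.\<close>

lemma corners_reducible:
  assumes \<eta>: "\<eta> \<in> spins" and O: "corner \<eta> (0, 0)" and Q: "corner \<eta> (j, 0)" "1 \<le> j" "j \<le> M"
    and P: "corner \<eta> (0, i)" "1 \<le> i" "i \<le> M"
  shows "reducible ({0..M} \<times> {0..M}) \<eta>"
proof (rule ccontr)
  assume irr: "\<not> ?thesis"
  have o: "\<eta> (0, 0) = 1" "\<eta> (1, 0) = -1" "\<eta> (0, 1) = -1" using O by (auto simp: corner_def)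
  have no: False if "staircase \<eta> n f" "fst (f 0) = 0" "snd (f n) = 0" "fst (f n) \<le> M" "snd (f 0) \<le> M" "fst (f n) \<ge> 1" for n f
    using reducible_below_staircase[OF \<eta> that(1-5) o(1,2) that(6)] irr by simp
  have 1: "{1..j} \<times> {0..i - 1} \<subseteq> {0..M} \<times> {0..M}" using Q P by auto
  obtain m g where g: "staircase \<eta> m g" "g m = (j, 0)"
    "fst (g 0) = 1 - 1 \<and> snd (g 0) \<in> {0..i - 1} \<or> snd (g 0) = i - 1 + 1 \<and> fst (g 0) \<in> {1..j}"
    by (rule staircase_from_boundary[OF \<eta> 1 _ _ _ irr, of "(j, 0)"])
      (use Q P in \<open>simp_all add: corner_def\<close>)
  have "fst (g 0) \<noteq> 0" using no[OF g(1)] g P Q by auto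
  then have g0: "g 0 = (fst (g 0), i)" "1 \<le> fst (g 0)" using g(3) by (auto intro: prod_eqI)
  have 2: "{0..j - 1} \<times> {1..i} \<subseteq> {0..M} \<times> {0..M}" using Q P by auto
  obtain n f where f: "staircase \<eta> n f" "f 0 = (0, i)"
    "snd (f n) = 1 - 1 \<and> fst (f n) \<in> {0..j - 1} \<or> fst (f n) = j - 1 + 1 \<and> snd (f n) \<in> {1..i}"
    by (rule staircase_to_boundary[OF \<eta> 2 _ _ _ irr, of "(0, i)"])
      (use Q P in \<open>simp_all add: corner_def\<close>)
  \<comment> \<open>Reaching the bottom row away from the origin is excluded by \<open>no\<close>;
    reaching the origin means going straight down through \<open>(0, 1)\<close>, which is
    minus.\<close>
  have "snd (f n) \<noteq> 0"
  proof
    assume s: "snd (f n) = 0"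
    then have "fst (f n) \<in> {0..j - 1}" using f(3) by auto
    with no[OF f(1)] s f P Q have z: "fst (f n) = 0" by force
    have n: "int n = i" using staircase_diff[OF f(1), of n] f s z by simp
    have "fst (f (n - 1)) \<le> 0" "fst (f 0) \<le> fst (f (n - 1))"
      using staircase_mono(1)[OF f(1), of "n - 1" n] staircase_mono(1)[OF f(1), of 0 "n - 1"] z by auto
    then have "fst (f (n - 1)) = 0" using f by simp
    moreover have "snd (f (n - 1)) = 1"
      using staircase_diff[OF f(1), of "n - 1"] calculation f n P by simp
    ultimately have "f (n - 1) = (0, 1)" by (intro prod_eqI) auto
    then have "\<eta> (0, 1) = 1" using f(1) unfolding staircase_def by (metis diff_le_self)
    with o show False by simp
  qed
  then have "f n = (j, snd (f n))" "snd (f n) \<le> i" "1 \<le> snd (f n)" using f(3) by (auto intro: prod_eqI)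
  then obtain N h where "staircase \<eta> N h" "h 0 = (0, i)" "h N = (j, 0)"
    using staircases_cross[OF f(1,2) _ _ g(1) g0(1) g(2)] g0 by (metis order_trans zero_le_one)
  then show False using no[of N h] P Q by simp
qed

section \<open>The clock of a single site\<close>

definition wait_law :: "real measure" where
  "wait_law = density lborel (\<lambda>s. ennreal (exponential_density 1 s))"

definition tick_law :: "(real \<times> bool) measure" where
  "tick_law = wait_law \<Otimes>\<^sub>M uniform_count_measure UNIV"

definition clock_law :: "(nat \<Rightarrow> real \<times> bool) measure" where
  "clock_law = PiM UNIV (\<lambda>_. tick_law)"

lemma dyn_law_eq: "dyn_law = PiM UNIV (\<lambda>_. clock_law)"
  by (simp add: dyn_law_def clock_law_def tick_law_def wait_law_def)

lemma prob_space_wait_law: "prob_space wait_law"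
  unfolding wait_law_def by (rule prob_space_exponential_density) simp

lemma prob_space_tick_law: "prob_space tick_law"
  unfolding tick_law_def
  by (intro prob_space_pair prob_space_wait_law prob_space_uniform_count_measure) auto

lemma prob_space_clock_law: "prob_space clock_law"
  unfolding clock_law_def by (intro prob_space_PiM prob_space_tick_law)

interpretation wait_law: prob_space wait_law by (rule prob_space_wait_law)
interpretation tick_law: prob_space tick_law by (rule prob_space_tick_law)
interpretation clock_law: prob_space clock_law by (rule prob_space_clock_law)
interpretation clock_seq: sequence_space tick_law by unfold_locales

lemma sets_wait_law [measurable_cong, simp]: "sets wait_law = sets borel"
  by (simp add: wait_law_def)

lemma sets_tick_law [measurable_cong]: "sets tick_law = sets (borel \<Otimes>\<^sub>M count_space UNIV)"
  unfolding tick_law_def by (intro sets_pair_measure_cong) (auto simp: sets_uniform_count_measure)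

lemma sets_clock_law [measurable_cong]:
  "sets clock_law = sets (PiM UNIV (\<lambda>_::nat. borel \<Otimes>\<^sub>M (count_space UNIV :: bool measure)))"
  unfolding clock_law_def by (intro sets_PiM_cong sets_tick_law) auto

lemma space_tick_law [simp]: "space tick_law = UNIV"
  using sets_eq_imp_space_eq[OF sets_tick_law] by (simp add: space_pair_measure)

lemma space_clock_law [simp]: "space clock_law = UNIV"
  by (simp add: clock_law_def space_PiM)

lemma sets_tick_Collect [simp, measurable]:
  "{p. s < fst p} \<in> sets tick_law" "{p. fst p \<le> s} \<in> sets tick_law" "{p. fst p \<le> s \<and> snd p = c} \<in> sets tick_law"
proof -
  have "{p \<in> space tick_law. s < fst p} \<in> sets tick_law" "{p \<in> space tick_law. fst p \<le> s} \<in> sets tick_law"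
    "{p \<in> space tick_law. fst p \<le> s \<and> snd p = c} \<in> sets tick_law"
    by measurable
  then show "{p. s < fst p} \<in> sets tick_law" "{p. fst p \<le> s} \<in> sets tick_law" "{p. fst p \<le> s \<and> snd p = c} \<in> sets tick_law"
    by simp_all
qed

text \<open>The memoryless property of the exponential law in integral form, by a shift of the
  variable.\<close>

lemma memoryless_wait:
  assumes [measurable]: "g \<in> borel_measurable borel" and s: "0 \<le> s"
  shows "(\<integral>\<^sup>+\<tau>. (if s < \<tau> then g (\<tau> - s) else 0) \<partial>wait_law) = ennreal (exp (- s)) * (\<integral>\<^sup>+\<tau>. g \<tau> \<partial>wait_law)"
proof -
  have "(\<integral>\<^sup>+\<tau>. (if s < \<tau> then g (\<tau> - s) else 0) \<partial>wait_law)
    = (\<integral>\<^sup>+\<tau>. ennreal (exponential_density 1 \<tau>) * (if s < \<tau> then g (\<tau> - s) else 0) \<partial>lborel)"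
    unfolding wait_law_def by (subst nn_integral_density) auto
  also have "\<dots> = (\<integral>\<^sup>+\<tau>. ennreal (exponential_density 1 (s + \<tau>)) * (if 0 < \<tau> then g \<tau> else 0) \<partial>lborel)"
    by (subst nn_integral_real_affine[where t = s and c = 1]; simp cong: if_cong)
  also have "\<dots> = (\<integral>\<^sup>+\<tau>. ennreal (exp (- s)) * (ennreal (exponential_density 1 \<tau>) * g \<tau>) \<partial>lborel)"
  \<comment> \<open>At 0 the density is positive while the left side vanishes, so this point is
    discarded as a null set.\<close>
  proof (rule nn_integral_cong_AE, use AE_lborel_singleton[of 0] in eventually_elim)
    fix \<tau> :: real assume "\<tau> \<noteq> 0"
    then show "ennreal (exponential_density 1 (s + \<tau>)) * (if 0 < \<tau> then g \<tau> else 0)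
      = ennreal (exp (- s)) * (ennreal (exponential_density 1 \<tau>) * g \<tau>)"
      using s by (auto simp: exponential_density_def exp_diff exp_minus field_simps ennreal_mult''[symmetric] mult.assoc[symmetric] exp_add)
  qed
  also have "\<dots> = ennreal (exp (- s)) * (\<integral>\<^sup>+\<tau>. ennreal (exponential_density 1 \<tau>) * g \<tau> \<partial>lborel)"
    by (subst nn_integral_cmult) auto
  also have "(\<integral>\<^sup>+\<tau>. ennreal (exponential_density 1 \<tau>) * g \<tau> \<partial>lborel) = (\<integral>\<^sup>+\<tau>. g \<tau> \<partial>wait_law)"
    unfolding wait_law_def by (subst nn_integral_density) auto
  finally show ?thesis .
qed

lemma memoryless_tick:
  assumes [measurable]: "g \<in> borel_measurable (borel \<Otimes>\<^sub>M count_space UNIV)" and s: "0 \<le> s"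
  shows "(\<integral>\<^sup>+p. (if s < fst p then g (fst p - s, snd p) else 0) \<partial>tick_law)
    = ennreal (exp (- s)) * (\<integral>\<^sup>+p. g p \<partial>tick_law)"
proof -
  let ?C = "uniform_count_measure (UNIV :: bool set)"
  interpret C: prob_space ?C by (rule prob_space_uniform_count_measure) auto
  interpret pair_sigma_finite wait_law ?C ..
  have sC [measurable_cong]: "sets ?C = sets (count_space UNIV)"
    by (simp add: sets_uniform_count_measure)
  have [measurable]: "(\<lambda>\<tau>. g (\<tau>, c)) \<in> borel_measurable borel" for c by measurable
  have "(\<integral>\<^sup>+p. (if s < fst p then g (fst p - s, snd p) else 0) \<partial>tick_law)
    = (\<integral>\<^sup>+c. (\<integral>\<^sup>+\<tau>. (if s < \<tau> then g (\<tau> - s, c) else 0) \<partial>wait_law) \<partial>?C)"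
    unfolding tick_law_def by (subst nn_integral_snd[symmetric]) (auto simp: case_prod_beta' cong: if_cong)
  also have "\<dots> = (\<integral>\<^sup>+c. ennreal (exp (- s)) * (\<integral>\<^sup>+\<tau>. g (\<tau>, c) \<partial>wait_law) \<partial>?C)"
    by (intro nn_integral_cong memoryless_wait s) auto
  also have "\<dots> = ennreal (exp (- s)) * (\<integral>\<^sup>+c. (\<integral>\<^sup>+\<tau>. g (\<tau>, c) \<partial>wait_law) \<partial>?C)"
    by (rule nn_integral_cmult) measurable
  also have "(\<integral>\<^sup>+c. (\<integral>\<^sup>+\<tau>. g (\<tau>, c) \<partial>wait_law) \<partial>?C) = (\<integral>\<^sup>+p. g p \<partial>tick_law)"
    unfolding tick_law_def by (subst nn_integral_snd[symmetric]) (auto simp: case_prod_beta')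
  finally show ?thesis .
qed

lemma tick_law_greater:
  assumes "0 \<le> s" shows "emeasure tick_law {p. s < fst p} = ennreal (exp (- s))"
proof -
  have "emeasure tick_law {p. s < fst p} = (\<integral>\<^sup>+p. indicator {p. s < fst p} p \<partial>tick_law)"
    by (rule nn_integral_indicator[symmetric]) simp
  also have "\<dots> = (\<integral>\<^sup>+p. (if s < fst p then (\<lambda>_. 1) (fst p - s, snd p) else 0) \<partial>tick_law)"
    by (intro nn_integral_cong) (auto simp: indicator_def)
  also have "\<dots> = ennreal (exp (- s)) * (\<integral>\<^sup>+p. (\<lambda>_. 1) p \<partial>tick_law)"
    by (rule memoryless_tick[OF _ assms]) auto
  finally show ?thesis using tick_law.emeasure_space_1 by simp
qed

lemma tick_law_prob_le:
  assumes "0 \<le> s"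
  shows "measure tick_law {p. fst p \<le> s} = 1 - exp (- s)"
proof -
  have "measure tick_law {p. s < fst p} = exp (- s)"
    using tick_law_greater[OF assms] by (simp add: measure_def)
  moreover have "measure tick_law (space tick_law - {p. s < fst p}) = 1 - measure tick_law {p. s < fst p}"
    by (rule tick_law.prob_compl) simp
  moreover have "space tick_law - {p. s < fst p} = {p. fst p \<le> s}" by auto
  ultimately show ?thesis by simp
qed

lemma tick_law_prob_le_coin:
  assumes "0 \<le> s"
  shows "measure tick_law {p. fst p \<le> s \<and> snd p = c} = (1 - exp (- s)) / 2"
proof -
  let ?C = "uniform_count_measure (UNIV :: bool set)"
  interpret C: prob_space ?C by (rule prob_space_uniform_count_measure) auto
  have rect: "emeasure tick_law ({..s} \<times> B) = emeasure wait_law {..s} * emeasure ?C B" for B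
    unfolding tick_law_def by (rule C.emeasure_pair_measure_Times) (auto simp: sets_uniform_count_measure)
  have "{p. fst p \<le> s} = {..s} \<times> (UNIV :: bool set)" by auto
  then have "measure tick_law {p. fst p \<le> s} = measure wait_law {..s}"
    using rect[of UNIV] C.emeasure_space_1 by (simp add: measure_def space_uniform_count_measure)
  moreover have "{p. fst p \<le> s \<and> snd p = c} = {..s} \<times> {c}" by auto
  then have "measure tick_law {p. fst p \<le> s \<and> snd p = c} = measure wait_law {..s} * measure ?C {c}"
    using rect[of "{c}"] by (simp add: measure_def enn2real_mult)
  moreover have "measure ?C {c} = 1 / 2"
    by (simp add: measure_uniform_count_measure)
  ultimately show ?thesis using tick_law_prob_le[OF assms] by simp
qed

section \<open>Renewal of a clock at a fixed time\<close>

definition ring :: "(nat \<Rightarrow> real \<times> bool) \<Rightarrow> nat \<Rightarrow> real" where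
  "ring v n = (\<Sum>i\<le>n. fst (v i))"

lemma ring_time_eq: "ring_time w x n = ring (w x) n"
  by (simp add: ring_time_def ring_def)

lemma ring_0 [simp]: "ring v 0 = fst (v 0)"
  by (simp add: ring_def)

lemma ring_Suc: "ring v (Suc n) = ring v n + fst (v (Suc n))"
  by (simp add: ring_def)

lemma ring_case_nat [simp]: "ring (case_nat p v) (Suc n) = fst p + ring v n"
  by (simp add: ring_def sum.atMost_Suc_shift del: sum.atMost_Suc)

lemma ring_measurable [measurable]: "(\<lambda>v. ring v n) \<in> borel_measurable clock_law"
  unfolding ring_def by measurable

text \<open>Rings are numbered from 0: n rings have occurred by time s, and ring n is the next
  one.\<close>

definition counts :: "real \<Rightarrow> (nat \<Rightarrow> real \<times> bool) \<Rightarrow> nat \<Rightarrow> bool" where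
  "counts s v n \<longleftrightarrow> s < ring v n \<and> (\<forall>m<n. ring v m \<le> s)"

text \<open>The clock seen from time s when n rings have passed: the running waiting time is cut to
  what is left of it and keeps its coin.\<close>

definition residual :: "nat \<Rightarrow> real \<Rightarrow> (nat \<Rightarrow> real \<times> bool) \<Rightarrow> nat \<Rightarrow> real \<times> bool" where
  "residual n s v = (\<lambda>k. if k = 0 then (ring v n - s, snd (v n)) else v (n + k))"

definition restart :: "real \<Rightarrow> (nat \<Rightarrow> real \<times> bool) \<Rightarrow> nat \<Rightarrow> real \<times> bool" where
  "restart s v = residual (LEAST n. s < ring v n) s v"

lemma counts_0: "counts s v 0 \<longleftrightarrow> s < fst (v 0)"
  by (simp add: counts_def)

lemma counts_case_nat: "counts s (case_nat p v) (Suc n) \<longleftrightarrow> fst p \<le> s \<and> counts (s - fst p) v n"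
  unfolding counts_def by (auto simp: All_less_Suc2 algebra_simps)

lemma counts_unique: "counts s v n \<Longrightarrow> counts s v m \<Longrightarrow> n = m"
  unfolding counts_def by (meson linorder_neqE_nat not_le)

lemma counts_Least: "counts s v n \<Longrightarrow> (LEAST n. s < ring v n) = n"
  unfolding counts_def by (intro Least_equality) (auto simp: not_less[symmetric])

lemma restart_counts: "counts s v n \<Longrightarrow> restart s v = residual n s v"
  by (simp add: restart_def counts_Least)

lemma counts_ex: "s < ring v m \<Longrightarrow> \<exists>n. counts s v n"
  unfolding counts_def using LeastI[of "\<lambda>n. s < ring v n" m] not_less_Least[of _ "\<lambda>n. s < ring v n"]
  by (metis not_less)

lemma residual_0: "residual 0 s (case_nat p v) = case_nat (fst p - s, snd p) v"
  by (auto simp: residual_def fun_eq_iff split: nat.split)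

lemma residual_Suc: "residual (Suc n) s (case_nat p v) = residual n (s - fst p) v"
  by (auto simp: residual_def fun_eq_iff)

lemma counts_measurable [measurable]: "Measurable.pred clock_law (\<lambda>v. counts s v n)"
  unfolding counts_def by measurable

lemma residual_measurable [measurable]: "residual n s \<in> clock_law \<rightarrow>\<^sub>M clock_law"
proof -
  have "(\<lambda>v. residual n s v) \<in> clock_law \<rightarrow>\<^sub>M PiM UNIV (\<lambda>_::nat. borel \<Otimes>\<^sub>M (count_space UNIV :: bool measure))"
    unfolding residual_def
    by (rule measurable_PiM_single') (auto simp: space_pair_measure intro!: measurable_If)
  then show ?thesis using measurable_cong_sets[OF refl sets_clock_law] by blast
qed

lemma restart_measurable [measurable]: "restart s \<in> clock_law \<rightarrow>\<^sub>M clock_law"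
  unfolding restart_def by (rule measurable_compose_countable[where f = "\<lambda>n v. residual n s v"]) measurable

text \<open>Conditioning on the first tick reduces statements about rings before s to a fresh clock
  and the time that remains.\<close>

lemma clock_law_split:
  assumes "A \<in> sets clock_law"
  shows "emeasure clock_law A = (\<integral>\<^sup>+p. emeasure clock_law {v. case_nat p v \<in> A} \<partial>tick_law)"
    and "(\<lambda>p. emeasure clock_law {v. case_nat p v \<in> A}) \<in> borel_measurable tick_law"
proof -
  let ?T = "\<lambda>(p, v). case_nat p v :: nat \<Rightarrow> real \<times> bool"
  have T: "?T \<in> tick_law \<Otimes>\<^sub>M clock_law \<rightarrow>\<^sub>M clock_law"
    unfolding clock_law_def by measurable
  let ?B = "?T -` A \<inter> space (tick_law \<Otimes>\<^sub>M clock_law)"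
  have B: "?B \<in> sets (tick_law \<Otimes>\<^sub>M clock_law)" using T assms by (rule measurable_sets)
  have v: "Pair p -` ?B = {v. case_nat p v \<in> A}" for p by (auto simp: space_pair_measure)
  have "emeasure clock_law A = emeasure (distr (tick_law \<Otimes>\<^sub>M clock_law) clock_law ?T) A"
    using clock_seq.PiM_iter by (simp add: clock_law_def)
  also have "\<dots> = emeasure (tick_law \<Otimes>\<^sub>M clock_law) ?B"
    by (rule emeasure_distr[OF T assms])
  also have "\<dots> = (\<integral>\<^sup>+p. emeasure clock_law (Pair p -` ?B) \<partial>tick_law)"
    by (rule clock_law.emeasure_pair_measure_alt[OF B])
  finally show "emeasure clock_law A = (\<integral>\<^sup>+p. emeasure clock_law {v. case_nat p v \<in> A} \<partial>tick_law)"
    unfolding v .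
  have "(\<lambda>p. emeasure clock_law (Pair p -` ?B)) \<in> borel_measurable tick_law"
    by (rule clock_law.measurable_emeasure_Pair[OF B])
  then show "(\<lambda>p. emeasure clock_law {v. case_nat p v \<in> A}) \<in> borel_measurable tick_law"
    unfolding v .
qed

lemma pred_residual: "E \<in> sets clock_law \<Longrightarrow> {v. counts s v n \<and> residual n s v \<in> E} \<in> sets clock_law"
proof -
  assume [measurable]: "E \<in> sets clock_law"
  have "{v \<in> space clock_law. counts s v n \<and> residual n s v \<in> E} \<in> sets clock_law" by measurable
  then show ?thesis by simp
qed

text \<open>Renewal at time \<open>s\<close>, by induction on the number \<open>n\<close> of rings before \<open>s\<close>.\<close>

lemma residual_indep:
  assumes E: "E \<in> sets clock_law" and "0 \<le> s"
  shows "emeasure clock_law {v. counts s v n \<and> residual n s v \<in> E}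
    = emeasure clock_law {v. counts s v n} * emeasure clock_law E"
  using \<open>0 \<le> s\<close>
proof (induction n arbitrary: s)
  case 0
  \<comment> \<open>Stated for every F, since F = \<open>UNIV\<close> yields the probability of the
    count alone.\<close>
  have c: "emeasure clock_law {v. counts s v 0 \<and> residual 0 s v \<in> F}
    = ennreal (exp (- s)) * emeasure clock_law F" if F: "F \<in> sets clock_law" for F
  proof -
    let ?G = "\<lambda>p. emeasure clock_law {v. case_nat p v \<in> F}"
    have G: "?G \<in> borel_measurable (borel \<Otimes>\<^sub>M count_space UNIV)"
      using clock_law_split(2)[OF F] measurable_cong_sets[OF sets_tick_law refl] by blast
    have "emeasure clock_law {v. counts s v 0 \<and> residual 0 s v \<in> F}
      = (\<integral>\<^sup>+p. emeasure clock_law {v. case_nat p v \<in> {v. counts s v 0 \<and> residual 0 s v \<in> F}} \<partial>tick_law)"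
      by (rule clock_law_split(1)[OF pred_residual[OF F]])
    also have "\<dots> = (\<integral>\<^sup>+p. (if s < fst p then ?G (fst p - s, snd p) else 0) \<partial>tick_law)"
      by (intro nn_integral_cong) (simp add: counts_0 residual_0)
    also have "\<dots> = ennreal (exp (- s)) * (\<integral>\<^sup>+p. ?G p \<partial>tick_law)"
      by (rule memoryless_tick[OF G 0])
    finally show ?thesis using clock_law_split(1)[OF F] by simp
  qed
  show ?case
    using c[OF E] c[of UNIV] clock_law.emeasure_space_1 sets.top[of clock_law] by simp
next
  case (Suc n)
  have c: "emeasure clock_law {v. counts s v (Suc n) \<and> residual (Suc n) s v \<in> F}
    = (\<integral>\<^sup>+p. (if fst p \<le> s then emeasure clock_law {v. counts (s - fst p) v n \<and> residual n (s - fst p) v \<in> F} else 0) \<partial>tick_law)"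
    if F: "F \<in> sets clock_law" for F
    by (subst clock_law_split(1)[OF pred_residual[OF F]], intro nn_integral_cong)
      (simp add: counts_case_nat residual_Suc)
  let ?G = "\<lambda>p. if fst p \<le> s then emeasure clock_law {v. counts (s - fst p) v n} else 0"
  have G: "?G \<in> borel_measurable tick_law"
  proof -
    have "{v. counts s v (Suc n)} \<in> sets clock_law"
      using pred_residual[OF sets.top, of s "Suc n"] by simp
    from clock_law_split(2)[OF this] show ?thesis
      by (rule measurable_cong[THEN iffD1, rotated]) (auto simp: counts_case_nat)
  qed
  have "emeasure clock_law {v. counts s v (Suc n) \<and> residual (Suc n) s v \<in> E}
    = (\<integral>\<^sup>+p. ?G p * emeasure clock_law E \<partial>tick_law)"
    unfolding c[OF E] by (intro nn_integral_cong) (auto simp: Suc.IH)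
  also have "\<dots> = (\<integral>\<^sup>+p. ?G p \<partial>tick_law) * emeasure clock_law E"
    by (rule nn_integral_multc[OF G])
  also have "(\<integral>\<^sup>+p. ?G p \<partial>tick_law) = emeasure clock_law {v. counts s v (Suc n)}"
    using c[OF sets.top] by (simp cong: if_cong)
  finally show ?case .
qed

definition good_clock :: "(nat \<Rightarrow> real \<times> bool) \<Rightarrow> bool" where
  "good_clock v \<longleftrightarrow> (\<forall>i. 0 < fst (v i)) \<and> (\<forall>t. \<exists>n. t < ring v n)"

lemma ring_strict_mono: "good_clock v \<Longrightarrow> strict_mono (ring v)"
  by (intro strict_monoI_Suc) (simp add: ring_Suc good_clock_def)

lemma ring_pos: "good_clock v \<Longrightarrow> 0 < ring v n"
  unfolding ring_def good_clock_def by (intro sum_pos) auto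

lemma AE_wait_pos: "AE v in clock_law. \<forall>i. 0 < fst (v i)"
proof -
  have "AE p in tick_law. 0 < fst p"
    using tick_law_greater[of 0]
    by (subst tick_law.prob_eq_1[symmetric, where A = "{p. 0 < fst p}", simplified])
       (auto simp: measure_def)
  then have "AE v in clock_law. 0 < fst (v i)" for i
    unfolding clock_law_def by (intro AE_PiM_component prob_space_tick_law) auto
  then show ?thesis by (simp add: AE_all_countable)
qed

text \<open>Rings cannot accumulate: that all waiting times stay below t has probability 0, as the
  limit of powers of \<open>1 - exp (- t)\<close>, and one long waiting time pushes the rings beyond
  t.\<close>

lemma AE_good_clock: "AE v in clock_law. good_clock v"
proof -
  have "AE v in clock_law. \<exists>i. real t < fst (v i)" for t :: nat
  proof -
    let ?E = "{p :: real \<times> bool. fst p \<le> real t}"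
    have E: "?E \<in> sets tick_law" by simp
    have "(\<lambda>n. \<Prod>i\<le>n. measure tick_law ?E) \<longlonglongrightarrow> measure clock_law (Pi UNIV (\<lambda>_. ?E))"
      using clock_seq.measure_PiM_countable[OF E] by (simp add: clock_law_def)
    moreover have "(\<lambda>n. \<Prod>i\<le>n. measure tick_law ?E) = (\<lambda>n. (1 - exp (- real t)) ^ Suc n)"
      by (simp add: tick_law_prob_le)
    moreover have "(\<lambda>n. (1 - exp (- real t)) ^ Suc n) \<longlonglongrightarrow> 0"
      by (intro LIMSEQ_Suc LIMSEQ_power_zero) auto
    ultimately have 0: "measure clock_law (Pi UNIV (\<lambda>_. ?E)) = 0"
      using LIMSEQ_unique by fastforce
    have m: "Pi UNIV (\<lambda>_. ?E) \<in> sets clock_law"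
      using clock_seq.infprod_in_sets[of "\<lambda>_. ?E"] E by (simp add: clock_law_def)
    have "AE v in clock_law. v \<notin> Pi UNIV (\<lambda>_. ?E)"
      using m 0 by (intro AE_not_in) (auto simp: null_sets_def clock_law.emeasure_eq_measure)
    then show ?thesis by eventually_elim (auto simp: Pi_iff not_le)
  qed
  then have "AE v in clock_law. \<forall>t::nat. \<exists>i. real t < fst (v i)" by (simp add: AE_all_countable)
  with AE_wait_pos show ?thesis
  proof eventually_elim
    case (elim v)
    have "\<exists>n. t < ring v n" for t
    proof -
      obtain k :: nat where k: "t \<le> real k" using real_arch_simple by blast
      obtain i where i: "real k < fst (v i)" using elim by blast
      have "fst (v i) \<le> ring v i" unfolding ring_def
        using elim by (intro member_le_sum) (auto intro: less_imp_le)
      with i k have "t < ring v i" by linarith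
      then show ?thesis ..
    qed
    then show ?case using elim by (simp add: good_clock_def)
  qed
qed

lemma AE_counts: "AE v in clock_law. \<exists>n. counts s v n"
  using AE_good_clock by eventually_elim (auto simp: good_clock_def intro: counts_ex)

text \<open>Summation of \<open>residual_indep\<close> over the number of rings; the probabilities
  of the counts add up to 1 because almost surely some ring comes after s.\<close>

lemma residual_sum:
  assumes E: "E \<in> sets clock_law" and s: "0 \<le> s"
  shows "emeasure clock_law {v. \<exists>n. counts s v n \<and> residual n s v \<in> E} = emeasure clock_law E"
proof -
  have *: "emeasure clock_law {v. \<exists>n. counts s v n \<and> residual n s v \<in> F}
    = (\<Sum>n. emeasure clock_law {v. counts s v n} * emeasure clock_law F)" if F: "F \<in> sets clock_law" for F
  proof -
    have "disjoint_family (\<lambda>n. {v. counts s v n \<and> residual n s v \<in> F})"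
      unfolding disjoint_family_on_def by (auto dest: counts_unique)
    then have "(\<Sum>n. emeasure clock_law {v. counts s v n \<and> residual n s v \<in> F})
      = emeasure clock_law (\<Union>n. {v. counts s v n \<and> residual n s v \<in> F})"
      by (intro suminf_emeasure) (auto intro: pred_residual F)
    also have "(\<Union>n. {v. counts s v n \<and> residual n s v \<in> F}) = {v. \<exists>n. counts s v n \<and> residual n s v \<in> F}"
      by auto
    finally show ?thesis by (simp add: residual_indep F s)
  qed
  have "{v \<in> space clock_law. \<exists>n. counts s v n} \<in> sets clock_law" by measurable
  then have "emeasure clock_law {v. \<exists>n. counts s v n} = 1"
    using AE_counts[of s] clock_law.emeasure_eq_1_AE[of "{v. \<exists>n. counts s v n}"] by simp
  then have "(\<Sum>n. emeasure clock_law {v. counts s v n}) = 1"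
    using *[OF sets.top] clock_law.emeasure_space_1 by simp
  then show ?thesis unfolding *[OF E] by simp
qed

section \<open>A clock read off in time slots\<close>

definition first_ring :: "real \<Rightarrow> (nat \<Rightarrow> real \<times> bool) \<Rightarrow> bool option" where
  "first_ring s v = (if fst (v 0) \<le> s then Some (snd (v 0)) else None)"

definition weight :: "real \<Rightarrow> bool option \<Rightarrow> real" where
  "weight q a = (case a of None \<Rightarrow> 1 - q | Some c \<Rightarrow> q / 2)"

lemma first_ring_measurable [measurable]: "first_ring s \<in> clock_law \<rightarrow>\<^sub>M count_space UNIV"
  unfolding first_ring_def by measurable

lemma restart_in_iff: "\<exists>n. counts s v n \<Longrightarrow> restart s v \<in> E \<longleftrightarrow> (\<exists>n. counts s v n \<and> residual n s v \<in> E)"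
  using restart_counts counts_unique by metis

text \<open>Given a first ring before s, the clock after it is fresh and has to run only for the
  remaining time; by \<open>residual_sum\<close> its restart has the clock law whatever the time and
  coin of that ring. Without a ring this is renewal with count 0.\<close>

lemma first_ring_restart_indep:
  assumes E: "E \<in> sets clock_law" and s: "0 \<le> s"
  shows "measure clock_law {v. first_ring s v = a \<and> restart s v \<in> E}
    = weight (1 - exp (- s)) a * measure clock_law E"
proof (cases a)
  case None
  have "{v. first_ring s v = a \<and> restart s v \<in> E} = {v. counts s v 0 \<and> residual 0 s v \<in> E}"
    using None restart_counts[of s _ 0] by (auto simp: first_ring_def counts_0 split: if_splits)
  moreover have "emeasure clock_law {v. counts s v 0} = ennreal (exp (- s))"
  proof -
    have m: "{v. counts s v 0} \<in> sets clock_law" using pred_residual[OF sets.top, of s 0] by simp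
    have "emeasure clock_law {v. counts s v 0} = (\<integral>\<^sup>+p. indicator {p. s < fst p} p \<partial>tick_law)"
      by (subst clock_law_split(1)[OF m], intro nn_integral_cong)
        (use clock_law.emeasure_space_1 in \<open>auto simp: counts_0 indicator_def\<close>)
    also have "\<dots> = emeasure tick_law {p. s < fst p}"
      by (rule nn_integral_indicator) simp
    finally show ?thesis using tick_law_greater[OF s] by simp
  qed
  ultimately show ?thesis
    using residual_indep[OF E s, of 0] None by (simp add: measure_def enn2real_mult weight_def)
next
  case (Some c)
  let ?A = "{v. first_ring s v = a \<and> (\<exists>n. counts s v n \<and> residual n s v \<in> E)}"
  have [measurable]: "E \<in> sets clock_law" by (rule E)
  have "{v \<in> space clock_law. first_ring s v = a \<and> (\<exists>n. counts s v n \<and> residual n s v \<in> E)} \<in> sets clock_law"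
    by measurable
  then have A: "?A \<in> sets clock_law" by simp
  have "{v \<in> space clock_law. first_ring s v = a \<and> restart s v \<in> E} \<in> sets clock_law"
    by measurable
  then have A': "{v. first_ring s v = a \<and> restart s v \<in> E} \<in> sets clock_law" by simp
  have eq: "measure clock_law {v. first_ring s v = a \<and> restart s v \<in> E} = measure clock_law ?A"
  proof (rule measure_eq_AE[OF _ A' A])
    show "AE v in clock_law. v \<in> {v. first_ring s v = a \<and> restart s v \<in> E} \<longleftrightarrow> v \<in> ?A"
      using AE_counts[of s] by eventually_elim (simp add: restart_in_iff)
  qed
  have "emeasure clock_law ?A
    = (\<integral>\<^sup>+p. emeasure clock_law E * indicator {p. fst p \<le> s \<and> snd p = c} p \<partial>tick_law)"
  proof (subst clock_law_split(1)[OF A], intro nn_integral_cong)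
    fix p :: "real \<times> bool"
    have "(case_nat p v \<in> ?A) \<longleftrightarrow> fst p \<le> s \<and> snd p = c \<and> (\<exists>n. counts (s - fst p) v n \<and> residual n (s - fst p) v \<in> E)" for v
    proof -
      have "(\<exists>n. counts s (case_nat p v) n \<and> residual n s (case_nat p v) \<in> E) \<longleftrightarrow>
        (\<exists>n. counts (s - fst p) v n \<and> residual n (s - fst p) v \<in> E)" if "fst p \<le> s"
      proof
        assume "\<exists>n. counts s (case_nat p v) n \<and> residual n s (case_nat p v) \<in> E"
        then obtain n where n: "counts s (case_nat p v) n" "residual n s (case_nat p v) \<in> E" by blast
        with that obtain m where "n = Suc m" by (cases n) (auto simp: counts_0)
        with n show "\<exists>n. counts (s - fst p) v n \<and> residual n (s - fst p) v \<in> E"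
          by (auto simp: counts_case_nat residual_Suc)
      next
        assume "\<exists>n. counts (s - fst p) v n \<and> residual n (s - fst p) v \<in> E"
        then obtain n where "counts (s - fst p) v n \<and> residual n (s - fst p) v \<in> E" by blast
        then have "counts s (case_nat p v) (Suc n) \<and> residual (Suc n) s (case_nat p v) \<in> E"
          using that by (simp add: counts_case_nat residual_Suc)
        then show "\<exists>n. counts s (case_nat p v) n \<and> residual n s (case_nat p v) \<in> E" ..
      qed
      then show ?thesis using Some by (auto simp: first_ring_def)
    qed
    then have "{v. case_nat p v \<in> ?A} = (if fst p \<le> s \<and> snd p = c
      then {v. \<exists>n. counts (s - fst p) v n \<and> residual n (s - fst p) v \<in> E} else {})"
      by auto
    then show "emeasure clock_law {v. case_nat p v \<in> ?A} = emeasure clock_law E * indicator {p. fst p \<le> s \<and> snd p = c} p"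
      using residual_sum[OF E, of "s - fst p"] by (auto simp: indicator_def)
  qed
  also have "\<dots> = emeasure clock_law E * emeasure tick_law {p. fst p \<le> s \<and> snd p = c}"
    by (rule nn_integral_cmult_indicator) simp
  finally show ?thesis
    unfolding eq using tick_law_prob_le_coin[OF s, of c] Some by (simp add: measure_def enn2real_mult weight_def mult.commute)
qed

lemma restart_prob:
  assumes E: "E \<in> sets clock_law" and s: "0 \<le> s"
  shows "measure clock_law {v. restart s v \<in> E} = measure clock_law E"
proof -
  have [measurable]: "E \<in> sets clock_law" by (rule E)
  have "{v \<in> space clock_law. \<exists>n. counts s v n \<and> residual n s v \<in> E} \<in> sets clock_law" by measurable
  then have A: "{v. \<exists>n. counts s v n \<and> residual n s v \<in> E} \<in> sets clock_law" by simp
  have "{v \<in> space clock_law. restart s v \<in> E} \<in> sets clock_law" by measurable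
  then have A': "{v. restart s v \<in> E} \<in> sets clock_law" by simp
  have "measure clock_law {v. restart s v \<in> E} = measure clock_law {v. \<exists>n. counts s v n \<and> residual n s v \<in> E}"
  proof (rule measure_eq_AE[OF _ A' A])
    show "AE v in clock_law. v \<in> {v. restart s v \<in> E} \<longleftrightarrow> v \<in> {v. \<exists>n. counts s v n \<and> residual n s v \<in> E}"
      using AE_counts[of s] by eventually_elim (simp add: restart_in_iff)
  qed
  with residual_sum[OF E s] show ?thesis by (simp add: measure_def)
qed

lemma first_ring_prob:
  assumes "0 \<le> s"
  shows "measure clock_law {v. first_ring s v = a} = weight (1 - exp (- s)) a"
  using first_ring_restart_indep[OF sets.top assms, of a] clock_law.prob_space by simp

text \<open>Only the first ring in the k-th interval, open on the left and closed on the right, is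
  recorded. This makes the slots of a clock independent and identically distributed; for finitely
  many clocks and a bounded time no ring is lost once s is small.\<close>

definition slot :: "real \<Rightarrow> (nat \<Rightarrow> real \<times> bool) \<Rightarrow> nat \<Rightarrow> bool option" where
  "slot s v k = first_ring s (restart (real k * s) v)"

lemma slot_measurable [measurable]: "(\<lambda>v. slot s v k) \<in> clock_law \<rightarrow>\<^sub>M count_space UNIV"
  unfolding slot_def by measurable

lemma ring_residual: "ring (residual n s v) k = ring v (n + k) - s"
proof (induction k)
  case 0
  then show ?case by (simp add: residual_def)
next
  case (Suc k)
  then show ?case by (simp add: ring_Suc) (simp add: residual_def)
qed

lemma good_residual:
  assumes "good_clock v" "counts s v n"
  shows "good_clock (residual n s v)"
  unfolding good_clock_def
proof (intro conjI allI)
  fix i show "0 < fst (residual n s v i)"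
    using assms by (auto simp: residual_def good_clock_def counts_def)
next
  fix t
  obtain m where m: "t + s < ring v m" using assms unfolding good_clock_def by blast
  also have "ring v m \<le> ring v (n + m)"
    using ring_strict_mono[OF assms(1)] by (simp add: strict_mono_less_eq)
  finally show "\<exists>k. t < ring (residual n s v) k" by (intro exI[of _ m]) (simp add: ring_residual)
qed

lemma good_counts: "good_clock v \<Longrightarrow> \<exists>n. counts s v n"
  by (auto simp: good_clock_def intro: counts_ex)

lemma restart_add:
  assumes v: "good_clock v" and st: "0 \<le> s" "0 \<le> t"
  shows "restart t (restart s v) = restart (s + t) v"
proof -
  obtain n where n: "counts s v n" using good_counts[OF v] by blast
  obtain m where m: "counts t (residual n s v) m" using good_counts[OF good_residual[OF v n]] by blast
  have "counts (s + t) v (n + m)"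
    unfolding counts_def
  proof (intro conjI allI impI)
    show "s + t < ring v (n + m)" using m by (simp add: counts_def ring_residual)
    fix k assume k: "k < n + m"
    show "ring v k \<le> s + t"
    proof (cases "k < n")
      case True
      then have "ring v k \<le> s" using n by (simp add: counts_def)
      then show ?thesis using st by simp
    next
      case False
      then obtain l where l: "k = n + l" using le_Suc_ex not_less by blast
      then have "ring (residual n s v) l \<le> t" using m k by (simp add: counts_def)
      then show ?thesis by (simp add: l ring_residual)
    qed
  qed
  then have "restart (s + t) v = residual (n + m) (s + t) v" by (rule restart_counts)
  also have "\<dots> = residual m t (residual n s v)"
  proof
    have "snd (residual n s v m) = snd (v (n + m))" by (simp add: residual_def)
    then show "residual (n + m) (s + t) v k = residual m t (residual n s v) k" for k
      by (cases "k = 0") (simp_all add: residual_def[of "n + m"] residual_def[of m t] ring_residual,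
        simp add: residual_def add.assoc)
  qed
  finally show ?thesis using restart_counts[OF n] restart_counts[OF m] by simp
qed

lemma slot_Suc: "good_clock v \<Longrightarrow> 0 \<le> s \<Longrightarrow> slot s v (Suc k) = slot s (restart s v) k"
  unfolding slot_def using restart_add[of v s "real k * s"] by (simp add: algebra_simps)

lemma slot_0: "good_clock v \<Longrightarrow> slot s v 0 = first_ring s v"
proof -
  assume v: "good_clock v"
  then have c: "counts 0 v 0" by (simp add: counts_0 good_clock_def)
  have "residual 0 0 v = v" by (auto simp: residual_def fun_eq_iff)
  then show ?thesis using restart_counts[OF c] by (simp add: slot_def)
qed

lemma slots_sets [measurable]: "{v. \<forall>k<K. slot s v k = a k} \<in> sets clock_law"
proof -
  have "{v \<in> space clock_law. \<forall>k<K. slot s v k = a k} \<in> sets clock_law" by measurable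
  then show ?thesis by simp
qed

text \<open>The first slot is independent of the restarted clock, whose slots are the remaining
  ones.\<close>

lemma slots_prob:
  assumes s: "0 \<le> s"
  shows "measure clock_law {v. \<forall>k<K. slot s v k = a k} = (\<Prod>k<K. weight (1 - exp (- s)) (a k))"
proof (induction K arbitrary: a)
  case 0
  then show ?case using clock_law.prob_space by simp
next
  case (Suc K)
  let ?E = "{v. \<forall>k<K. slot s v k = a (Suc k)}"
  have [measurable]: "?E \<in> sets clock_law" by (rule slots_sets)
  have "{v \<in> space clock_law. first_ring s v = a 0 \<and> restart s v \<in> ?E} \<in> sets clock_law"
    by measurable
  then have m: "{v. first_ring s v = a 0 \<and> restart s v \<in> ?E} \<in> sets clock_law" by simp
  have "measure clock_law {v. \<forall>k<Suc K. slot s v k = a k}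
    = measure clock_law {v. first_ring s v = a 0 \<and> restart s v \<in> ?E}"
  proof (rule measure_eq_AE[OF _ slots_sets m])
    show "AE v in clock_law. v \<in> {v. \<forall>k<Suc K. slot s v k = a k} \<longleftrightarrow> v \<in> {v. first_ring s v = a 0 \<and> restart s v \<in> ?E}"
      using AE_good_clock
    proof eventually_elim
      case (elim v)
      then show ?case using slot_Suc[OF elim s] slot_0[OF elim] by (auto simp: All_less_Suc2)
    qed
  qed
  also have "\<dots> = weight (1 - exp (- s)) (a 0) * (\<Prod>k<K. weight (1 - exp (- s)) (a (Suc k)))"
    using first_ring_restart_indep[OF slots_sets s] Suc by simp
  also have "\<dots> = (\<Prod>k<Suc K. weight (1 - exp (- s)) (a k))"
    by (simp add: prod.lessThan_Suc_shift del: prod.lessThan_Suc)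
  finally show ?case .
qed

lemma slot_prob:
  assumes "0 \<le> s"
  shows "measure clock_law {v. slot s v k = a} = weight (1 - exp (- s)) a"
proof -
  have "{v \<in> space clock_law. first_ring s v = a} \<in> sets clock_law" by measurable
  then have m: "{v. first_ring s v = a} \<in> sets clock_law" by simp
  from restart_prob[OF m, of "real k * s"] assms show ?thesis
    by (simp add: slot_def first_ring_prob)
qed

lemma slot_eq_None_iff:
  assumes v: "good_clock v" and s: "0 \<le> s"
  shows "slot s v k = None \<longleftrightarrow> (\<forall>n. ring v n \<notin> {real k * s<..real (Suc k) * s})"
proof -
  obtain n where n: "counts (real k * s) v n" using good_counts[OF v] by blast
  have "slot s v k = None \<longleftrightarrow> real (Suc k) * s < ring v n"
    unfolding slot_def restart_counts[OF n] by (auto simp: first_ring_def residual_def algebra_simps)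
  also have "\<dots> \<longleftrightarrow> (\<forall>m. ring v m \<notin> {real k * s<..real (Suc k) * s})"
  proof
    assume a: "real (Suc k) * s < ring v n"
    show "\<forall>m. ring v m \<notin> {real k * s<..real (Suc k) * s}"
    proof
      fix m
      have "ring v n \<le> ring v m" if "n \<le> m"
        using ring_strict_mono[OF v] that by (simp add: strict_mono_less_eq)
      then show "ring v m \<notin> {real k * s<..real (Suc k) * s}"
        using n a unfolding counts_def by (cases "m < n") force+
    qed
  next
    assume "\<forall>m. ring v m \<notin> {real k * s<..real (Suc k) * s}"
    then show "real (Suc k) * s < ring v n" using n unfolding counts_def by fastforce
  qed
  finally show ?thesis .
qed

lemma slot_eq_Some:
  assumes v: "good_clock v" and s: "0 \<le> s" and n: "ring v n \<in> {real k * s<..real (Suc k) * s}"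
    and u: "\<And>m. ring v m \<in> {real k * s<..real (Suc k) * s} \<Longrightarrow> m = n"
  shows "slot s v k = Some (snd (v n))"
proof -
  have "ring v m \<le> real k * s" if "m < n" for m
  proof (rule ccontr)
    assume "\<not> ring v m \<le> real k * s"
    moreover have "ring v m < ring v n" using ring_strict_mono[OF v] that by (simp add: strict_mono_less)
    ultimately show False using u[of m] n that by auto
  qed
  then have "counts (real k * s) v n" using n unfolding counts_def by auto
  then show ?thesis using n unfolding slot_def
    by (simp add: restart_counts first_ring_def residual_def algebra_simps)
qed

section \<open>All clocks\<close>

interpretation dyn_law: prob_space dyn_law by (rule prob_space_dyn_law)
interpretation dyn_prod: product_prob_space "\<lambda>_::site. clock_law" UNIV by unfold_locales

lemma space_dyn_law [simp]: "space dyn_law = UNIV"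
  by (simp add: dyn_law_eq space_PiM)

lemma component_measurable [measurable]: "(\<lambda>w. w x) \<in> dyn_law \<rightarrow>\<^sub>M clock_law"
  unfolding dyn_law_eq by measurable

lemma ring_component_measurable [measurable]: "(\<lambda>w. ring (w x) n) \<in> borel_measurable dyn_law"
  by (rule measurable_compose[OF component_measurable ring_measurable])

lemma dyn_law_prob:
  assumes "finite S" "\<And>x. x \<in> S \<Longrightarrow> E x \<in> sets clock_law"
  shows "measure dyn_law {w. \<forall>x\<in>S. w x \<in> E x} = (\<Prod>x\<in>S. measure clock_law (E x))"
proof -
  have "emeasure dyn_law {w. \<forall>x\<in>S. w x \<in> E x} = (\<Prod>x\<in>S. emeasure clock_law (E x))"
    using dyn_prod.emeasure_PiM_Collect[of S E] assms by (simp add: dyn_law_eq space_PiM)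
  also have "\<dots> = ennreal (\<Prod>x\<in>S. measure clock_law (E x))"
    by (simp add: clock_law.emeasure_eq_measure prod_ennreal)
  finally show ?thesis by (simp add: measure_def prod_nonneg)
qed

lemma dyn_law_slots_prob:
  assumes "finite S" "0 \<le> s"
  shows "measure dyn_law {w. \<forall>x\<in>S. \<forall>k<K. slot s (w x) k = a (k, x)}
    = (\<Prod>x\<in>S. \<Prod>k<K. weight (1 - exp (- s)) (a (k, x)))"
  using dyn_law_prob[of S "\<lambda>x. {v. \<forall>k<K. slot s v k = a (k, x)}"] assms
  by (simp add: slots_prob slots_sets)

lemma slot_Collect_sets: "{v. P (slot s v k)} \<in> sets clock_law"
proof -
  have "{v \<in> space clock_law. P (slot s v k)} \<in> sets clock_law" by measurable
  then show ?thesis by simp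
qed

lemma slot_not_None_prob:
  assumes "0 \<le> s" shows "measure clock_law {v. slot s v k \<noteq> None} = 1 - exp (- s)"
proof -
  have "measure clock_law (space clock_law - {v. slot s v k = None}) = 1 - measure clock_law {v. slot s v k = None}"
    by (rule clock_law.prob_compl) (rule slot_Collect_sets)
  moreover have "space clock_law - {v. slot s v k = None} = {v. slot s v k \<noteq> None}" by auto
  ultimately show ?thesis using slot_prob[OF assms, of k None] by (simp add: weight_def)
qed

lemma all_ring_prob:
  assumes "finite S" "0 \<le> s"
  shows "measure dyn_law {w. \<forall>x\<in>S. slot s (w x) k \<noteq> None} = (1 - exp (- s)) ^ card S"
  using dyn_law_prob[of S "\<lambda>_. {v. slot s v k \<noteq> None}"] assms slot_Collect_sets
  by (simp add: slot_not_None_prob del: not_None_eq)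

lemma one_minus_exp_le: "1 - exp (- s) \<le> (s::real)"
  using exp_ge_add_one_self[of "- s"] by simp

section \<open>Finite clusters of influence\<close>

primrec paths :: "nat \<Rightarrow> site \<Rightarrow> site list set" where
  "paths 0 x = {[x]}"
| "paths (Suc n) x = (\<Union>y\<in>neighbours x. (#) x ` paths n y)"

lemma finite_paths: "finite (paths n x)"
  by (induction n arbitrary: x) auto

lemma card_paths: "card (paths n x) \<le> 4 ^ n"
proof (induction n arbitrary: x)
  case (Suc n)
  have "card (paths (Suc n) x) \<le> (\<Sum>y\<in>neighbours x. card ((#) x ` paths n y))"
    by (simp add: card_UN_le)
  also have "\<dots> \<le> (\<Sum>y\<in>neighbours x. 4 ^ n)"
    by (intro sum_mono order_trans[OF card_image_le Suc] finite_paths)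
  finally show ?case by (simp add: card_neighbours)
qed simp

lemma length_paths: "l \<in> paths n x \<Longrightarrow> length l = Suc n"
  by (induction n arbitrary: x l) auto

lemma paths_map:
  "f 0 = x \<Longrightarrow> (\<And>i. i < n \<Longrightarrow> f (Suc i) \<in> neighbours (f i)) \<Longrightarrow> map f [0..<Suc n] \<in> paths n x"
proof (induction n arbitrary: f x)
  case (Suc n)
  have "map (f \<circ> Suc) [0..<Suc n] \<in> paths n (f (Suc 0))"
    by (rule Suc.IH) (use Suc.prems in auto)
  moreover have "map f [0..<Suc (Suc n)] = f 0 # map (f \<circ> Suc) [0..<Suc n]"
    by (subst upt_conv_Cons) (auto simp: map_Suc_upt[symmetric] simp del: upt_Suc)
  ultimately show ?case using Suc.prems(1) Suc.prems(2)[of 0] by (auto simp del: upt_Suc)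
qed simp

text \<open>During the k-th slab the state of x can depend on a neighbour only if the clock at x
  rings. The slab length 1/8 makes this percolation subcritical: at most \<open>4 ^ n\<close> paths,
  each open with probability at most \<open>(1/8) ^ n\<close>.\<close>

definition influence :: "clocks \<Rightarrow> nat \<Rightarrow> site rel" where
  "influence w k = {(x, y). slot (1/8) (w x) k \<noteq> None \<and> y \<in> neighbours x}"

text \<open>A shortest chain of influence visits no site twice, and all its sites except possibly
  the last one ring. With more than n steps its first n + 1 sites would contradict the hypothesis,
  so the cluster lies within n steps of x.\<close>

lemma finite_influence:
  assumes no: "\<And>l. l \<in> paths n x \<Longrightarrow> distinct l \<Longrightarrow> \<exists>y\<in>set l. slot (1/8) (w y) k = None"
  shows "finite ((influence w k)\<^sup>* `` {x})"
proof -
  let ?r = "influence w k"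
  have fin: "finite ((?r ^^ m) `` {x})" for m
  proof (induction m)
    case (Suc m)
    have "(?r ^^ Suc m) `` {x} \<subseteq> (\<Union>y\<in>(?r ^^ m) `` {x}. neighbours y)"
      by (auto simp: influence_def)
    then show ?case by (rule finite_subset) (use Suc in auto)
  qed auto
  have "?r\<^sup>* `` {x} \<subseteq> (\<Union>m\<le>n. (?r ^^ m) `` {x})"
  proof
    fix y assume "y \<in> ?r\<^sup>* `` {x}"
    then have ex: "\<exists>m. (x, y) \<in> ?r ^^ m" by (auto simp: rtrancl_power)
    define m where "m = (LEAST m. (x, y) \<in> ?r ^^ m)"
    have m: "(x, y) \<in> ?r ^^ m" unfolding m_def using ex by (rule LeastI_ex)
    have least: "\<not> (x, y) \<in> ?r ^^ l" if "l < m" for l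
      using that unfolding m_def by (rule not_less_Least)
    from m obtain f where f: "f 0 = x" "f m = y" "\<And>i. i < m \<Longrightarrow> (f i, f (Suc i)) \<in> ?r"
      by (auto simp: relpow_fun_conv)
    have seg: "(f i, f j) \<in> ?r ^^ (j - i)" if "i \<le> j" "j \<le> m" for i j
      unfolding relpow_fun_conv using that f(3)
      by (intro exI[of _ "\<lambda>l. f (i + l)"]) auto
    have inj: "f i \<noteq> f j" if "i < j" "j \<le> m" for i j
    proof
      assume e: "f i = f j"
      have "(x, f i) \<in> ?r ^^ i" using seg[of 0 i] f that by simp
      moreover have "(f i, y) \<in> ?r ^^ (m - j)" using seg[of j m] f that e by simp
      ultimately have "(x, y) \<in> ?r ^^ (i + (m - j))" by (auto simp: relpow_add)
      moreover have "i + (m - j) < m" using that by simp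
      ultimately show False using least by blast
    qed
    have "m \<le> n"
    proof (rule ccontr)
      assume "\<not> m \<le> n"
      then have nm: "n < m" by simp
      have "map f [0..<Suc n] \<in> paths n x"
        by (rule paths_map) (use f nm in \<open>auto simp: influence_def\<close>)
      moreover have "inj_on f {0..<Suc n}"
        using inj nm by (intro inj_onI) (metis atLeastLessThan_iff less_Suc_eq_le less_imp_le_nat linorder_neqE_nat order_trans)
      then have "distinct (map f [0..<Suc n])" by (simp add: distinct_map del: upt_Suc)
      ultimately obtain z where "z \<in> set (map f [0..<Suc n])" "slot (1/8) (w z) k = None" using no by blast
      then have "\<exists>i<Suc n. slot (1/8) (w (f i)) k = None" by (auto simp del: upt_Suc)
      then obtain i where "i < Suc n" "slot (1/8) (w (f i)) k = None" by blast
      then show False using f(3)[of i] nm by (auto simp: influence_def)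
    qed
    with m show "y \<in> (\<Union>m\<le>n. (?r ^^ m) `` {x})" by auto
  qed
  then show ?thesis by (rule finite_subset) (use fin in auto)
qed

text \<open>A first moment bound over paths, restricted to self-avoiding ones because the clocks are
  independent at distinct sites.\<close>

lemma AE_finite_influence: "AE w in dyn_law. finite ((influence w k)\<^sup>* `` {x})"
proof -
  define A where "A n = (\<Union>l\<in>{l \<in> paths n x. distinct l}. {w. \<forall>y\<in>set l. slot (1/8) (w y) k \<noteq> None})" for n
  have m: "{w. \<forall>y\<in>set l. slot (1/8) (w y) k \<noteq> None} \<in> sets dyn_law" for l
  proof -
    have "{w \<in> space dyn_law. \<forall>y\<in>set l. slot (1/8) (w y) k \<noteq> None} \<in> sets dyn_law" by measurable
    then show ?thesis by simp
  qed
  have A: "A n \<in> sets dyn_law" for n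
    unfolding A_def by (intro sets.finite_UN m) (simp add: finite_paths)
  have le: "measure dyn_law (A n) \<le> (1/2) ^ n" for n
  proof -
    have "measure dyn_law (A n) \<le> (\<Sum>l\<in>{l \<in> paths n x. distinct l}. measure dyn_law {w. \<forall>y\<in>set l. slot (1/8) (w y) k \<noteq> None})"
      unfolding A_def using m by (intro dyn_law.finite_measure_subadditive_finite) (auto simp: finite_paths)
    also have "\<dots> \<le> (\<Sum>l\<in>{l \<in> paths n x. distinct l}. (1/8) ^ n)"
    proof (rule sum_mono)
      fix l assume "l \<in> {l \<in> paths n x. distinct l}"
      then have "card (set l) = Suc n" using length_paths[of l n x] distinct_card[of l] by auto
      then have "measure dyn_law {w. \<forall>y\<in>set l. slot (1/8) (w y) k \<noteq> None} = (1 - exp (- (1/8))) ^ Suc n"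
        using all_ring_prob[of "set l" "1/8" k] by (simp del: power_Suc not_None_eq)
      also have "\<dots> \<le> (1/8) ^ Suc n"
        using one_minus_exp_le[of "1/8"] by (intro power_mono) auto
      also have "\<dots> \<le> (1/8) ^ n" by simp
      finally show "measure dyn_law {w. \<forall>y\<in>set l. slot (1/8) (w y) k \<noteq> None} \<le> (1/8) ^ n" .
    qed
    also have "\<dots> = real (card {l \<in> paths n x. distinct l}) * (1/8) ^ n" by simp
    also have "\<dots> \<le> 4 ^ n * (1/8) ^ n"
    proof (rule mult_right_mono)
      have "card {l \<in> paths n x. distinct l} \<le> card (paths n x)"
        by (intro card_mono finite_paths) auto
      with card_paths[of n x] have "card {l \<in> paths n x. distinct l} \<le> 4 ^ n" by linarith
      then have "real (card {l \<in> paths n x. distinct l}) \<le> real (4 ^ n)" by (simp only: of_nat_le_iff)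
      then show "real (card {l \<in> paths n x. distinct l}) \<le> 4 ^ n" by simp
    qed simp
    also have "\<dots> = (1/2) ^ n" by (simp add: power_mult_distrib[symmetric])
    finally show ?thesis .
  qed
  have N: "(\<Inter>n. A n) \<in> sets dyn_law" using A by auto
  have "measure dyn_law (\<Inter>n. A n) \<le> (1/2) ^ n" for n
    using dyn_law.finite_measure_mono[of "\<Inter>n. A n" "A n"] A le[of n] by fastforce
  then have "measure dyn_law (\<Inter>n. A n) \<le> 0"
    by (intro LIMSEQ_le_const[OF LIMSEQ_power_zero[of "1/2::real"]]) auto
  then have "measure dyn_law (\<Inter>n. A n) = 0" using measure_nonneg[of dyn_law "\<Inter>n. A n"] by linarith
  then have "AE w in dyn_law. w \<notin> (\<Inter>n. A n)"
    using N by (intro AE_not_in) (auto simp: null_sets_def dyn_law.emeasure_eq_measure)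
  then show ?thesis
  proof eventually_elim
    case (elim w)
    then obtain n where "w \<notin> A n" by auto
    then show ?case unfolding A_def by (intro finite_influence[of n]) auto
  qed
qed

lemma slot_ex:
  assumes "0 < s" "0 < (t::real)"
  obtains k where "real k * s < t" "t \<le> real (Suc k) * s"
proof -
  \<comment> \<open>Slots are open on the left, hence the ceiling minus one instead of the
    floor.\<close>
  define k where "k = nat (\<lceil>t / s\<rceil> - 1)"
  have "0 < t / s" using assms by simp
  then have "0 < \<lceil>t / s\<rceil>" by simp
  then have "real k = real_of_int \<lceil>t / s\<rceil> - 1" unfolding k_def by simp
  then have "real k < t / s" "t / s \<le> real (Suc k)" by linarith+
  then show ?thesis using that[of k] assms by (simp add: field_simps)
qed

text \<open>Simultaneous rings before T put both clocks into the same slot of length s = 1 / (N +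
  1). Each of the T / s slots contributes a probability of at most the square of s, in total T s,
  which tends to 0.\<close>

lemma AE_rings_distinct:
  assumes xy: "x \<noteq> y"
  shows "AE w in dyn_law. \<forall>m n. ring (w x) m \<noteq> ring (w y) n"
proof -
  have good: "AE w in dyn_law. good_clock (w z)" for z
    unfolding dyn_law_eq by (intro AE_PiM_component AE_good_clock prob_space_clock_law) auto
  have "AE w in dyn_law. \<not> (\<exists>m n. ring (w x) m = ring (w y) n \<and> ring (w x) m \<le> real T)" for T :: nat
  proof -
    let ?B = "{w. \<exists>m n. ring (w x) m = ring (w y) n \<and> ring (w x) m \<le> real T}"
    have "{w \<in> space dyn_law. \<exists>m n. ring (w x) m = ring (w y) n \<and> ring (w x) m \<le> real T} \<in> sets dyn_law"
      by (intro sets.sets_Collect_countable_Ex sets.sets_Collect_conj borel_measurable_eq borel_measurable_le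
        ring_component_measurable borel_measurable_const)
    then have B: "?B \<in> sets dyn_law" by simp
    have le: "measure dyn_law ?B \<le> real T * inverse (real (Suc N))" for N
    proof -
      let ?s = "inverse (real (Suc N))"
      let ?C = "\<lambda>k. {w. \<forall>z\<in>{x, y}. slot ?s (w z) k \<noteq> None}"
      have C: "?C k \<in> sets dyn_law" for k
      proof -
        have "{w \<in> space dyn_law. \<forall>z\<in>{x, y}. slot ?s (w z) k \<noteq> None} \<in> sets dyn_law" by measurable
        then show ?thesis by simp
      qed
      have "AE w in dyn_law. w \<in> ?B \<longrightarrow> w \<in> (\<Union>k<T * Suc N. ?C k)"
        using good[of x] good[of y]
      proof eventually_elim
        case (elim w)
        show ?case
        proof
          assume "w \<in> ?B"
          then obtain m n where mn: "ring (w x) m = ring (w y) n" "ring (w x) m \<le> real T" by auto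
          obtain k where k: "real k * ?s < ring (w x) m" "ring (w x) m \<le> real (Suc k) * ?s"
            using slot_ex[of ?s "ring (w x) m"] ring_pos[OF elim(1)] by auto
          have "real k * ?s < real T" using k mn by linarith
          then have "real k < real (T * Suc N)" by (simp add: field_simps)
          then have "k < T * Suc N" by (simp only: of_nat_less_iff)
          moreover have "slot ?s (w x) k \<noteq> None" "slot ?s (w y) k \<noteq> None"
          proof -
            have "ring (w x) m \<in> {real k * ?s<..real (Suc k) * ?s}" "ring (w y) n \<in> {real k * ?s<..real (Suc k) * ?s}"
              using k mn by (simp_all only: greaterThanAtMost_iff)
            then show "slot ?s (w x) k \<noteq> None" "slot ?s (w y) k \<noteq> None"
              using slot_eq_None_iff[OF elim(1), of ?s k] slot_eq_None_iff[OF elim(2), of ?s k] by auto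
          qed
          ultimately show "w \<in> (\<Union>k<T * Suc N. ?C k)" by auto
        qed
      qed
      then have "measure dyn_law ?B \<le> measure dyn_law (\<Union>k<T * Suc N. ?C k)"
        using C by (intro dyn_law.finite_measure_mono_AE) auto
      also have "\<dots> \<le> (\<Sum>k<T * Suc N. measure dyn_law (?C k))"
        using C by (intro dyn_law.finite_measure_subadditive_finite) auto
      also have "\<dots> \<le> (\<Sum>k<T * Suc N. ?s\<^sup>2)"
      proof (rule sum_mono)
        fix k
        have "measure dyn_law (?C k) = (1 - exp (- ?s)) ^ card {x, y}"
          by (rule all_ring_prob) auto
        also have "card {x, y} = 2" using xy by simp
        also have "(1 - exp (- ?s)) ^ 2 \<le> ?s\<^sup>2"
          using one_minus_exp_le[of ?s] by (intro power_mono) auto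
        finally show "measure dyn_law (?C k) \<le> ?s\<^sup>2" .
      qed
      also have "\<dots> = real T * ?s * (real (Suc N) * ?s)"
        by (simp only: sum_constant card_lessThan of_nat_mult power2_eq_square mult_ac)
      also have "real (Suc N) * ?s = 1" by (rule right_inverse) simp
      finally show ?thesis by simp
    qed
    have lim: "(\<lambda>N. real T * inverse (real (Suc N))) \<longlonglongrightarrow> real T * 0"
      by (intro tendsto_mult tendsto_const LIMSEQ_inverse_real_of_nat)
    have "measure dyn_law ?B \<le> real T * 0"
      by (rule LIMSEQ_le_const[OF lim]) (use le in blast)
    then have "measure dyn_law ?B = 0" using measure_nonneg[of dyn_law ?B] by linarith
    then have "AE w in dyn_law. w \<notin> ?B"
      using B by (intro AE_not_in) (auto simp: null_sets_def dyn_law.emeasure_eq_measure)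
    then show ?thesis by simp
  qed
  then have "AE w in dyn_law. \<forall>T::nat. \<not> (\<exists>m n. ring (w x) m = ring (w y) n \<and> ring (w x) m \<le> real T)"
    by (simp add: AE_all_countable)
  then show ?thesis
    by eventually_elim (meson real_arch_simple)
qed

text \<open>From here on trajectories are compared deterministically; randomness of the clocks
  enters only through these properties.\<close>

definition good_clocks :: "clocks \<Rightarrow> bool" where
  "good_clocks w \<longleftrightarrow> (\<forall>x. good_clock (w x)) \<and> (\<forall>x y m n. x \<noteq> y \<longrightarrow> ring (w x) m \<noteq> ring (w y) n) \<and>
     (\<forall>k x. finite ((influence w k)\<^sup>* `` {x}))"

lemma AE_good_clocks: "AE w in dyn_law. good_clocks w"
proof -
  have "AE w in dyn_law. good_clock (w z)" for z
    unfolding dyn_law_eq by (intro AE_PiM_component AE_good_clock prob_space_clock_law) auto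
  moreover have "AE w in dyn_law. x \<noteq> y \<longrightarrow> (\<forall>m n. ring (w x) m \<noteq> ring (w y) n)" for x y
    using AE_rings_distinct[of x y] by (cases "x = y") auto
  ultimately have "AE w in dyn_law. (\<forall>z. good_clock (w z)) \<and> (\<forall>x y. x \<noteq> y \<longrightarrow> (\<forall>m n. ring (w x) m \<noteq> ring (w y) n)) \<and>
    (\<forall>k x. finite ((influence w k)\<^sup>* `` {x}))"
    using AE_finite_influence by (simp only: AE_conj_iff AE_all_countable simp_thms)
  then show ?thesis by eventually_elim (simp add: good_clocks_def)
qed

section \<open>Trajectories and their approximation in discrete time\<close>

lemma good_clocksD:
  assumes "good_clocks w"
  shows "good_clock (w x)" "x \<noteq> y \<Longrightarrow> ring (w x) m \<noteq> ring (w y) n" "finite ((influence w k)\<^sup>* `` {x})"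
  using assms unfolding good_clocks_def by blast+

definition apply_slot :: "bool option \<Rightarrow> site \<Rightarrow> config \<Rightarrow> config" where
  "apply_slot a x \<zeta> = (case a of None \<Rightarrow> \<zeta> | Some c \<Rightarrow> update x c \<zeta>)"

definition evolve :: "(nat \<times> site \<Rightarrow> bool option) \<Rightarrow> (nat \<times> site) list \<Rightarrow> config \<Rightarrow> config" where
  "evolve X l = fold (\<lambda>i. apply_slot (X i) (snd i)) l"

definition slots_list :: "site list \<Rightarrow> nat \<Rightarrow> (nat \<times> site) list" where
  "slots_list xs K = concat (map (\<lambda>k. map (Pair k) xs) [0..<K])"

definition array :: "real \<Rightarrow> clocks \<Rightarrow> nat \<times> site \<Rightarrow> bool option" where
  "array s w i = slot s (w (snd i)) (fst i)"

text \<open>The dynamics in discrete time: in each time slot of length \<open>s\<close> the sites of \<open>xs\<close> are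
  processed one after the other.\<close>

definition approximation :: "real \<Rightarrow> site list \<Rightarrow> nat \<Rightarrow> config \<Rightarrow> clocks \<Rightarrow> config" where
  "approximation s xs K \<eta> w = evolve (array s w) (slots_list xs K) \<eta>"

lemma evolve_simps [simp]:
  "evolve X [] \<zeta> = \<zeta>" "evolve X (i # l) \<zeta> = evolve X l (apply_slot (X i) (snd i) \<zeta>)"
  by (simp_all add: evolve_def)

lemma approximation_0 [simp]: "approximation s xs 0 \<eta> w = \<eta>"
  by (simp add: approximation_def slots_list_def)

lemma approximation_Suc:
  "approximation s xs (Suc K) \<eta> w = evolve (array s w) (map (Pair K) xs) (approximation s xs K \<eta> w)"
  by (simp add: approximation_def slots_list_def evolve_def)

lemma evolve_None: "\<forall>x\<in>set xs. X (k, x) = None \<Longrightarrow> evolve X (map (Pair k) xs) \<zeta> = \<zeta>"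
  by (induction xs) (auto simp: apply_slot_def)

text \<open>When at most one site rings in the slot, processing the list amounts to a single update
  and the order of the list is immaterial.\<close>

lemma evolve_single:
  assumes "distinct xs" "\<And>x y. x \<in> set xs \<Longrightarrow> y \<in> set xs \<Longrightarrow> X (k, x) \<noteq> None \<Longrightarrow> X (k, y) \<noteq> None \<Longrightarrow> x = y"
    and "x \<in> set xs"
  shows "evolve X (map (Pair k) xs) \<zeta> x = (case X (k, x) of None \<Rightarrow> \<zeta> x | Some c \<Rightarrow> updated_spin c \<zeta> x)"
  using assms
proof (induction xs)
  case (Cons y ys)
  show ?case
  proof (cases "X (k, y)")
    case None
    show ?thesis
    proof (cases "x = y")
      case True
      have "evolve X (map (Pair k) ys) \<zeta> y = \<zeta> y" if "y \<notin> set ys"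
        using that by (induction ys arbitrary: \<zeta>) (auto simp: apply_slot_def update_def split: option.split)
      then show ?thesis using None True Cons.prems(1) by (simp add: apply_slot_def)
    next
      case False
      then show ?thesis using None Cons by (simp add: apply_slot_def)
    qed
  next
    case (Some c)
    have n: "X (k, z) = None" if "z \<in> set ys" for z
      using Cons.prems(1) Cons.prems(2)[of y z] that Some by fastforce
    then have "evolve X (map (Pair k) (y # ys)) \<zeta> = update y c \<zeta>"
      using Some by (simp add: apply_slot_def evolve_None)
    moreover have "X (k, x) = None" if "x \<noteq> y" using n Cons.prems(3) that by simp
    ultimately show ?thesis using Some by (cases "x = y") (auto simp: update_def)
  qed
qed simp

definition separated :: "real \<Rightarrow> clocks \<Rightarrow> site set \<Rightarrow> nat \<Rightarrow> bool" where
  "separated h w S K \<longleftrightarrow> (\<forall>x\<in>S. \<forall>y\<in>S. \<forall>m n. \<forall>k<K.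
     ring (w x) m \<in> {real k * h<..real (Suc k) * h} \<longrightarrow> ring (w y) n \<in> {real k * h<..real (Suc k) * h} \<longrightarrow> x = y \<and> m = n)"

lemma trajectory_const:
  assumes "ising_trajectory \<eta> w s" "0 \<le> t" "t \<le> u" "\<And>n. ring (w x) n \<notin> {t<..u}"
  shows "s u x = s t x"
  using assms unfolding ising_trajectory_def ring_time_eq by blast

text \<open>Within the slot x changes only at its own ring, and by separation its neighbours are
  then still as at the start of the slot. Neighbours must lie in S only if x rings: border sites of
  a cluster are frozen.\<close>

lemma trajectory_step:
  assumes w: "good_clocks w" and s: "ising_trajectory \<eta> w s" and h: "0 < h" and sep: "separated h w S K" and k: "k < K"
    and x: "x \<in> S" and nb: "slot h (w x) k \<noteq> None \<Longrightarrow> neighbours x \<subseteq> S"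
  shows "s (real (Suc k) * h) x = (case slot h (w x) k of None \<Rightarrow> s (real k * h) x | Some c \<Rightarrow> updated_spin c (s (real k * h)) x)"
proof (cases "slot h (w x) k = None")
  case True
  have gx: "good_clock (w x)" using w by (rule good_clocksD)
  then have "ring (w x) n \<notin> {real k * h<..real (Suc k) * h}" for n
    using True slot_eq_None_iff[OF gx, of h k] h by auto
  then have "s (real (Suc k) * h) x = s (real k * h) x"
    using h by (intro trajectory_const[OF s]) auto
  then show ?thesis using True by simp
next
  case False
  have gx: "good_clock (w x)" using w by (rule good_clocksD)
  let ?a = "real k * h" and ?b = "real (Suc k) * h"
  obtain n where n: "ring (w x) n \<in> {?a<..?b}"
    using False slot_eq_None_iff[OF gx, of h k] h by auto
  have uniq: "x = y \<and> m = n" if "y \<in> S" "ring (w y) m \<in> {?a<..?b}" for y m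
    using sep n that k x unfolding separated_def by blast
  have Some: "slot h (w x) k = Some (snd (w x n))"
    using uniq[OF x] h by (intro slot_eq_Some[OF gx _ n]) auto
  let ?r = "ring (w x) n"
  have "\<forall>\<^sub>F u in at_left ?r. s ?r x = updated_spin (snd (w x n)) (s u) x"
    using s unfolding ising_trajectory_def ring_time_eq coin_def by blast
  moreover have "\<forall>\<^sub>F u in at_left ?r. u \<in> {?a<..<?r}"
    using n by (intro eventually_at_leftI[of ?a]) auto
  ultimately have "\<forall>\<^sub>F u in at_left ?r. s ?r x = updated_spin (snd (w x n)) (s u) x \<and> u \<in> {?a<..<?r}"
    by (rule eventually_conj)
  \<comment> \<open>The filter \<open>at_left\<close> is used through a single time u between the
    start of the slot and the ring.\<close>
  then obtain u where u: "s ?r x = updated_spin (snd (w x n)) (s u) x" "?a < u" "u < ?r"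
    using eventually_happens'[OF trivial_limit_at_left_real] by fastforce
  have a0: "0 \<le> ?a" using h by simp
  have su: "s u z = s ?a z" if "z \<in> insert x (neighbours x)" for z
  proof (rule trajectory_const[OF s a0])
    show "?a \<le> u" using u by simp
    fix m show "ring (w z) m \<notin> {?a<..u}"
    proof
      assume m: "ring (w z) m \<in> {?a<..u}"
      have "z \<in> S" using that x nb False by auto
      moreover have "ring (w z) m \<in> {?a<..?b}" using m u n by auto
      ultimately have "x = z \<and> m = n" by (rule uniq)
      then show False using m u by simp
    qed
  qed
  have "s ?b x = s ?r x"
  proof (rule trajectory_const[OF s])
    show "0 \<le> ?r" "?r \<le> ?b" using n a0 by auto
    fix m show "ring (w x) m \<notin> {?r<..?b}"
    proof
      assume m: "ring (w x) m \<in> {?r<..?b}"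
      then have "m = n" using uniq[OF x, of m] n by auto
      then show False using m by simp
    qed
  qed
  also have "\<dots> = updated_spin (snd (w x n)) (s ?a) x"
    unfolding u(1) by (rule updated_spin_cong) (use su in auto)
  finally show ?thesis using Some by simp
qed

lemma approximation_step:
  assumes w: "good_clocks w" and h: "0 < h" and sep: "separated h w (set xs) K" and k: "k < K"
    and xs: "distinct xs" and x: "x \<in> set xs"
  shows "approximation h xs (Suc k) \<eta> w x = (case slot h (w x) k of None \<Rightarrow> approximation h xs k \<eta> w x
    | Some c \<Rightarrow> updated_spin c (approximation h xs k \<eta> w) x)"
proof -
  have *: "y = z" if "y \<in> set xs" "z \<in> set xs" "array h w (k, y) \<noteq> None" "array h w (k, z) \<noteq> None" for y z
  proof -
    note yz = that
    have "good_clock (w y)" "good_clock (w z)" using w by (auto intro: good_clocksD)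
    then obtain m n where "ring (w y) m \<in> {real k * h<..real (Suc k) * h}" "ring (w z) n \<in> {real k * h<..real (Suc k) * h}"
      using yz(3,4) h by (auto simp: array_def slot_eq_None_iff)
    then show ?thesis using sep k yz(1,2) unfolding separated_def by blast
  qed
  have "evolve (array h w) (map (Pair k) xs) \<zeta> x = (case array h w (k, x) of None \<Rightarrow> \<zeta> x | Some c \<Rightarrow> updated_spin c \<zeta> x)" for \<zeta>
    by (rule evolve_single[OF xs * x])
  then show ?thesis
    unfolding approximation_Suc by (simp add: array_def)
qed

text \<open>On a set closed under influence in the i-th slab nothing enters from outside, so
  agreement at the start of the slab persists from slot to slot.\<close>

lemma approximation_slab:
  assumes w: "good_clocks w" and s: "ising_trajectory \<eta> w s" and h: "0 < h" "h * real r = 1/8"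
    and sep: "separated h w (set xs) (Suc i * r)" and xs: "distinct xs" and C: "C \<subseteq> set xs"
    and closed: "\<And>x. x \<in> C \<Longrightarrow> slot (1/8) (w x) i \<noteq> None \<Longrightarrow> neighbours x \<subseteq> C"
    and init: "\<And>x. x \<in> C \<Longrightarrow> s (real (i * r) * h) x = approximation h xs (i * r) \<eta> w x"
    and j: "j \<le> r"
  shows "\<forall>x\<in>C. s (real (i * r + j) * h) x = approximation h xs (i * r + j) \<eta> w x"
  using j
proof (induction j)
  case 0
  then show ?case using init by simp
next
  case (Suc j)
  let ?k = "i * r + j"
  have k: "?k < Suc i * r" using Suc.prems by simp
  have IH: "s (real ?k * h) x = approximation h xs ?k \<eta> w x" if "x \<in> C" for x
    using Suc that by simp
  have "s (real (Suc ?k) * h) x = approximation h xs (Suc ?k) \<eta> w x" if x: "x \<in> C" for x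
  proof -
    have gx: "good_clock (w x)" using w by (rule good_clocksD)
    \<comment> \<open>A ring in a fine slot is also a ring in the slab containing it, so closedness
      of C applies.\<close>
    have nb: "neighbours x \<subseteq> C" if ne: "slot h (w x) ?k \<noteq> None"
    proof (rule closed[OF x])
      obtain n where n: "ring (w x) n \<in> {real ?k * h<..real (Suc ?k) * h}"
        using ne slot_eq_None_iff[OF gx, of h ?k] h by auto
      have rh: "real r * h = 1/8" using h by (simp add: mult.commute)
      have "real i * (1/8) = real (i * r) * h" using rh by (simp add: mult.assoc)
      also have "\<dots> \<le> real ?k * h" using h by (intro mult_right_mono) auto
      finally have 1: "real i * (1/8) < ring (w x) n" using n by simp
      have "real (Suc ?k) * h \<le> real (Suc i * r) * h" using h Suc.prems by (intro mult_right_mono) auto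
      also have "real (Suc i * r) * h = real (Suc i) * (real r * h)" by (simp only: of_nat_mult mult.assoc)
      finally have 2: "ring (w x) n \<le> real (Suc i) * (1/8)" using n unfolding rh by auto
      show "slot (1/8) (w x) i \<noteq> None"
        using slot_eq_None_iff[OF gx, of "1/8" i] 1 2 by auto
    qed
    have "s (real (Suc ?k) * h) x = (case slot h (w x) ?k of None \<Rightarrow> s (real ?k * h) x | Some c \<Rightarrow> updated_spin c (s (real ?k * h)) x)"
      using nb C x by (intro trajectory_step[OF w s h(1) sep k]) auto
    also have "\<dots> = (case slot h (w x) ?k of None \<Rightarrow> approximation h xs ?k \<eta> w x | Some c \<Rightarrow> updated_spin c (approximation h xs ?k \<eta> w) x)"
    proof (cases "slot h (w x) ?k")
      case (Some c)
      then have "updated_spin c (s (real ?k * h)) x = updated_spin c (approximation h xs ?k \<eta> w) x"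
        using nb IH x by (intro updated_spin_cong) auto
      then show ?thesis using Some by simp
    qed (use IH x in simp)
    also have "\<dots> = approximation h xs (Suc ?k) \<eta> w x"
      using C x by (intro approximation_step[OF w h(1) sep k xs, symmetric]) auto
    finally show ?thesis .
  qed
  then show ?case by simp
qed

lemma mesh_slab: "3 \<le> m \<Longrightarrow> (1/2) ^ m * real (2 ^ (m - 3)) = (1/8 :: real)"
proof -
  assume "3 \<le> m"
  then obtain j where "m = j + 3" using le_Suc_ex by (metis add.commute)
  then show ?thesis by (simp add: power_add power_divide)
qed

text \<open>B is built backwards in time: A during slab i requires the cluster of A at the end of
  slab i - 1, a finite set to which the induction hypothesis applies. It depends on the clocks but
  not on mesh, list or trajectory, so it can be fixed before any limit is taken.\<close>

lemma approximation_slabs: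
  assumes w: "good_clocks w" and "finite A"
  shows "\<exists>B. finite B \<and> (\<forall>m xs \<eta> s. 3 \<le> m \<longrightarrow> distinct xs \<longrightarrow> B \<subseteq> set xs \<longrightarrow>
    separated ((1/2) ^ m) w (set xs) (Suc i * 2 ^ (m - 3)) \<longrightarrow> ising_trajectory \<eta> w s \<longrightarrow>
    (\<forall>j\<le>2 ^ (m - 3). \<forall>x\<in>A. s (real (i * 2 ^ (m - 3) + j) * (1/2) ^ m) x = approximation ((1/2) ^ m) xs (i * 2 ^ (m - 3) + j) \<eta> w x))"
  using \<open>finite A\<close>
proof (induction i arbitrary: A)
  fix i :: nat and A :: "site set"
  let ?C = "\<lambda>i A. (\<Union>x\<in>A. (influence w i)\<^sup>* `` {x})"
  have fin: "finite (?C i A)" if "finite A" for i A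
    using that good_clocksD(3)[OF w] by auto
  have sub: "A \<subseteq> ?C i A" for i A by auto
  have closed: "neighbours x \<subseteq> ?C i A" if "x \<in> ?C i A" "slot (1/8) (w x) i \<noteq> None" for x i A
    using that by (auto simp: influence_def intro: rtrancl_into_rtrancl)
  {
    case 0
    show ?case
    proof (intro exI[of _ "?C 0 A"] conjI allI impI ballI)
      fix m :: nat and xs \<eta> s and j :: nat and x
      assume a: "3 \<le> m" "distinct xs" "?C 0 A \<subseteq> set xs" "separated ((1/2) ^ m) w (set xs) (Suc 0 * 2 ^ (m - 3))"
        "ising_trajectory \<eta> w s" "j \<le> 2 ^ (m - 3)" "x \<in> A"
      have "s 0 = \<eta>" using a by (simp add: ising_trajectory_def)
      then have "\<forall>x\<in>?C 0 A. s (real (0 * 2 ^ (m - 3) + j) * (1/2) ^ m) x = approximation ((1/2) ^ m) xs (0 * 2 ^ (m - 3) + j) \<eta> w x"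
        by (intro approximation_slab[OF w a(5) _ mesh_slab[OF a(1)] a(4,2,3) closed _ a(6)]) auto
      then show "s (real (0 * 2 ^ (m - 3) + j) * (1/2) ^ m) x = approximation ((1/2) ^ m) xs (0 * 2 ^ (m - 3) + j) \<eta> w x"
        using a(7) sub by blast
    qed (rule fin[OF 0])
  next
    case (Suc i)
    from Suc.IH[OF fin[OF Suc.prems, of "Suc i"]] obtain B where B: "finite B"
      "\<forall>m xs \<eta> s. 3 \<le> m \<longrightarrow> distinct xs \<longrightarrow> B \<subseteq> set xs \<longrightarrow>
        separated ((1/2) ^ m) w (set xs) (Suc i * 2 ^ (m - 3)) \<longrightarrow> ising_trajectory \<eta> w s \<longrightarrow>
        (\<forall>j\<le>2 ^ (m - 3). \<forall>x\<in>?C (Suc i) A. s (real (i * 2 ^ (m - 3) + j) * (1/2) ^ m) x = approximation ((1/2) ^ m) xs (i * 2 ^ (m - 3) + j) \<eta> w x)"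
      by (elim exE conjE) (rule that)
    show ?case
    proof (intro exI[of _ "B \<union> ?C (Suc i) A"] conjI allI impI ballI)
      fix m :: nat and xs \<eta> s and j :: nat and x
      assume a: "3 \<le> m" "distinct xs" "B \<union> ?C (Suc i) A \<subseteq> set xs" "separated ((1/2) ^ m) w (set xs) (Suc (Suc i) * 2 ^ (m - 3))"
        "ising_trajectory \<eta> w s" "j \<le> 2 ^ (m - 3)" "x \<in> A"
      have sep: "separated ((1/2) ^ m) w (set xs) (Suc i * 2 ^ (m - 3))"
        using a(4) unfolding separated_def by (meson less_le_trans le_add2 mult_le_mono1 lessI less_imp_le_nat)
      have init: "s (real (Suc i * 2 ^ (m - 3)) * (1/2) ^ m) x = approximation ((1/2) ^ m) xs (Suc i * 2 ^ (m - 3)) \<eta> w x"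
        if "x \<in> ?C (Suc i) A" for x
        using B(2)[rule_format, OF a(1,2) _ sep a(5) _ that, of "2 ^ (m - 3)"] a(3) by (simp add: add.commute)
      have C: "?C (Suc i) A \<subseteq> set xs" using a(3) by blast
      have "\<forall>x\<in>?C (Suc i) A. s (real (Suc i * 2 ^ (m - 3) + j) * (1/2) ^ m) x = approximation ((1/2) ^ m) xs (Suc i * 2 ^ (m - 3) + j) \<eta> w x"
        by (intro approximation_slab[OF w a(5) _ mesh_slab[OF a(1)] a(4,2) C closed init a(6)]) auto
      then show "s (real (Suc i * 2 ^ (m - 3) + j) * (1/2) ^ m) x = approximation ((1/2) ^ m) xs (Suc i * 2 ^ (m - 3) + j) \<eta> w x"
        using a(7) sub by blast
    qed (use fin[OF Suc.prems] B in auto)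
  }
qed

lemma separated_eventually:
  assumes w: "good_clocks w" and S: "finite S"
  shows "\<exists>m0. \<forall>m\<ge>m0. separated ((1/2) ^ m) w S (T * 2 ^ m)"
proof -
  define R where "R = {p. fst p \<in> S \<and> ring (w (fst p)) (snd p) \<le> real T}"
  let ?t = "\<lambda>p. ring (w (fst p)) (snd p)"
  have "finite {n. ring (w x) n \<le> real T}" for x
  proof -
    have g: "good_clock (w x)" using w by (rule good_clocksD)
    then obtain N where N: "real T < ring (w x) N" by (auto simp: good_clock_def)
    have "{n. ring (w x) n \<le> real T} \<subseteq> {..N}"
    proof
      fix n assume "n \<in> {n. ring (w x) n \<le> real T}"
      then have "ring (w x) n < ring (w x) N" using N by simp
      then show "n \<in> {..N}" using ring_strict_mono[OF g] by (simp add: strict_mono_less)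
    qed
    then show ?thesis by (rule finite_subset) simp
  qed
  then have "finite (SIGMA x:S. {n. ring (w x) n \<le> real T})" using S by auto
  moreover have "R = (SIGMA x:S. {n. ring (w x) n \<le> real T})" by (auto simp: R_def)
  ultimately have R: "finite R" by simp
  have inj: "?t p \<noteq> ?t q" if "p \<noteq> q" for p q
  proof (cases "fst p = fst q")
    case True
    have g: "good_clock (w (fst q))" using w by (rule good_clocksD)
    have "snd p \<noteq> snd q" using that True by (auto simp: prod_eq_iff)
    then show ?thesis using True strict_mono_eq[OF ring_strict_mono[OF g]] by simp
  next
    case False
    then show ?thesis by (rule good_clocksD(2)[OF w])
  qed
  \<comment> \<open>Finitely many distinct ring times have a positive smallest gap; inserting 1
    keeps F nonempty.\<close>
  define F where "F = insert 1 ((\<lambda>(p, q). \<bar>?t p - ?t q\<bar>) ` {(p, q). p \<in> R \<and> q \<in> R \<and> p \<noteq> q})"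
  have "finite {(p, q). p \<in> R \<and> q \<in> R \<and> p \<noteq> q}"
    by (rule finite_subset[of _ "R \<times> R"]) (use R in auto)
  then have F: "finite F" "F \<noteq> {}" by (auto simp: F_def)
  have "0 < Min F" using F inj by (auto simp: F_def)
  then obtain m0 where m0: "(1/2 :: real) ^ m0 < Min F"
    using real_arch_pow_inv[of "Min F" "1/2"] by auto
  show ?thesis
  proof (intro exI[of _ m0] allI impI)
    fix m assume "m0 \<le> m"
    then have "(1/2 :: real) ^ m \<le> (1/2) ^ m0" by (intro power_decreasing) auto
    then have h: "(1/2 :: real) ^ m < Min F" by (rule order.strict_trans1[OF _ m0])
    let ?h = "(1/2 :: real) ^ m"
    show "separated ?h w S (T * 2 ^ m)"
      unfolding separated_def
    proof (intro ballI allI impI)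
      fix x y a b k
      assume xy: "x \<in> S" "y \<in> S" and k: "k < T * 2 ^ m"
        and r: "ring (w x) a \<in> {real k * ?h<..real (Suc k) * ?h}" "ring (w y) b \<in> {real k * ?h<..real (Suc k) * ?h}"
      have "real (Suc k) \<le> real (T * 2 ^ m)" using k by (intro of_nat_mono) simp
      then have "real (Suc k) * ?h \<le> real (T * 2 ^ m) * ?h" by (intro mult_right_mono) auto
      also have "\<dots> = real T" by (simp add: power_divide)
      finally have le: "ring (w x) a \<le> real T" "ring (w y) b \<le> real T" using r by auto
      show "x = y \<and> a = b"
      proof (rule ccontr)
        assume "\<not> (x = y \<and> a = b)"
        then have "\<bar>ring (w x) a - ring (w y) b\<bar> \<in> F"
          using le xy unfolding F_def R_def by (intro insertI2 image_eqI[of _ _ "((x, a), (y, b))"]) auto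
        then have "Min F \<le> \<bar>ring (w x) a - ring (w y) b\<bar>" using F by simp
        moreover have "\<bar>ring (w x) a - ring (w y) b\<bar> < ?h" using r by (auto simp: algebra_simps)
        ultimately show False using h by simp
      qed
    qed
  qed
qed

lemma approximation_agrees:
  assumes w: "good_clocks w" and A: "finite A"
  shows "\<exists>B. finite B \<and> (\<forall>xs. distinct xs \<longrightarrow> B \<subseteq> set xs \<longrightarrow> (\<exists>m0. \<forall>m\<ge>m0. \<forall>k\<le>T * 2 ^ m. \<forall>\<eta> s.
    ising_trajectory \<eta> w s \<longrightarrow> (\<forall>x\<in>A. s (real k * (1/2) ^ m) x = approximation ((1/2) ^ m) xs k \<eta> w x)))"
proof -
  obtain B where B: "\<And>i. finite (B i)" "\<And>i m xs \<eta> s j x. 3 \<le> m \<Longrightarrow> distinct xs \<Longrightarrow> B i \<subseteq> set xs \<Longrightarrow>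
    separated ((1/2) ^ m) w (set xs) (Suc i * 2 ^ (m - 3)) \<Longrightarrow> ising_trajectory \<eta> w s \<Longrightarrow>
    j \<le> 2 ^ (m - 3) \<Longrightarrow> x \<in> A \<Longrightarrow> s (real (i * 2 ^ (m - 3) + j) * (1/2) ^ m) x = approximation ((1/2) ^ m) xs (i * 2 ^ (m - 3) + j) \<eta> w x"
    using approximation_slabs[OF w A] by metis
  show ?thesis
  \<comment> \<open>Eight slabs per unit of time; the extra unit covers the slab starting at T,
    where \<open>k = T * 2 ^ m\<close> falls after division by the slab length.\<close>
  proof (intro exI[of _ "\<Union>i<8 * Suc T. B i"] conjI allI impI)
    show "finite (\<Union>i<8 * Suc T. B i)" using B by auto
    fix xs :: "site list" assume xs: "distinct xs" "(\<Union>i<8 * Suc T. B i) \<subseteq> set xs"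
    obtain m0 where m0: "\<And>m. m0 \<le> m \<Longrightarrow> separated ((1/2) ^ m) w (set xs) (Suc T * 2 ^ m)"
      using separated_eventually[OF w, of "set xs" "Suc T"] by auto
    show "\<exists>m0. \<forall>m\<ge>m0. \<forall>k\<le>T * 2 ^ m. \<forall>\<eta> s.
      ising_trajectory \<eta> w s \<longrightarrow> (\<forall>x\<in>A. s (real k * (1/2) ^ m) x = approximation ((1/2) ^ m) xs k \<eta> w x)"
    proof (intro exI[of _ "max m0 3"] allI impI ballI)
      fix m k \<eta> s x assume m: "max m0 3 \<le> m" and k: "k \<le> T * 2 ^ m" and s: "ising_trajectory \<eta> w s" and x: "x \<in> A"
      let ?r = "2 ^ (m - 3) :: nat"
      define i where "i = k div ?r"
      define j where "j = k mod ?r"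
      have kij: "k = i * ?r + j" unfolding i_def j_def by (rule div_mult_mod_eq[symmetric])
      have j: "j \<le> ?r" by (simp add: j_def less_imp_le)
      have m8: "2 ^ m = 8 * ?r"
      proof -
        obtain l where "m = l + 3" using m by (metis le_Suc_ex max.boundedE add.commute)
        then show ?thesis by (simp add: power_add)
      qed
      have "i * ?r \<le> k" unfolding kij by simp
      also have "k \<le> (8 * T) * ?r" using k unfolding m8 by (simp add: mult_ac)
      finally have "i * ?r \<le> (8 * T) * ?r" .
      then have i: "i \<le> 8 * T" by (simp only: mult_le_cancel2) simp
      have "Suc i * ?r \<le> (8 * Suc T) * ?r" using i by (intro mult_right_mono) auto
      also have "\<dots> = Suc T * 2 ^ m" unfolding m8 by (simp only: mult_ac)
      finally have "separated ((1/2) ^ m) w (set xs) (Suc i * ?r)"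
        using m0[of m] m unfolding separated_def by (meson less_le_trans max.boundedE)
      moreover have "B i \<subseteq> (\<Union>i<8 * Suc T. B i)" using i by (intro UN_upper) simp
      then have "B i \<subseteq> set xs" using xs(2) by (rule subset_trans)
      ultimately show "s (real k * (1/2) ^ m) x = approximation ((1/2) ^ m) xs k \<eta> w x"
        unfolding kij using m xs s x j by (intro B(2)) auto
    qed
  qed
qed

text \<open>Both trajectories are constant at x from t until just before the next ring, and at a
  dyadic time in between both are computed by the same finite approximation.\<close>

lemma trajectory_unique:
  assumes w: "good_clocks w" and s: "ising_trajectory \<eta> w s" "ising_trajectory \<eta> w s'" and t: "0 \<le> t"
  shows "s t = s' t"
proof
  fix x
  have g: "good_clock (w x)" using w by (rule good_clocksD)
  obtain n where n: "counts t (w x) n" using good_counts[OF g] by blast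
  then have tn: "t < ring (w x) n" by (simp add: counts_def)
  obtain T :: nat where T: "ring (w x) n \<le> real T" using real_arch_simple by blast
  obtain B where B: "finite B" "\<And>xs. distinct xs \<Longrightarrow> B \<subseteq> set xs \<Longrightarrow> (\<exists>m0. \<forall>m\<ge>m0. \<forall>k\<le>T * 2 ^ m. \<forall>\<eta> s.
    ising_trajectory \<eta> w s \<longrightarrow> (\<forall>x\<in>{x}. s (real k * (1/2) ^ m) x = approximation ((1/2) ^ m) xs k \<eta> w x))"
    using approximation_agrees[OF w, of "{x}" T] by auto
  obtain xs where xs: "set xs = B" "distinct xs" using finite_distinct_list[OF B(1)] by blast
  obtain m0 where m0: "\<And>m k s. m0 \<le> m \<Longrightarrow> k \<le> T * 2 ^ m \<Longrightarrow> ising_trajectory \<eta> w s \<Longrightarrow>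
    s (real k * (1/2) ^ m) x = approximation ((1/2) ^ m) xs k \<eta> w x"
    using B(2)[OF xs(2)] xs(1) by blast
  obtain m1 where m1: "(1/2 :: real) ^ m1 < ring (w x) n - t"
    using real_arch_pow_inv[of "ring (w x) n - t" "1/2"] tn by auto
  \<comment> \<open>Fine enough for the approximation and for a grid point between t and the next
    ring at x.\<close>
  define m where "m = max m0 m1"
  have "(1/2 :: real) ^ m \<le> (1/2) ^ m1" unfolding m_def by (intro power_decreasing) auto
  then have h: "(1/2 :: real) ^ m < ring (w x) n - t" by (rule order.strict_trans1[OF _ m1])
  obtain k where k: "real k * (1/2) ^ m < t + (1/2) ^ m" "t + (1/2) ^ m \<le> real (Suc k) * (1/2) ^ m"
    using slot_ex[of "(1/2) ^ m" "t + (1/2) ^ m"] t by (auto simp: add_nonneg_pos)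
  let ?u = "real k * (1/2) ^ m"
  have u: "t \<le> ?u" "?u < ring (w x) n" using k h by (auto simp: algebra_simps)
  have "real k = ?u * 2 ^ m" by (simp add: power_divide)
  also have "\<dots> \<le> real T * 2 ^ m" using u T by (intro mult_right_mono) auto
  finally have "real k \<le> real (T * 2 ^ m)" by simp
  then have kT: "k \<le> T * 2 ^ m" by (simp only: of_nat_le_iff)
  have no: "ring (w x) l \<notin> {t<..?u}" for l
  proof
    assume l: "ring (w x) l \<in> {t<..?u}"
    then have "\<not> l < n" using n by (auto simp: counts_def)
    then have "ring (w x) n \<le> ring (w x) l"
      using ring_strict_mono[OF g] by (simp add: strict_mono_less_eq)
    with l u show False by simp
  qed
  have "s t x = s ?u x" "s' t x = s' ?u x"
    using trajectory_const[OF s(1) t u(1) no] trajectory_const[OF s(2) t u(1) no] by simp_all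
  moreover have "s ?u x = s' ?u x"
    using m0[OF _ kT s(1)] m0[OF _ kT s(2)] by (simp add: m_def)
  ultimately show "s t x = s' t x" by simp
qed

section \<open>The law of the approximation\<close>

interpretation initial_law: prob_space initial_law by (rule prob_space_initial_law)
interpretation ising_law: prob_space ising_law by (rule prob_space_ising_law)

lemma sets_initial_law: "sets initial_law = sets state_space"
  unfolding initial_law_def state_space_def
  by (intro sets_PiM_cong) (auto simp: sets_uniform_count_measure)

lemma space_state_space: "space state_space = spins"
  by (auto simp: state_space_def space_PiM PiE_def Pi_def spins_def)

lemma space_initial_law: "space initial_law = spins"
  using sets_eq_imp_space_eq[OF sets_initial_law] space_state_space by simp

lemma space_ising_law: "space ising_law = spins \<times> UNIV"
  by (simp add: ising_law_def space_pair_measure space_initial_law)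

lemma pred_spin [measurable]: "Measurable.pred state_space (\<lambda>\<eta>. \<eta> x = a)"
proof -
  have "(\<lambda>\<eta>. \<eta> x) \<in> state_space \<rightarrow>\<^sub>M count_space {-1, 1}"
    unfolding state_space_def by (rule measurable_component_singleton) simp
  then have "(\<lambda>\<eta>. \<eta> x = a) \<in> state_space \<rightarrow>\<^sub>M count_space UNIV"
    by (rule measurable_compose) simp
  then show ?thesis by simp
qed

lemma cylinder_measurable:
  fixes f :: "config \<Rightarrow> real"
  assumes "finite S" "cylinder S f"
  shows "f \<in> borel_measurable state_space"
  using assms
proof (induction S arbitrary: f)
  case empty
  then have "f = (\<lambda>_. f (\<lambda>_. 1))" by (auto simp: cylinder_def)
  then show ?case by (metis borel_measurable_const)
next
  case (insert x S)
  have m: "(\<lambda>\<eta>. f (\<eta>(x := a))) \<in> borel_measurable state_space" for a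
    using insert.prems by (intro insert.IH) (auto simp: cylinder_def)
  have "(\<lambda>\<eta>. if \<eta> x = 1 then f (\<eta>(x := 1)) else f (\<eta>(x := -1))) \<in> borel_measurable state_space"
    using m by measurable
  moreover have "f \<eta> = (if \<eta> x = 1 then f (\<eta>(x := 1)) else f (\<eta>(x := -1)))" if "\<eta> \<in> space state_space" for \<eta>
    using spinsD[of \<eta> x] that by (auto simp: space_state_space intro!: arg_cong[where f = f])
  ultimately show ?case by (subst measurable_cong)
qed

lemma cylinder_measurable_initial:
  fixes f :: "config \<Rightarrow> real"
  assumes "finite S" "cylinder S f" shows "f \<in> borel_measurable initial_law"
  using cylinder_measurable[OF assms] measurable_cong_sets[OF sets_initial_law refl] by blast

lemma integrable_bounded_initial:
  fixes f :: "config \<Rightarrow> real"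
  assumes "finite S" "cylinder S f" "\<And>\<eta>. \<bar>f \<eta>\<bar> \<le> C"
  shows "integrable initial_law f"
  using assms by (intro initial_law.integrable_const_bound[where B = C] cylinder_measurable_initial) auto

section \<open>Association of the initial law\<close>

definition randomise :: "site \<Rightarrow> (config \<Rightarrow> real) \<Rightarrow> config \<Rightarrow> real" where
  "randomise x f \<eta> = (f (\<eta>(x := 1)) + f (\<eta>(x := -1))) / 2"

text \<open>Replacing one coordinate of a product measure by an independent copy leaves the measure
  unchanged.\<close>

lemma integral_randomise:
  assumes S: "finite S" "cylinder S f" and C: "\<And>\<eta>. \<bar>f \<eta>\<bar> \<le> C"
  shows "(\<integral>\<eta>. randomise x f \<eta> \<partial>initial_law) = (\<integral>\<eta>. f \<eta> \<partial>initial_law)"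
proof -
  let ?M = "\<lambda>_::site. uniform_count_measure {-1, 1 :: int}"
  have ps: "prob_space (?M x)" by (intro prob_space_uniform_count_measure) auto
  interpret M: prob_space "?M x" by (rule ps)
  interpret P: pair_prob_space "?M x" initial_law by unfold_locales
  let ?T = "\<lambda>(a, \<eta>). \<eta>(x := a) :: config"
  have D: "distr (?M x \<Otimes>\<^sub>M initial_law) initial_law ?T = initial_law"
    using distr_pair_PiM_eq_PiM[of UNIV ?M x] ps by (simp add: initial_law_def)
  have T: "?T \<in> ?M x \<Otimes>\<^sub>M initial_law \<rightarrow>\<^sub>M initial_law"
    unfolding initial_law_def case_prod_beta'
    by (rule measurable_fun_upd[where J = UNIV]) (auto intro: measurable_snd measurable_fst)
  have f: "f \<in> borel_measurable initial_law" by (rule cylinder_measurable_initial[OF S])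
  have fT: "(\<lambda>p. f (?T p)) \<in> borel_measurable (?M x \<Otimes>\<^sub>M initial_law)"
    by (rule measurable_compose[OF T f])
  have int: "integrable (?M x \<Otimes>\<^sub>M initial_law) (\<lambda>p. f (?T p))"
    by (rule P.integrable_const_bound[where B = C]) (use C fT in auto)
  have cyl: "cylinder S (\<lambda>\<eta>. f (\<eta>(x := a)))" for a
    using S(2) unfolding cylinder_def by auto
  have inta: "integrable initial_law (\<lambda>\<eta>. f (\<eta>(x := a)))" for a
    using C by (intro integrable_bounded_initial[OF S(1) cyl]) auto
  have "(\<integral>\<eta>. f \<eta> \<partial>initial_law) = (\<integral>\<eta>. f \<eta> \<partial>distr (?M x \<Otimes>\<^sub>M initial_law) initial_law ?T)"
    by (simp only: D)
  also have "\<dots> = (\<integral>p. f (?T p) \<partial>(?M x \<Otimes>\<^sub>M initial_law))"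
    by (rule integral_distr[OF T f])
  also have "\<dots> = (\<integral>a. (\<integral>\<eta>. f (?T (a, \<eta>)) \<partial>initial_law) \<partial>?M x)"
    by (rule P.integral_fst'[symmetric, OF int])
  also have "\<dots> = ((\<integral>\<eta>. f (\<eta>(x := -1)) \<partial>initial_law) + (\<integral>\<eta>. f (\<eta>(x := 1)) \<partial>initial_law)) / 2"
    by (simp add: integral_uniform_count_measure)
  also have "\<dots> = (\<integral>\<eta>. randomise x f \<eta> \<partial>initial_law)"
    unfolding randomise_def using inta by simp
  finally show ?thesis by simp
qed

lemma increasing_randomise: "increasing f \<Longrightarrow> increasing (randomise x f)"
  unfolding increasing_def
proof (intro ballI impI)
  fix \<eta> \<zeta> assume f: "\<forall>\<eta>\<in>spins. \<forall>\<zeta>\<in>spins. \<eta> \<le> \<zeta> \<longrightarrow> f \<eta> \<le> f \<zeta>" and s: "\<eta> \<in> spins" "\<zeta> \<in> spins" "\<eta> \<le> \<zeta>"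
  have "f (\<eta>(x := a)) \<le> f (\<zeta>(x := a))" if "a = 1 \<or> a = -1" for a
    using f s that by (auto simp: spins_def le_fun_def)
  from this[of 1] this[of "-1"] show "randomise x f \<eta> \<le> randomise x f \<zeta>"
    unfolding randomise_def by simp
qed

lemma randomise_mult:
  assumes f: "increasing f" "increasing g" and \<eta>: "\<eta> \<in> spins"
  shows "randomise x f \<eta> * randomise x g \<eta> \<le> randomise x (\<lambda>\<eta>. f \<eta> * g \<eta>) \<eta>"
proof -
  have "(f (\<eta>(x := 1)) - f (\<eta>(x := -1))) * (g (\<eta>(x := 1)) - g (\<eta>(x := -1))) \<ge> 0"
    by (rule increasing_single_site[OF f, where x = x]) (use \<eta> in \<open>auto simp: spins_def\<close>)
  then show ?thesis by (simp add: randomise_def field_simps)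
qed

lemma cylinder_randomise: "cylinder S f \<Longrightarrow> cylinder (S - {x}) (randomise x f)"
  unfolding cylinder_def randomise_def
proof (intro allI impI)
  fix \<eta> \<zeta> :: config
  assume f: "\<forall>\<eta> \<zeta>. (\<forall>x\<in>S. \<eta> x = \<zeta> x) \<longrightarrow> f \<eta> = f \<zeta>" and e: "\<forall>y\<in>S - {x}. \<eta> y = \<zeta> y"
  have "f (\<eta>(x := a)) = f (\<zeta>(x := a))" for a using e by (intro f[rule_format]) auto
  then show "(f (\<eta>(x := 1)) + f (\<eta>(x := - 1))) / 2 = (f (\<zeta>(x := 1)) + f (\<zeta>(x := - 1))) / 2" by simp
qed

lemma randomise_bound:
  fixes C :: real
  assumes C: "\<And>\<eta>. \<bar>f \<eta>\<bar> \<le> C" shows "\<bar>randomise x f \<eta>\<bar> \<le> C"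
  using C[of "\<eta>(x := 1)"] C[of "\<eta>(x := -1)"] unfolding randomise_def by (simp add: abs_le_iff field_simps)

text \<open>Harris' inequality for the initial law, by integrating out one site after the other.\<close>

lemma initial_association:
  assumes "finite S" "cylinder S f" "cylinder S g" "cylinder S h" and inc: "increasing f" "increasing g"
    and b: "\<And>\<eta>. \<bar>f \<eta>\<bar> \<le> C" "\<And>\<eta>. \<bar>g \<eta>\<bar> \<le> C" "\<And>\<eta>. \<bar>h \<eta>\<bar> \<le> C" and h: "\<And>\<eta>. \<eta> \<in> spins \<Longrightarrow> f \<eta> * g \<eta> \<le> h \<eta>"
  shows "(\<integral>\<eta>. f \<eta> \<partial>initial_law) * (\<integral>\<eta>. g \<eta> \<partial>initial_law) \<le> (\<integral>\<eta>. h \<eta> \<partial>initial_law)"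
  using assms
proof (induction S arbitrary: f g h)
  case empty
  have "f = (\<lambda>_. f (\<lambda>_. 1))" "g = (\<lambda>_. g (\<lambda>_. 1))" "h = (\<lambda>_. h (\<lambda>_. 1))"
    using empty by (auto simp: cylinder_def)
  then obtain a b c where "f = (\<lambda>_. a)" "g = (\<lambda>_. b)" "h = (\<lambda>_. c)" by metis
  moreover have "(\<lambda>_. 1) \<in> spins" by (simp add: spins_def)
  ultimately show ?case using empty(9)[of "\<lambda>_. 1"] initial_law.prob_space by simp
next
  case (insert x S)
  let ?I = "insert x S"
  have fin: "finite ?I" using insert by simp
  have S: "?I - {x} = S" using insert by auto
  have "(\<integral>\<eta>. randomise x f \<eta> \<partial>initial_law) * (\<integral>\<eta>. randomise x g \<eta> \<partial>initial_law) \<le> (\<integral>\<eta>. randomise x h \<eta> \<partial>initial_law)"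
  proof (rule insert.IH)
    show "cylinder S (randomise x f)" "cylinder S (randomise x g)" "cylinder S (randomise x h)"
      using insert.prems(1-3)[THEN cylinder_randomise, of x] unfolding S .
    show "increasing (randomise x f)" "increasing (randomise x g)"
      by (intro increasing_randomise insert.prems)+
    show "\<bar>randomise x f \<eta>\<bar> \<le> C" "\<bar>randomise x g \<eta>\<bar> \<le> C" "\<bar>randomise x h \<eta>\<bar> \<le> C" for \<eta>
      by (intro randomise_bound insert.prems)+
    fix \<eta> assume \<eta>: "\<eta> \<in> spins"
    \<comment> \<open>Randomising does not commute with products, so the induction carries an upper
      bound h of the product.\<close>
    have "randomise x (\<lambda>\<eta>. f \<eta> * g \<eta>) \<eta> \<le> randomise x h \<eta>"
      unfolding randomise_def using \<eta>
      by (intro divide_right_mono add_mono insert.prems(9)) (auto simp: spins_def)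
    with randomise_mult[OF insert.prems(4,5) \<eta>, of x]
    show "randomise x f \<eta> * randomise x g \<eta> \<le> randomise x h \<eta>" by linarith
  qed
  then show ?case
    using integral_randomise[OF fin insert.prems(1,6)] integral_randomise[OF fin insert.prems(2,7)]
      integral_randomise[OF fin insert.prems(3,8)] by simp
qed

section \<open>The law of the discrete dynamics\<close>

lemma evolve_cong: "(\<And>i. i \<in> set l \<Longrightarrow> X i = Y i) \<Longrightarrow> evolve X l \<eta> = evolve Y l \<eta>"
  by (induction l arbitrary: \<eta>) auto

lemma cylinder_evolve:
  assumes "finite S" "cylinder S f"
  shows "\<exists>S'. finite S' \<and> cylinder S' (\<lambda>\<eta>. f (evolve X l \<eta>))"
proof (induction l)
  case Nil
  then show ?case using assms by auto
next
  case (Cons i l)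
  then obtain S' where S': "finite S'" "cylinder S' (\<lambda>\<eta>. f (evolve X l \<eta>))" by blast
  show ?case
  proof (cases "X i")
    case None
    then show ?thesis using S' by (auto simp: apply_slot_def)
  next
    case (Some c)
    have "cylinder (S' \<union> ({snd i} \<union> neighbours (snd i))) (\<lambda>\<eta>. f (evolve X (i # l) \<eta>))"
      using cylinder_update[OF S'(2), of "snd i" c] Some by (simp add: apply_slot_def)
    moreover have "finite (S' \<union> ({snd i} \<union> neighbours (snd i)))" using S' by simp
    ultimately show ?thesis by (intro exI[of _ "S' \<union> ({snd i} \<union> neighbours (snd i))"] conjI)
  qed
qed

lemma UNIV_bool_option: "(UNIV :: bool option set) = {None, Some True, Some False}"
  by (auto simp: UNIV_option_conv)

text \<open>The expectation over all slot outcomes factorises into one-site operators. Outcomes are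
  extensional functions, so each is counted once.\<close>

lemma sum_evolve:
  "distinct l \<Longrightarrow> (\<Sum>a\<in>PiE (set l) (\<lambda>_. UNIV). (\<Prod>i\<in>set l. weight q (a i)) * f (evolve a l \<eta>))
    = resamples q (map snd l) f \<eta>"
proof (induction l arbitrary: \<eta>)
  case (Cons i l)
  let ?F = "\<lambda>a. (\<Prod>j\<in>set (i # l). weight q (a j)) * f (evolve a (i # l) \<eta>)"
  have il: "i \<notin> set l" using Cons by simp
  have "(\<Sum>a\<in>PiE (set (i # l)) (\<lambda>_. UNIV). ?F a) = (\<Sum>p\<in>UNIV \<times> PiE (set l) (\<lambda>_. UNIV). ?F ((\<lambda>(y, g). g(i := y)) p))"
    unfolding list.set(2) PiE_insert_eq using inj_combinator[OF il]
    by (subst sum.reindex) (auto simp: o_def)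
  also have "\<dots> = (\<Sum>b\<in>UNIV. \<Sum>a\<in>PiE (set l) (\<lambda>_. UNIV). ?F (a(i := b)))"
    by (subst sum.cartesian_product) (simp add: case_prod_beta')
  also have "\<dots> = (\<Sum>b\<in>UNIV. weight q b * resamples q (map snd l) f (apply_slot b (snd i) \<eta>))"
  proof (rule sum.cong[OF refl])
    fix b :: "bool option"
    have *: "?F (a(i := b)) = weight q b * ((\<Prod>j\<in>set l. weight q (a j)) * f (evolve a l (apply_slot b (snd i) \<eta>)))" for a
    proof -
      have "(\<Prod>j\<in>set l. weight q ((a(i := b)) j)) = (\<Prod>j\<in>set l. weight q (a j))"
        using il by (intro prod.cong) auto
      moreover have "evolve (a(i := b)) l \<zeta> = evolve a l \<zeta>" for \<zeta>
        using il by (intro evolve_cong) auto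
      ultimately show ?thesis using il by simp
    qed
    then show "(\<Sum>a\<in>PiE (set l) (\<lambda>_. UNIV). ?F (a(i := b))) = weight q b * resamples q (map snd l) f (apply_slot b (snd i) \<eta>)"
      unfolding * sum_distrib_left[symmetric] using Cons by simp
  qed
  also have "\<dots> = resamples q (map snd (i # l)) f \<eta>"
    unfolding UNIV_bool_option by (simp add: weight_def resample_def apply_slot_def field_simps)
  finally show ?case .
qed simp

lemma set_slots_list: "set (slots_list xs K) = {..<K} \<times> set xs"
  by (auto simp: slots_list_def)

lemma distinct_slots_list: "distinct xs \<Longrightarrow> distinct (slots_list xs K)"
  by (induction K) (auto simp: slots_list_def distinct_map inj_on_def)

lemma concat_replicate_Suc: "concat (replicate (Suc k) xs) = concat (replicate k xs) @ xs"
  by (simp only: replicate_Suc replicate_append_same[symmetric]) simp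

lemma map_snd_slots_list: "map snd (slots_list xs K) = concat (replicate K xs)"
proof (induction K)
  case (Suc K)
  then show ?case by (simp only: concat_replicate_Suc) (simp add: slots_list_def comp_def)
qed (simp add: slots_list_def)

lemma array_sets: "{w. \<forall>i\<in>I. array s w i = a i} \<in> sets dyn_law" if "finite I"
proof -
  have "{w \<in> space dyn_law. \<forall>i\<in>I. array s w i = a i} \<in> sets dyn_law"
    unfolding array_def using that by measurable
  then show ?thesis by simp
qed

text \<open>A finite sum of products of a local function of the initial state and an event of the
  clocks: this form gives joint measurability and lets the clocks be integrated out.\<close>

lemma approximation_expand:
  fixes f :: "config \<Rightarrow> real"
  assumes l: "l = slots_list xs K"
  shows "f (approximation s xs K \<eta> w) =
    (\<Sum>a\<in>PiE (set l) (\<lambda>_. UNIV). f (evolve a l \<eta>) * indicator {w. \<forall>i\<in>set l. array s w i = a i} w)"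
proof -
  let ?r = "restrict (array s w) (set l)"
  have "(\<forall>i\<in>set l. array s w i = a i) \<longleftrightarrow> a = ?r" if "a \<in> PiE (set l) (\<lambda>_. UNIV)" for a
    using that by (auto simp: fun_eq_iff PiE_def extensional_def)
  then have "(\<Sum>a\<in>PiE (set l) (\<lambda>_. UNIV). f (evolve a l \<eta>) * indicator {w. \<forall>i\<in>set l. array s w i = a i} w)
    = (\<Sum>a\<in>PiE (set l) (\<lambda>_. UNIV). if a = ?r then f (evolve a l \<eta>) else 0)"
    by (intro sum.cong) (auto simp: indicator_def)
  also have "\<dots> = f (evolve ?r l \<eta>)"
    by (subst sum.delta) (auto intro!: finite_PiE)
  also have "evolve ?r l \<eta> = evolve (array s w) l \<eta>"
    by (rule evolve_cong) auto
  finally show ?thesis unfolding approximation_def l by simp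
qed

lemma approximation_measurable:
  fixes f :: "config \<Rightarrow> real"
  assumes S: "finite S" "cylinder S f"
  shows "(\<lambda>\<omega>. f (approximation s xs K (fst \<omega>) (snd \<omega>))) \<in> borel_measurable ising_law"
proof -
  let ?l = "slots_list xs K"
  have 1: "(\<lambda>\<eta>. f (evolve a ?l \<eta>)) \<in> borel_measurable initial_law" for a
    using cylinder_evolve[OF S, of a ?l] by (elim exE conjE) (rule cylinder_measurable_initial)
  have 2: "(\<lambda>w. indicator {w. \<forall>i\<in>set ?l. array s w i = a i} w :: real) \<in> borel_measurable dyn_law" for a
    by (intro borel_measurable_indicator array_sets) simp
  have "(\<lambda>\<omega>. f (evolve a ?l (fst \<omega>)) * indicator {w. \<forall>i\<in>set ?l. array s w i = a i} (snd \<omega>) :: real) \<in> borel_measurable ising_law" for a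
    unfolding ising_law_def
    by (intro borel_measurable_times measurable_compose[OF measurable_fst 1] measurable_compose[OF measurable_snd 2])
  then show ?thesis
    unfolding approximation_expand[OF refl] by (intro borel_measurable_sum)
qed

lemma expectation_approximation:
  assumes S: "finite S" "cylinder S f" and C: "\<And>\<eta>. \<bar>f \<eta>\<bar> \<le> C" and xs: "distinct xs" and s: "0 \<le> s"
  shows "(\<integral>\<omega>. f (approximation s xs K (fst \<omega>) (snd \<omega>)) \<partial>ising_law)
    = (\<integral>\<eta>. resamples (1 - exp (- s)) (concat (replicate K xs)) f \<eta> \<partial>initial_law)"
proof -
  interpret P: pair_prob_space initial_law dyn_law by unfold_locales
  let ?l = "slots_list xs K" and ?q = "1 - exp (- s)"
  have int: "integrable (initial_law \<Otimes>\<^sub>M dyn_law) (\<lambda>\<omega>. f (approximation s xs K (fst \<omega>) (snd \<omega>)))"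
    by (rule P.integrable_const_bound[where B = C])
      (use C approximation_measurable[OF S, of s xs K] in \<open>auto simp: ising_law_def\<close>)
  have A: "{w. \<forall>i\<in>set ?l. array s w i = a i} \<in> sets dyn_law" for a
    by (rule array_sets) simp
  have "(\<integral>w. f (approximation s xs K \<eta> w) \<partial>dyn_law) = resamples ?q (map snd ?l) f \<eta>" for \<eta>
  proof -
    have p: "measure dyn_law {w. \<forall>i\<in>set ?l. array s w i = a i} = (\<Prod>i\<in>set ?l. weight ?q (a i))" for a
    proof -
      have "{w. \<forall>i\<in>set ?l. array s w i = a i} = {w. \<forall>x\<in>set xs. \<forall>k<K. slot s (w x) k = a (k, x)}"
        by (auto simp: set_slots_list array_def)
      moreover have "(\<Prod>i\<in>set ?l. weight ?q (a i)) = (\<Prod>x\<in>set xs. \<Prod>k<K. weight ?q (a (k, x)))"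
        unfolding set_slots_list by (subst prod.swap) (simp add: prod.cartesian_product case_prod_beta')
      ultimately show ?thesis using dyn_law_slots_prob[of "set xs" s K a] s by simp
    qed
    have "(\<integral>w. f (approximation s xs K \<eta> w) \<partial>dyn_law)
      = (\<Sum>a\<in>PiE (set ?l) (\<lambda>_. UNIV). (\<integral>w. f (evolve a ?l \<eta>) * indicator {w. \<forall>i\<in>set ?l. array s w i = a i} w \<partial>dyn_law))"
      unfolding approximation_expand[OF refl] using A
      by (intro Bochner_Integration.integral_sum) (auto simp: dyn_law.emeasure_eq_measure)
    also have "\<dots> = (\<Sum>a\<in>PiE (set ?l) (\<lambda>_. UNIV). (\<Prod>i\<in>set ?l. weight ?q (a i)) * f (evolve a ?l \<eta>))"
      using A by (intro sum.cong refl) (simp add: p mult.commute)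
    also have "\<dots> = resamples ?q (map snd ?l) f \<eta>"
      by (rule sum_evolve[OF distinct_slots_list[OF xs]])
    finally show ?thesis .
  qed
  then show ?thesis
    unfolding ising_law_def by (subst P.integral_fst'[symmetric, OF int]) (simp add: map_snd_slots_list)
qed

lemma (in prob_space) prob_tendsto_0:
  assumes A: "\<And>n. A n \<in> events" and ev: "AE \<omega> in M. \<forall>\<^sub>F n in sequentially. \<omega> \<notin> A n"
  shows "(\<lambda>n. prob (A n)) \<longlonglongrightarrow> 0"
proof -
  have "(\<lambda>n. \<integral>\<omega>. indicator (A n) \<omega> \<partial>M) \<longlonglongrightarrow> (\<integral>\<omega>. 0 \<partial>M :: real)"
  proof (rule integral_dominated_convergence[where w = "\<lambda>_. 1"])
    show "AE \<omega> in M. (\<lambda>n. indicator (A n) \<omega> :: real) \<longlonglongrightarrow> 0"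
      using ev by eventually_elim (auto intro!: tendsto_eventually elim!: eventually_mono)
  qed (use A in \<open>auto simp: indicator_def\<close>)
  then show ?thesis using A by simp
qed

definition box_list :: "nat \<Rightarrow> site list" where
  "box_list n = (SOME xs. distinct xs \<and> set xs = square n)"

lemma box_list: "distinct (box_list n)" "set (box_list n) = square n"
proof -
  have "finite (square n)" by (simp add: square_def)
  then have "\<exists>xs. distinct xs \<and> set xs = square n" using finite_distinct_list by blast
  then have "distinct (box_list n) \<and> set (box_list n) = square n" unfolding box_list_def by (rule someI_ex)
  then show "distinct (box_list n)" "set (box_list n) = square n" by auto
qed

lemma finite_square [simp]: "finite (square n)"
  by (simp add: square_def)

lemma eventually_subset_square:
  assumes "finite B" shows "\<forall>\<^sub>F n in sequentially. B \<subseteq> square n"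
  using assms
proof (induction B)
  case (insert x B)
  have "\<forall>\<^sub>F n in sequentially. x \<in> square n"
    using eventually_ge_at_top[of "nat (\<bar>fst x\<bar> + \<bar>snd x\<bar>)"]
    by eventually_elim (cases x, auto simp: square_def)
  with insert.IH show ?case by eventually_elim auto
qed simp

section \<open>Symmetries and convergence of the approximation\<close>

lemma AE_ising_snd:
  assumes "AE w in dyn_law. P w" shows "AE \<omega> in ising_law. P (snd \<omega>)"
proof -
  from assms obtain N where N: "{w \<in> space dyn_law. \<not> P w} \<subseteq> N" "N \<in> null_sets dyn_law"
    by (auto elim: AE_E simp: null_sets_def)
  have "space initial_law \<times> N \<in> null_sets ising_law"
    unfolding ising_law_def using N(2) by (intro dyn_law.times_in_null_sets2) auto
  then show ?thesis
    by (rule AE_I') (use N in \<open>auto simp: space_ising_law space_initial_law\<close>)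
qed

section \<open>Lattice symmetries and spin reversal\<close>

definition transform :: "int \<Rightarrow> (site \<Rightarrow> site) \<Rightarrow> config \<Rightarrow> config" where
  "transform e \<phi> \<eta> = (\<lambda>x. e * \<eta> (\<phi> x))"

definition automorphism :: "(site \<Rightarrow> site) \<Rightarrow> bool" where
  "automorphism \<phi> \<longleftrightarrow> bij \<phi> \<and> (\<forall>x. neighbours (\<phi> x) = \<phi> ` neighbours x)"

lemma transform_spins: "e = 1 \<or> e = -1 \<Longrightarrow> \<eta> \<in> spins \<Longrightarrow> transform e \<phi> \<eta> \<in> spins"
  unfolding spins_def mem_Collect_eq
proof
  fix x assume e: "e = 1 \<or> e = -1" and "\<forall>x. \<eta> x = 1 \<or> \<eta> x = -1"
  from this(2)[rule_format, of "\<phi> x"] e show "transform e \<phi> \<eta> x = 1 \<or> transform e \<phi> \<eta> x = -1"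
    unfolding transform_def by auto
qed

lemma disagreements_transform:
  assumes "automorphism \<phi>" "e = 1 \<or> e = -1"
  shows "disagreements (transform e \<phi> \<eta>) x = disagreements \<eta> (\<phi> x)"
proof -
  have inj: "inj \<phi>" using assms(1) unfolding automorphism_def by (auto dest: bij_is_inj)
  have n: "neighbours (\<phi> x) = \<phi> ` neighbours x" using assms(1) unfolding automorphism_def by blast
  have "{y \<in> neighbours (\<phi> x). \<eta> y \<noteq> \<eta> (\<phi> x)} = \<phi> ` {y \<in> neighbours x. transform e \<phi> \<eta> y \<noteq> transform e \<phi> \<eta> x}"
    unfolding n transform_def using assms(2) by auto
  then show ?thesis unfolding disagreements_def using inj by (simp add: card_image inj_on_subset)
qed

lemma updated_spin_transform:
  assumes "automorphism \<phi>" "e = 1 \<or> e = -1"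
  shows "updated_spin c (transform e \<phi> \<eta>) x = e * updated_spin c \<eta> (\<phi> x)"
  unfolding updated_spin_def disagreements_transform[OF assms] by (simp add: transform_def)

text \<open>The update only compares spins of neighbours, so it commutes with lattice symmetries and
  spin reversal if the clocks move along with the sites. The coin decides between flipping and
  staying, hence reversal leaves it alone.\<close>

lemma trajectory_transform:
  assumes s: "ising_trajectory \<eta> w s" and \<phi>: "automorphism \<phi>" "e = 1 \<or> e = -1"
  shows "ising_trajectory (transform e \<phi> \<eta>) (\<lambda>x. w (\<phi> x)) (\<lambda>t. transform e \<phi> (s t))"
  unfolding ising_trajectory_def
proof (intro conjI allI impI)
  show "transform e \<phi> (s 0) = transform e \<phi> \<eta>" using s by (simp add: ising_trajectory_def)
next
  fix x t u assume a: "0 \<le> t \<and> t \<le> u \<and> (\<forall>n. ring_time (\<lambda>x. w (\<phi> x)) x n \<notin> {t<..u})"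
  then have "s u (\<phi> x) = s t (\<phi> x)"
    by (intro trajectory_const[OF s]) (auto simp: ring_time_eq)
  then show "transform e \<phi> (s u) x = transform e \<phi> (s t) x" by (simp add: transform_def)
next
  fix x n
  have "\<forall>\<^sub>F u in at_left (ring_time w (\<phi> x) n). s (ring_time w (\<phi> x) n) (\<phi> x) = updated_spin (coin w (\<phi> x) n) (s u) (\<phi> x)"
    using s unfolding ising_trajectory_def by blast
  then have "\<forall>\<^sub>F u in at_left (ring_time w (\<phi> x) n).
    transform e \<phi> (s (ring_time w (\<phi> x) n)) x = updated_spin (coin w (\<phi> x) n) (transform e \<phi> (s u)) x"
    by eventually_elim (simp only: updated_spin_transform[OF \<phi>], simp add: transform_def)
  then show "\<forall>\<^sub>F u in at_left (ring_time (\<lambda>x. w (\<phi> x)) x n).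
    transform e \<phi> (s (ring_time (\<lambda>x. w (\<phi> x)) x n)) x = updated_spin (coin (\<lambda>x. w (\<phi> x)) x n) (transform e \<phi> (s u)) x"
    by (simp add: ring_time_def coin_def)
qed

lemma sets_coin [simp]: "sets (uniform_count_measure {-1, 1 :: int}) = Pow {-1, 1}"
  by (simp add: sets_uniform_count_measure)

text \<open>Checked on finite dimensional cylinders: coordinates are permuted, and a fair spin times
  a sign is fair.\<close>

lemma distr_initial_transform:
  assumes \<phi>: "automorphism \<phi>" and e: "e = 1 \<or> e = -1"
  shows "distr initial_law initial_law (transform e \<phi>) = initial_law"
    and "transform e \<phi> \<in> initial_law \<rightarrow>\<^sub>M initial_law"
proof -
  let ?M = "\<lambda>_::site. uniform_count_measure {-1, 1 :: int}"
  have ps: "prob_space (?M x)" for x by (intro prob_space_uniform_count_measure) auto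
  interpret product_prob_space ?M UNIV
    by (intro product_prob_spaceI ps)
  have inj: "inj \<phi>" using \<phi> unfolding automorphism_def by (auto dest: bij_is_inj)
  have c: "(\<lambda>\<eta>. \<eta> y) \<in> initial_law \<rightarrow>\<^sub>M ?M y" for y
    unfolding initial_law_def by (rule measurable_component_singleton) simp
  have e': "(\<lambda>a. e * a) \<in> ?M y \<rightarrow>\<^sub>M ?M z" for y z
    using e by (auto simp: measurable_def space_uniform_count_measure)
  show T: "transform e \<phi> \<in> initial_law \<rightarrow>\<^sub>M initial_law"
  proof -
    have "transform e \<phi> \<in> initial_law \<rightarrow>\<^sub>M PiM UNIV ?M"
    proof (rule measurable_PiM_single')
      show "(\<lambda>\<eta>. transform e \<phi> \<eta> x) \<in> initial_law \<rightarrow>\<^sub>M ?M x" for x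
        unfolding transform_def by (rule measurable_compose[OF c e'])
      show "transform e \<phi> \<in> space initial_law \<rightarrow> (\<Pi>\<^sub>E i\<in>UNIV. space (?M i))"
        using transform_spins[OF e] unfolding space_initial_law
        by (auto simp: space_uniform_count_measure PiE_def spins_def)
    qed
    then show ?thesis by (simp add: initial_law_def)
  qed
  have "PiM UNIV ?M = distr initial_law initial_law (transform e \<phi>)"
  proof (rule measure_eqI_PiM_infinite)
    show "sets (PiM UNIV ?M) = sets (PiM UNIV ?M)" by simp
    show "sets (distr initial_law initial_law (transform e \<phi>)) = sets (PiM UNIV ?M)"
      by (simp add: initial_law_def)
    show "finite_measure (PiM UNIV ?M)"
      by (rule P.finite_measure)
    fix A J assume J: "finite J" and A: "\<And>i. i \<in> J \<Longrightarrow> A i \<in> sets (?M i)"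
    let ?X = "prod_emb UNIV ?M J (Pi\<^sub>E J A)"
    let ?B = "\<lambda>x. (\<lambda>a. e * a) -` A (inv \<phi> x) \<inter> {-1, 1}"
    have X: "?X \<in> sets initial_law"
      unfolding initial_law_def using J A by (intro sets_PiM_I) auto
    have sub: "A i \<subseteq> {-1, 1}" if "i \<in> J" for i using A[OF that] by simp
    have "transform e \<phi> -` ?X \<inter> space initial_law = {\<eta> \<in> space (PiM UNIV ?M). \<forall>y\<in>\<phi> ` J. \<eta> y \<in> ?B y}"
    proof -
      have "transform e \<phi> \<eta> \<in> ?X \<longleftrightarrow> (\<forall>x\<in>J. e * \<eta> (\<phi> x) \<in> A x)" if "\<eta> \<in> spins" for \<eta>
        using transform_spins[OF e that, of \<phi>] unfolding prod_emb_def
        by (auto simp: space_uniform_count_measure transform_def spins_def PiE_def Pi_def)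
      moreover have "(\<forall>y\<in>\<phi> ` J. \<eta> y \<in> ?B y) \<longleftrightarrow> (\<forall>x\<in>J. e * \<eta> (\<phi> x) \<in> A x)" if "\<eta> \<in> spins" for \<eta>
        using spinsD[OF that] inj by (simp add: disj_commute)
      ultimately have "transform e \<phi> \<eta> \<in> ?X \<longleftrightarrow> (\<forall>y\<in>\<phi> ` J. \<eta> y \<in> ?B y)" if "\<eta> \<in> spins" for \<eta>
        using that by (simp only:)
      then show ?thesis
        unfolding initial_law_def[symmetric] space_initial_law by blast
    qed
    then have "emeasure (distr initial_law initial_law (transform e \<phi>)) ?X
      = emeasure (PiM UNIV ?M) {\<eta> \<in> space (PiM UNIV ?M). \<forall>y\<in>\<phi> ` J. \<eta> y \<in> ?B y}"
      using X T by (simp add: emeasure_distr initial_law_def)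
    also have "\<dots> = (\<Prod>y\<in>\<phi> ` J. emeasure (?M y) (?B y))"
      using J by (intro emeasure_PiM_Collect) auto
    also have "\<dots> = (\<Prod>x\<in>J. emeasure (?M x) (A x))"
    proof (subst prod.reindex)
      show "inj_on \<phi> J" using inj by (rule inj_on_subset) simp
      have "emeasure (?M x) (?B (\<phi> x)) = emeasure (?M x) (A x)" if "x \<in> J" for x
      proof -
        have "?B (\<phi> x) = (\<lambda>a. e * a) ` A x"
        proof -
          have "inv \<phi> (\<phi> x) = x" using inj by simp
          then show ?thesis using e sub[OF that] by (auto simp: image_iff)
        qed
        moreover have "card ((\<lambda>a. e * a) ` A x) = card (A x)"
          using e by (intro card_image) (auto simp: inj_on_def)
        moreover have "(\<lambda>a. e * a) ` A x \<subseteq> {-1, 1}" using e sub[OF that] by auto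
        ultimately show ?thesis
          using sub[OF that] by (simp add: emeasure_uniform_count_measure)
      qed
      then show "prod ((\<lambda>y. emeasure (?M y) (?B y)) \<circ> \<phi>) J = (\<Prod>x\<in>J. emeasure (?M x) (A x))"
        by (intro prod.cong) auto
    qed
    also have "\<dots> = emeasure (PiM UNIV ?M) ?X"
      using J A by (intro emeasure_PiM_emb[symmetric]) auto
    finally show "emeasure (PiM UNIV ?M) ?X = emeasure (distr initial_law initial_law (transform e \<phi>)) ?X" ..
  qed
  then show "distr initial_law initial_law (transform e \<phi>) = initial_law"
    by (simp add: initial_law_def)
qed

lemma distr_dyn_reindex:
  assumes "automorphism \<phi>"
  shows "distr dyn_law dyn_law (\<lambda>w x. w (\<phi> x)) = dyn_law"
proof -
  have "inj \<phi>" using assms unfolding automorphism_def by (auto dest: bij_is_inj)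
  then show ?thesis
    using distr_PiM_reindex[of UNIV "\<lambda>_. clock_law" \<phi> UNIV] prob_space_clock_law
    by (simp add: dyn_law_eq restrict_UNIV)
qed

definition transform_pair :: "int \<Rightarrow> (site \<Rightarrow> site) \<Rightarrow> config \<times> clocks \<Rightarrow> config \<times> clocks" where
  "transform_pair e \<phi> = (\<lambda>(\<eta>, w). (transform e \<phi> \<eta>, \<lambda>x. w (\<phi> x)))"

lemma distr_ising_transform:
  assumes \<phi>: "automorphism \<phi>" and e: "e = 1 \<or> e = -1"
  shows "distr ising_law ising_law (transform_pair e \<phi>) = ising_law"
    and "transform_pair e \<phi> \<in> ising_law \<rightarrow>\<^sub>M ising_law"
proof -
  have w: "(\<lambda>w x. w (\<phi> x)) \<in> dyn_law \<rightarrow>\<^sub>M dyn_law"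
  proof -
    have "(\<lambda>w x. w (\<phi> x)) \<in> dyn_law \<rightarrow>\<^sub>M PiM UNIV (\<lambda>_::site. clock_law)"
      by (rule measurable_PiM_single') auto
    then show ?thesis by (simp add: dyn_law_eq)
  qed
  have "distr initial_law initial_law (transform e \<phi>) \<Otimes>\<^sub>M distr dyn_law dyn_law (\<lambda>w x. w (\<phi> x))
    = distr (initial_law \<Otimes>\<^sub>M dyn_law) (initial_law \<Otimes>\<^sub>M dyn_law) (\<lambda>(\<eta>, w). (transform e \<phi> \<eta>, \<lambda>x. w (\<phi> x)))"
    using distr_initial_transform(2)[OF \<phi> e] w
    by (rule pair_measure_distr) (unfold distr_dyn_reindex[OF \<phi>], unfold_locales)
  then show "distr ising_law ising_law (transform_pair e \<phi>) = ising_law"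
    unfolding distr_initial_transform(1)[OF \<phi> e] distr_dyn_reindex[OF \<phi>]
    by (simp add: ising_law_def transform_pair_def)
  show "transform_pair e \<phi> \<in> ising_law \<rightarrow>\<^sub>M ising_law"
    unfolding ising_law_def transform_pair_def
    using distr_initial_transform(2)[OF \<phi> e] w by measurable
qed

locale ising =
  fixes \<sigma> :: "real \<Rightarrow> config \<times> clocks \<Rightarrow> config"
  assumes process: "ising_process \<sigma>"
begin

definition u :: "(config \<Rightarrow> real) \<Rightarrow> real \<Rightarrow> real" where
  "u f t = (\<integral>\<omega>. f (\<sigma> t \<omega>) \<partial>ising_law)"

lemma \<sigma>_measurable: "0 \<le> t \<Longrightarrow> \<sigma> t \<in> ising_law \<rightarrow>\<^sub>M state_space"
  using process by (auto simp: ising_process_def)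

lemma \<sigma>_spins: "0 \<le> t \<Longrightarrow> \<omega> \<in> space ising_law \<Longrightarrow> \<sigma> t \<omega> \<in> spins"
  using measurable_space[OF \<sigma>_measurable] by (simp add: space_state_space)

lemma f\<sigma>_measurable:
  fixes f :: "config \<Rightarrow> real"
  assumes "finite S" "cylinder S f" "0 \<le> t"
  shows "(\<lambda>\<omega>. f (\<sigma> t \<omega>)) \<in> borel_measurable ising_law"
  using \<sigma>_measurable[OF assms(3)] cylinder_measurable[OF assms(1,2)] by (rule measurable_compose)

lemma f\<sigma>_integrable:
  fixes f :: "config \<Rightarrow> real"
  assumes "finite S" "cylinder S f" "\<And>\<eta>. \<bar>f \<eta>\<bar> \<le> C" "0 \<le> t"
  shows "integrable ising_law (\<lambda>\<omega>. f (\<sigma> t \<omega>))"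
  by (rule ising_law.integrable_const_bound[where B = C]) (use assms f\<sigma>_measurable in auto)

lemma AE_good: "AE \<omega> in ising_law. good_clocks (snd \<omega>) \<and> ising_trajectory (fst \<omega>) (snd \<omega>) (\<lambda>t. \<sigma> t \<omega>)"
  using AE_ising_snd[OF AE_good_clocks] process by (auto simp: ising_process_def)

text \<open>The transformed noise has the law of the noise. Evaluating the process at it, and
  transforming the process, give two trajectories of the same noise, which agree by pathwise
  uniqueness.\<close>

lemma u_transform:
  fixes f :: "config \<Rightarrow> real"
  assumes S: "finite S" "cylinder S f" and t: "0 \<le> t" and \<phi>: "automorphism \<phi>" and e: "e = 1 \<or> e = -1"
  shows "u (\<lambda>\<eta>. f (transform e \<phi> \<eta>)) t = u f t"
proof -
  let ?T = "transform_pair e \<phi>"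
  note D = distr_ising_transform[OF \<phi> e]
  have "AE \<omega> in distr ising_law ising_law ?T. good_clocks (snd \<omega>) \<and> ising_trajectory (fst \<omega>) (snd \<omega>) (\<lambda>t. \<sigma> t \<omega>)"
    unfolding D(1) by (rule AE_good)
  then have "AE \<omega> in ising_law. good_clocks (snd (?T \<omega>)) \<and> ising_trajectory (fst (?T \<omega>)) (snd (?T \<omega>)) (\<lambda>t. \<sigma> t (?T \<omega>))"
    by (rule AE_distrD[OF D(2)])
  then have eq: "AE \<omega> in ising_law. \<sigma> t (?T \<omega>) = transform e \<phi> (\<sigma> t \<omega>)"
    using AE_good
  proof eventually_elim
    case (elim \<omega>)
    have "ising_trajectory (fst (?T \<omega>)) (snd (?T \<omega>)) (\<lambda>t. transform e \<phi> (\<sigma> t \<omega>))"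
      using trajectory_transform[OF _ \<phi> e, of "fst \<omega>" "snd \<omega>" "\<lambda>t. \<sigma> t \<omega>"] elim
      by (simp add: transform_pair_def case_prod_beta')
    then show ?case using trajectory_unique[of "snd (?T \<omega>)" "fst (?T \<omega>)"] elim t by blast
  qed
  have m: "(\<lambda>\<omega>. f (\<sigma> t \<omega>)) \<in> borel_measurable ising_law" by (rule f\<sigma>_measurable[OF S t])
  have "finite (\<phi> ` S)" "cylinder (\<phi> ` S) (\<lambda>\<eta>. f (transform e \<phi> \<eta>))"
    using S unfolding cylinder_def transform_def by auto
  then have m': "(\<lambda>\<omega>. f (transform e \<phi> (\<sigma> t \<omega>))) \<in> borel_measurable ising_law"
    using f\<sigma>_measurable[of "\<phi> ` S" "\<lambda>\<eta>. f (transform e \<phi> \<eta>)"] t by simp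
  have "u f t = (\<integral>\<omega>. f (\<sigma> t \<omega>) \<partial>distr ising_law ising_law ?T)" unfolding u_def D(1) ..
  also have "\<dots> = (\<integral>\<omega>. f (\<sigma> t (?T \<omega>)) \<partial>ising_law)" by (rule integral_distr[OF D(2) m])
  also have "\<dots> = (\<integral>\<omega>. f (transform e \<phi> (\<sigma> t \<omega>)) \<partial>ising_law)"
    using eq by (intro integral_cong_AE measurable_compose[OF D(2) m] m') auto
  finally show ?thesis by (simp add: u_def)
qed

section \<open>Comparison of the process with its discretisation\<close>

definition approx :: "nat \<Rightarrow> nat \<Rightarrow> nat \<Rightarrow> config \<times> clocks \<Rightarrow> config" where
  "approx n m k \<omega> = approximation ((1/2) ^ m) (box_list n) k (fst \<omega>) (snd \<omega>)"

definition v :: "nat \<Rightarrow> nat \<Rightarrow> nat \<Rightarrow> (config \<Rightarrow> real) \<Rightarrow> real" where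
  "v n m k f = (\<integral>\<eta>. resamples (1 - exp (- ((1/2) ^ m))) (concat (replicate k (box_list n))) f \<eta> \<partial>initial_law)"

text \<open>For m at least j, the time \<open>k * (1/2) ^ j\<close> consists of
  \<open>k * 2 ^ (m - j)\<close> slots of mesh \<open>(1/2) ^ m\<close>. Spins are compared as reals
  so that measurability follows from equality of real functions.\<close>

definition bad :: "site set \<Rightarrow> nat \<Rightarrow> nat \<Rightarrow> nat \<Rightarrow> nat \<Rightarrow> (config \<times> clocks) set" where
  "bad A j k n m = {\<omega> \<in> space ising_law. \<exists>x\<in>A. real_of_int (\<sigma> (real k * (1/2) ^ j) \<omega> x) \<noteq> real_of_int (approx n m (k * 2 ^ (m - j)) \<omega> x)}"

lemma bad_sets: "finite A \<Longrightarrow> bad A j k n m \<in> sets ising_law"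
proof -
  assume A: "finite A"
  have "{\<omega> \<in> space ising_law. real_of_int (\<sigma> (real k * (1/2) ^ j) \<omega> x) = real_of_int (approx n m (k * 2 ^ (m - j)) \<omega> x)} \<in> sets ising_law" for x
  proof (rule borel_measurable_eq)
    have c: "cylinder {x} (\<lambda>\<eta>. real_of_int (\<eta> x))" by (simp add: cylinder_def)
    show "(\<lambda>\<omega>. real_of_int (\<sigma> (real k * (1/2) ^ j) \<omega> x)) \<in> borel_measurable ising_law"
      by (rule f\<sigma>_measurable[OF _ c]) auto
    show "(\<lambda>\<omega>. real_of_int (approx n m (k * 2 ^ (m - j)) \<omega> x)) \<in> borel_measurable ising_law"
      unfolding approx_def by (rule approximation_measurable[OF _ c]) auto
  qed
  then have "{\<omega> \<in> space ising_law. \<not> (real_of_int (\<sigma> (real k * (1/2) ^ j) \<omega> x) = real_of_int (approx n m (k * 2 ^ (m - j)) \<omega> x))} \<in> sets ising_law" for x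
    by (intro sets.sets_Collect_neg)
  then show ?thesis unfolding bad_def by (intro sets.sets_Collect_finite_Ex A)
qed

text \<open>\<open>E n\<close> collects the realisations that are bad for infinitely many m. Almost
  surely a realisation is outside \<open>E n\<close> for all large n, and outside \<open>E n\<close>
  the bad set empties as m grows.\<close>

lemma bad_small:
  assumes A: "finite A" and \<epsilon>: "0 < \<epsilon>"
  shows "\<forall>\<^sub>F n in sequentially. \<forall>\<^sub>F m in sequentially. measure ising_law (bad A j k n m) < \<epsilon>"
proof -
  define E where "E n = (\<Inter>M. \<Union>m\<in>{M..}. bad A j k n m)" for n
  have E: "E n \<in> sets ising_law" for n
    unfolding E_def using bad_sets[OF A] by (intro sets.countable_INT' sets.countable_UN') auto
  have "AE \<omega> in ising_law. \<forall>\<^sub>F n in sequentially. \<omega> \<notin> E n"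
    using AE_good
  proof eventually_elim
    case (elim \<omega>)
    then have w: "good_clocks (snd \<omega>)" and s: "ising_trajectory (fst \<omega>) (snd \<omega>) (\<lambda>t. \<sigma> t \<omega>)" by auto
    obtain B where B: "finite B" "\<And>xs. distinct xs \<Longrightarrow> B \<subseteq> set xs \<Longrightarrow> (\<exists>m0. \<forall>m\<ge>m0. \<forall>l\<le>k * 2 ^ m. \<forall>\<eta> s.
      ising_trajectory \<eta> (snd \<omega>) s \<longrightarrow> (\<forall>x\<in>A. s (real l * (1/2) ^ m) x = approximation ((1/2) ^ m) xs l \<eta> (snd \<omega>) x))"
      using approximation_agrees[OF w A, of k] by auto
    show ?case using eventually_subset_square[OF B(1)]
    proof eventually_elim
      case (elim n)
      have "\<exists>m0. \<forall>m\<ge>m0. \<forall>l\<le>k * 2 ^ m. \<forall>\<eta> s. ising_trajectory \<eta> (snd \<omega>) s \<longrightarrow>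
        (\<forall>x\<in>A. s (real l * (1/2) ^ m) x = approximation ((1/2) ^ m) (box_list n) l \<eta> (snd \<omega>) x)"
        by (rule B(2)) (use elim in \<open>simp_all add: box_list\<close>)
      then obtain m0 where "\<forall>m\<ge>m0. \<forall>l\<le>k * 2 ^ m. \<forall>\<eta> s. ising_trajectory \<eta> (snd \<omega>) s \<longrightarrow>
        (\<forall>x\<in>A. s (real l * (1/2) ^ m) x = approximation ((1/2) ^ m) (box_list n) l \<eta> (snd \<omega>) x)"
        by (rule exE)
      note m0 = this[rule_format, OF _ _ s]
      have "\<omega> \<notin> bad A j k n m" if m: "max m0 j \<le> m" for m
      proof -
        have eq: "real k * (1/2) ^ j = real (k * 2 ^ (m - j)) * (1/2) ^ m"
        proof -
          have "m = (m - j) + j" using m by simp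
          then have "(1/2 :: real) ^ m = (1/2) ^ (m - j) * (1/2) ^ j" by (metis power_add)
          then show ?thesis by (simp add: power_divide)
        qed
        have "k * 2 ^ (m - j) \<le> k * 2 ^ m" by (intro mult_left_mono power_increasing) auto
        then have "\<sigma> (real k * (1/2) ^ j) \<omega> x = approx n m (k * 2 ^ (m - j)) \<omega> x" if "x \<in> A" for x
          unfolding eq approx_def using m that by (intro m0) auto
        then show ?thesis unfolding bad_def by simp
      qed
      then show "\<omega> \<notin> E n" unfolding E_def by (auto intro!: exI[of _ "max m0 j"])
    qed
  qed
  then have "(\<lambda>n. measure ising_law (E n)) \<longlonglongrightarrow> 0"
    by (rule ising_law.prob_tendsto_0[OF E])
  then have "\<forall>\<^sub>F n in sequentially. measure ising_law (E n) < \<epsilon> / 2"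
    using \<epsilon> by (intro order_tendstoD(2)) auto
  then show ?thesis
  proof eventually_elim
    case (elim n)
    have "(\<lambda>m. measure ising_law (bad A j k n m - E n)) \<longlonglongrightarrow> 0"
    proof (rule ising_law.prob_tendsto_0)
      show "bad A j k n m - E n \<in> sets ising_law" for m using bad_sets[OF A] E by auto
      show "AE \<omega> in ising_law. \<forall>\<^sub>F m in sequentially. \<omega> \<notin> bad A j k n m - E n"
      proof (rule AE_I2)
        fix \<omega>
        show "\<forall>\<^sub>F m in sequentially. \<omega> \<notin> bad A j k n m - E n"
        proof (cases "\<omega> \<in> E n")
          case False
          then obtain M where "\<omega> \<notin> (\<Union>m\<in>{M..}. bad A j k n m)" unfolding E_def by auto
          then show ?thesis by (intro eventually_sequentiallyI[of M]) auto
        qed simp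
      qed
    qed
    then have "\<forall>\<^sub>F m in sequentially. measure ising_law (bad A j k n m - E n) < \<epsilon> / 2"
      using \<epsilon> by (intro order_tendstoD(2)) auto
    then show ?case
    proof eventually_elim
      case (elim m)
      have "measure ising_law (bad A j k n m) \<le> measure ising_law ((bad A j k n m - E n) \<union> E n)"
        using bad_sets[OF A] E by (intro ising_law.finite_measure_mono) auto
      also have "\<dots> \<le> measure ising_law (bad A j k n m - E n) + measure ising_law (E n)"
        using bad_sets[OF A] E by (intro measure_Un_le) auto
      finally show ?case using elim \<open>measure ising_law (E n) < \<epsilon> / 2\<close> by simp
    qed
  qed
qed

lemma integrable_indicator_ising: "N \<in> sets ising_law \<Longrightarrow> integrable ising_law (indicat_real N)"
  by (rule integrable_real_indicator) (auto simp: ising_law.emeasure_eq_measure)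

lemma u_diff_bound:
  fixes f :: "config \<Rightarrow> real"
  assumes C: "\<And>\<eta>. \<bar>f \<eta>\<bar> \<le> C" and X: "integrable ising_law (\<lambda>\<omega>. f (X \<omega>))" and Y: "integrable ising_law (\<lambda>\<omega>. f (Y \<omega>))"
    and N: "N \<in> sets ising_law" "AE \<omega> in ising_law. \<omega> \<notin> N \<longrightarrow> f (X \<omega>) = f (Y \<omega>)"
  shows "\<bar>(\<integral>\<omega>. f (X \<omega>) \<partial>ising_law) - (\<integral>\<omega>. f (Y \<omega>) \<partial>ising_law)\<bar> \<le> 2 * C * measure ising_law N"
proof -
  have "\<bar>(\<integral>\<omega>. f (X \<omega>) \<partial>ising_law) - (\<integral>\<omega>. f (Y \<omega>) \<partial>ising_law)\<bar> = \<bar>\<integral>\<omega>. f (X \<omega>) - f (Y \<omega>) \<partial>ising_law\<bar>"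
    using X Y by simp
  also have "\<dots> \<le> (\<integral>\<omega>. \<bar>f (X \<omega>) - f (Y \<omega>)\<bar> \<partial>ising_law)" by (rule integral_abs_bound)
  also have "\<dots> \<le> (\<integral>\<omega>. 2 * C * indicator N \<omega> \<partial>ising_law)"
  proof (rule integral_mono_AE)
    show "AE \<omega> in ising_law. \<bar>f (X \<omega>) - f (Y \<omega>)\<bar> \<le> 2 * C * indicator N \<omega>"
      using N(2)
    proof eventually_elim
      case (elim \<omega>)
      then show ?case using C[of "X \<omega>"] C[of "Y \<omega>"] by (cases "\<omega> \<in> N") auto
    qed
  qed (use X Y integrable_indicator_ising[OF N(1)] in auto)
  also have "\<dots> = 2 * C * measure ising_law N" using N by simp
  finally show ?thesis .
qed

lemma u_approx:
  fixes f :: "config \<Rightarrow> real"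
  assumes S: "finite S" "cylinder S f" and C: "\<And>\<eta>. \<bar>f \<eta>\<bar> \<le> C" and \<epsilon>: "0 < \<epsilon>"
  shows "\<forall>\<^sub>F n in sequentially. \<forall>\<^sub>F m in sequentially. \<bar>u f (real k * (1/2) ^ j) - v n m (k * 2 ^ (m - j)) f\<bar> < \<epsilon>"
proof -
  have C0: "0 \<le> C" using C[of undefined] by linarith
  \<comment> \<open>The summand 1 avoids a division by zero when C is 0.\<close>
  let ?e = "\<epsilon> / (2 * C + 1)"
  have "0 < ?e" using \<epsilon> C0 by simp
  from bad_small[OF S(1) this, of j k] show ?thesis
  proof (rule eventually_mono, elim eventually_mono)
    fix n m assume b: "measure ising_law (bad S j k n m) < ?e"
    have v: "v n m (k * 2 ^ (m - j)) f = (\<integral>\<omega>. f (approx n m (k * 2 ^ (m - j)) \<omega>) \<partial>ising_law)"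
      unfolding v_def approx_def
      by (rule expectation_approximation[symmetric, OF S C box_list(1)]) simp
    have "\<bar>u f (real k * (1/2) ^ j) - v n m (k * 2 ^ (m - j)) f\<bar> \<le> 2 * C * measure ising_law (bad S j k n m)"
      unfolding u_def v
    proof (rule u_diff_bound[OF C _ _ bad_sets[OF S(1)]])
      show "integrable ising_law (\<lambda>\<omega>. f (\<sigma> (real k * (1/2) ^ j) \<omega>))"
        by (rule f\<sigma>_integrable[OF S C]) simp
      show "integrable ising_law (\<lambda>\<omega>. f (approx n m (k * 2 ^ (m - j)) \<omega>))"
        unfolding approx_def
        by (rule ising_law.integrable_const_bound[where B = C]) (use C approximation_measurable[OF S] in auto)
      show "AE \<omega> in ising_law. \<omega> \<notin> bad S j k n m \<longrightarrow> f (\<sigma> (real k * (1/2) ^ j) \<omega>) = f (approx n m (k * 2 ^ (m - j)) \<omega>)"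
        by (rule AE_I2) (auto simp: bad_def intro!: cylinderD[OF S(2)])
    qed
    also have "\<dots> \<le> (2 * C + 1) * measure ising_law (bad S j k n m)"
      by (intro mult_right_mono) auto
    also have "\<dots> < (2 * C + 1) * ?e" using b C0 by (intro mult_strict_left_mono) auto
    also have "\<dots> = \<epsilon>" using C0 by simp
    finally show "\<bar>u f (real k * (1/2) ^ j) - v n m (k * 2 ^ (m - j)) f\<bar> < \<epsilon>" .
  qed
qed

end

section \<open>Association and the forward equation\<close>

lemma resamples_diff: "resamples q xs (\<lambda>\<eta>. f \<eta> - g \<eta>) \<eta> = resamples q xs f \<eta> - resamples q xs g \<eta>"
  using resamples_add[of q xs f "\<lambda>\<eta>. (-1) * g \<eta>"] resamples_cmult[of q xs "-1" g] by simp

lemma one_minus_exp_ge: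
  assumes "0 \<le> (s::real)" shows "s - (1 - exp (- s)) \<le> s\<^sup>2"
proof -
  have "exp (- s) * (1 + s) \<le> exp (- s) * exp s"
    by (intro mult_left_mono exp_ge_add_one_self) auto
  then have "exp (- s) * (1 + s) \<le> 1" by (simp add: exp_minus)
  moreover have "1 \<le> (1 - s + s\<^sup>2) * (1 + s)"
    using assms by (simp add: algebra_simps power2_eq_square)
  ultimately have "exp (- s) * (1 + s) \<le> (1 - s + s\<^sup>2) * (1 + s)" by linarith
  then have "exp (- s) \<le> 1 - s + s\<^sup>2" using assms by (simp add: mult_le_cancel_right)
  then show ?thesis by simp
qed

text \<open>The iterated limit, m first and then n, is replaced by one sequence with explicit error,
  to which the usual limit theorems apply.\<close>

lemma diagonal_sequences:
  assumes "\<And>\<epsilon>::real. 0 < \<epsilon> \<Longrightarrow> \<forall>\<^sub>F n in sequentially. \<forall>\<^sub>F m in sequentially. Q \<epsilon> n m"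
  obtains a b :: "nat \<Rightarrow> nat" where "\<And>N. Q (1 / real (Suc N)) (a N) (b N)" "\<And>N. N \<le> a N" "\<And>N. N \<le> b N"
proof -
  have "\<exists>n m. Q (1 / real (Suc N)) n m \<and> N \<le> n \<and> N \<le> m" for N
  proof -
    have "\<forall>\<^sub>F n in sequentially. (\<forall>\<^sub>F m in sequentially. Q (1 / real (Suc N)) n m) \<and> N \<le> n"
      using assms[of "1 / real (Suc N)"] by (intro eventually_conj eventually_ge_at_top) auto
    then obtain n where n: "\<forall>\<^sub>F m in sequentially. Q (1 / real (Suc N)) n m" "N \<le> n"
      using eventually_happens'[OF sequentially_bot] by blast
    from n(1) have "\<forall>\<^sub>F m in sequentially. Q (1 / real (Suc N)) n m \<and> N \<le> m"
      by (intro eventually_conj eventually_ge_at_top)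
    then obtain m where "Q (1 / real (Suc N)) n m" "N \<le> m"
      using eventually_happens'[OF sequentially_bot] by blast
    with n show ?thesis by blast
  qed
  then show ?thesis using that by metis
qed

lemma LIMSEQ_of_close:
  fixes X :: "nat \<Rightarrow> real"
  assumes "\<And>N. \<bar>x - X N\<bar> < 1 / real (Suc N)" shows "X \<longlonglongrightarrow> x"
proof (rule LIMSEQ_I)
  fix r :: real assume "0 < r"
  then obtain N0 where N0: "inverse (real (Suc N0)) < r" using reals_Archimedean by blast
  have "norm (X N - x) < r" if "N0 \<le> N" for N
  proof -
    have "1 / real (Suc N) \<le> 1 / real (Suc N0)" using that by (intro divide_left_mono) auto
    then show ?thesis using assms[of N] N0 by (simp add: inverse_eq_divide abs_minus_commute)
  qed
  then show "\<exists>no. \<forall>n\<ge>no. norm (X n - x) < r" by blast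
qed

context ising
begin

definition mesh_prob :: "nat \<Rightarrow> real" where
  "mesh_prob m = 1 - exp (- ((1/2) ^ m))"

lemma mesh_prob: "0 \<le> mesh_prob m" "mesh_prob m \<le> 1" "mesh_prob m \<le> (1/2) ^ m" "(1/2) ^ m - mesh_prob m \<le> ((1/2) ^ m)\<^sup>2"
  using one_minus_exp_le[of "(1/2) ^ m"] one_minus_exp_ge[of "(1/2) ^ m"] by (auto simp: mesh_prob_def)

lemma v_eq: "v n m k f = (\<integral>\<eta>. resamples (mesh_prob m) (concat (replicate k (box_list n))) f \<eta> \<partial>initial_law)"
  by (simp add: v_def mesh_prob_def)

lemma integrable_resamples:
  fixes C :: real
  assumes S: "finite S" "cylinder S f" and C: "\<And>\<eta>. \<bar>f \<eta>\<bar> \<le> C"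
  shows "integrable initial_law (resamples (mesh_prob m) xs f)"
proof -
  obtain S' where S': "finite S'" "cylinder S' (resamples (mesh_prob m) xs f)"
    using cylinder_resamples[OF S, of "mesh_prob m" xs] by (elim exE conjE)
  show ?thesis
    by (rule integrable_bounded_initial[OF S' resamples_bound[OF C mesh_prob(1,2)]])
qed

lemma integral_bound_initial:
  fixes f :: "config \<Rightarrow> real"
  assumes "integrable initial_law f" "\<And>\<eta>. \<bar>f \<eta>\<bar> \<le> C" shows "\<bar>\<integral>\<eta>. f \<eta> \<partial>initial_law\<bar> \<le> C"
proof -
  have "\<bar>\<integral>\<eta>. f \<eta> \<partial>initial_law\<bar> \<le> (\<integral>\<eta>. \<bar>f \<eta>\<bar> \<partial>initial_law)" by (rule integral_abs_bound)
  also have "\<dots> \<le> (\<integral>\<eta>. C \<partial>initial_law)" using assms by (intro integral_mono) auto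
  finally show ?thesis using initial_law.prob_space by simp
qed

lemma v_bound:
  fixes C :: real
  assumes S: "finite S" "cylinder S f" and C: "\<And>\<eta>. \<bar>f \<eta>\<bar> \<le> C"
  shows "\<bar>v n m k f\<bar> \<le> C"
  unfolding v_eq by (intro integral_bound_initial integrable_resamples[OF S C] resamples_bound[OF C mesh_prob(1,2)])

lemma v_step:
  fixes C :: real
  assumes S: "finite S" "cylinder S f" and C: "\<And>\<eta>. \<bar>f \<eta>\<bar> \<le> C"
  shows "\<bar>v n m (Suc k) f - v n m k f\<bar> \<le> mesh_prob m * (card S * (2 * C))"
proof -
  let ?q = "mesh_prob m" and ?xs = "box_list n" and ?L = "concat (replicate k (box_list n))"
  have C0: "0 \<le> C" using C[of undefined] by linarith
  have step: "v n m (Suc k) f = (\<integral>\<eta>. resamples ?q ?L (resamples ?q ?xs f) \<eta> \<partial>initial_law)"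
    unfolding v_eq concat_replicate_Suc resamples_append ..
  have i1: "integrable initial_law (resamples ?q ?L (resamples ?q ?xs f))"
    using integrable_resamples[OF S C, of m "?L @ ?xs"] by (simp add: resamples_append[abs_def])
  have i2: "integrable initial_law (resamples ?q ?L f)" by (rule integrable_resamples[OF S C])
  have b: "\<bar>resamples ?q ?xs f \<eta> - f \<eta>\<bar> \<le> ?q * (card S * (2 * C))" for \<eta>
  proof -
    have "\<bar>resamples ?q ?xs f \<eta> - f \<eta>\<bar> \<le> ?q * (card (set ?xs \<inter> S) * (2 * C))"
      by (rule resamples_diff_bound[OF S C mesh_prob(1,2) box_list(1)])
    also have "\<dots> \<le> ?q * (card S * (2 * C))"
      using C0 mesh_prob(1)[of m] S(1) by (intro mult_left_mono mult_right_mono) (auto intro: card_mono)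
    finally show ?thesis .
  qed
  have "v n m (Suc k) f - v n m k f = (\<integral>\<eta>. resamples ?q ?L (\<lambda>\<eta>. resamples ?q ?xs f \<eta> - f \<eta>) \<eta> \<partial>initial_law)"
    unfolding step unfolding v_eq resamples_diff by (rule Bochner_Integration.integral_diff[symmetric, OF i1 i2])
  also have "\<bar>\<dots>\<bar> \<le> ?q * (card S * (2 * C))"
  proof (rule integral_bound_initial)
    show "integrable initial_law (resamples ?q ?L (\<lambda>\<eta>. resamples ?q ?xs f \<eta> - f \<eta>))"
      using i1 i2 unfolding resamples_diff[abs_def] by (rule Bochner_Integration.integrable_diff)
  qed (rule resamples_bound[OF b mesh_prob(1,2)])
  finally show ?thesis .
qed

lemma v_step_generator:
  fixes C :: real
  assumes S: "finite S" "cylinder S f" and C: "\<And>\<eta>. \<bar>f \<eta>\<bar> \<le> C" and n: "S \<subseteq> square n"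
  shows "\<bar>v n m (Suc k) f - v n m k f - mesh_prob m * v n m k (generator S f)\<bar>
    \<le> (mesh_prob m)\<^sup>2 * (card S * ((card S + 5) * (4 * C)))"
proof -
  let ?q = "mesh_prob m" and ?xs = "box_list n" and ?L = "concat (replicate k (box_list n))" and ?g = "generator S f"
  let ?h = "\<lambda>\<eta>. resamples ?q ?xs f \<eta> - f \<eta> - ?q * ?g \<eta>"
  have xs: "set ?xs \<inter> S = S" using n by (auto simp: box_list)
  have Sg: "finite (\<Union>x\<in>S. {x} \<union> neighbours x)" using S by auto
  have i1: "integrable initial_law (resamples ?q ?L (resamples ?q ?xs f))"
    using integrable_resamples[OF S C, of m "?L @ ?xs"] by (simp add: resamples_append[abs_def])
  have i2: "integrable initial_law (resamples ?q ?L f)" by (rule integrable_resamples[OF S C])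
  have i3: "integrable initial_law (resamples ?q ?L ?g)"
    by (rule integrable_resamples[OF Sg cylinder_generator[OF S(2)] generator_bound[OF C]])
  have e: "resamples ?q ?L ?h = (\<lambda>\<eta>. resamples ?q ?L (resamples ?q ?xs f) \<eta> - resamples ?q ?L f \<eta> - ?q * resamples ?q ?L ?g \<eta>)"
    using resamples_diff[of ?q ?L "\<lambda>\<eta>. resamples ?q ?xs f \<eta> - f \<eta>" "\<lambda>\<eta>. ?q * ?g \<eta>"]
      resamples_diff[of ?q ?L "resamples ?q ?xs f" f] resamples_cmult[of ?q ?L ?q ?g] by auto
  have i: "integrable initial_law (resamples ?q ?L ?h)"
    unfolding e using i1 i2 i3 by (intro Bochner_Integration.integrable_diff) auto
  have b: "\<bar>?h \<eta>\<bar> \<le> ?q\<^sup>2 * (card S * ((card S + 5) * (4 * C)))" for \<eta>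
    using resamples_generator[OF S C mesh_prob(1,2) box_list(1), of m n \<eta>] unfolding xs .
  have "v n m (Suc k) f - v n m k f - ?q * v n m k ?g = (\<integral>\<eta>. resamples ?q ?L ?h \<eta> \<partial>initial_law)"
    unfolding e unfolding v_eq concat_replicate_Suc resamples_append using i1 i2 i3 by simp
  also have "\<bar>\<dots>\<bar> \<le> ?q\<^sup>2 * (card S * ((card S + 5) * (4 * C)))"
    by (rule integral_bound_initial[OF i resamples_bound[OF b mesh_prob(1,2)]])
  finally show ?thesis .
qed

text \<open>Telescoping over b slots. Each slot costs C1 times the square of q; replacing its
  generator term by the one at slot k costs at most C2 b times the square of q, whence the quadratic
  term.\<close>

lemma v_forward:
  fixes C :: real
  assumes S: "finite S" "cylinder S f" and C: "\<And>\<eta>. \<bar>f \<eta>\<bar> \<le> C" and n: "S \<subseteq> square n"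
  defines "C1 \<equiv> card S * ((card S + 5) * (4 * C))"
    and "C2 \<equiv> card (\<Union>x\<in>S. {x} \<union> neighbours x) * (2 * (card S * (2 * C)))"
  shows "\<bar>v n m (k + b) f - v n m k f - b * mesh_prob m * v n m k (generator S f)\<bar>
    \<le> b * C1 * (mesh_prob m)\<^sup>2 + (b * mesh_prob m)\<^sup>2 * C2"
proof -
  let ?q = "mesh_prob m" and ?g = "generator S f"
  have Sg: "finite (\<Union>x\<in>S. {x} \<union> neighbours x)" using S by auto
  have C0: "0 \<le> C" using C[of undefined] by linarith
  have C2: "0 \<le> C2" unfolding C2_def using C0 by simp
  have g: "\<bar>v n m (k + b) ?g - v n m k ?g\<bar> \<le> b * ?q * C2" for b
  proof (induction b)
    case (Suc b)
    have "\<bar>v n m (Suc (k + b)) ?g - v n m (k + b) ?g\<bar> \<le> ?q * C2"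
      unfolding C2_def by (rule v_step[OF Sg cylinder_generator[OF S(2)] generator_bound[OF C]])
    then show ?case using Suc by (simp add: algebra_simps abs_le_iff)
  qed simp
  show ?thesis
  proof (induction b)
    case (Suc b)
    have 1: "\<bar>v n m (Suc (k + b)) f - v n m (k + b) f - ?q * v n m (k + b) ?g\<bar> \<le> ?q\<^sup>2 * C1"
      unfolding C1_def by (rule v_step_generator[OF S C n])
    have 2: "\<bar>?q * (v n m (k + b) ?g - v n m k ?g)\<bar> \<le> ?q * (b * ?q * C2)"
      unfolding abs_mult using g[of b] mesh_prob(1)[of m] by (intro mult_mono) auto
    have 3: "v n m (k + Suc b) f - v n m k f - Suc b * ?q * v n m k ?g
      = (v n m (Suc (k + b)) f - v n m (k + b) f - ?q * v n m (k + b) ?g)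
        + (v n m (k + b) f - v n m k f - b * ?q * v n m k ?g) + ?q * (v n m (k + b) ?g - v n m k ?g)"
      by (simp add: algebra_simps)
    have "\<bar>v n m (k + Suc b) f - v n m k f - Suc b * ?q * v n m k ?g\<bar>
      \<le> ?q\<^sup>2 * C1 + (b * C1 * ?q\<^sup>2 + (b * ?q)\<^sup>2 * C2) + ?q * (b * ?q * C2)"
      unfolding 3 using 1 2 Suc by (simp add: abs_le_iff)
    \<comment> \<open>The slack is \<open>(b + 1) ^ 2 - b ^ 2 - b = b + 1\<close>.\<close>
    also have "\<dots> \<le> Suc b * C1 * ?q\<^sup>2 + (Suc b * ?q)\<^sup>2 * C2"
    proof -
      have "(real (Suc b) * ?q)\<^sup>2 * C2 - ((b * ?q)\<^sup>2 * C2 + ?q * (b * ?q * C2)) = (real b + 1) * (?q\<^sup>2 * C2)"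
        by (simp add: algebra_simps power2_eq_square)
      moreover have "\<dots> \<ge> 0" using C2 by (intro mult_nonneg_nonneg) auto
      ultimately show ?thesis by (simp add: algebra_simps)
    qed
    finally show ?case .
  qed simp
qed

text \<open>Kolmogorov's forward equation, with an error that is uniform in time.\<close>

lemma u_forward:
  fixes f :: "config \<Rightarrow> real"
  assumes S: "finite S" "cylinder S f" and C: "\<And>\<eta>. \<bar>f \<eta>\<bar> \<le> C"
  shows "\<exists>K. \<forall>j k b. \<bar>u f (real (k + b) * (1/2) ^ j) - u f (real k * (1/2) ^ j)
    - real b * (1/2) ^ j * u (generator S f) (real k * (1/2) ^ j)\<bar> \<le> K * (real b * (1/2) ^ j)\<^sup>2"
proof -
  let ?g = "generator S f" and ?S = "\<Union>x\<in>S. {x} \<union> neighbours x"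
  define C1 where "C1 = real (card S) * (real (card S + 5) * (4 * C))"
  define C2 where "C2 = real (card ?S) * (2 * (real (card S) * (2 * C)))"
  define Cg where "Cg = real (card S) * (2 * C)"
  have C0: "0 \<le> C" using C[of undefined] by linarith
  then have nn: "0 \<le> C1" "0 \<le> C2" "0 \<le> Cg" unfolding C1_def C2_def Cg_def by auto
  have Sg: "finite ?S" using S by auto
  note cg = cylinder_generator[OF S(2)] and bg = generator_bound[OF C]
  have "\<bar>u f (real (k + b) * (1/2) ^ j) - u f (real k * (1/2) ^ j) - real b * (1/2) ^ j * u ?g (real k * (1/2) ^ j)\<bar>
    \<le> C2 * (real b * (1/2) ^ j)\<^sup>2" for j k b
  proof -
    let ?t = "real k * (1/2) ^ j" and ?h = "real b * (1/2) ^ j"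
    let ?s = "real (k + b) * (1/2) ^ j"
    have ev: "\<forall>\<^sub>F n in sequentially. \<forall>\<^sub>F m in sequentially.
      \<bar>u f ?s - v n m ((k + b) * 2 ^ (m - j)) f\<bar> < \<epsilon> \<and> \<bar>u f ?t - v n m (k * 2 ^ (m - j)) f\<bar> < \<epsilon> \<and>
      \<bar>u ?g ?t - v n m (k * 2 ^ (m - j)) ?g\<bar> < \<epsilon> \<and> S \<subseteq> square n \<and> j \<le> m" if "0 < \<epsilon>" for \<epsilon>
      using u_approx[OF S C that, of "k + b" j] u_approx[OF S C that, of k j] u_approx[OF Sg cg bg that, of k j]
        eventually_subset_square[OF S(1)]
    proof eventually_elim
      case (elim n)
      from elim(1,2,3) eventually_ge_at_top[of j] show ?case
        by eventually_elim (use elim(4) in auto)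
    qed
    obtain a c where ac: "\<And>N. \<bar>u f ?s - v (a N) (c N) ((k + b) * 2 ^ (c N - j)) f\<bar> < 1 / real (Suc N) \<and>
      \<bar>u f ?t - v (a N) (c N) (k * 2 ^ (c N - j)) f\<bar> < 1 / real (Suc N) \<and>
      \<bar>u ?g ?t - v (a N) (c N) (k * 2 ^ (c N - j)) ?g\<bar> < 1 / real (Suc N) \<and> S \<subseteq> square (a N) \<and> j \<le> c N"
      "\<And>N. N \<le> c N"
      by (rule diagonal_sequences[OF ev]) auto
    let ?X = "\<lambda>N. v (a N) (c N) ((k + b) * 2 ^ (c N - j)) f"
    let ?Y = "\<lambda>N. v (a N) (c N) (k * 2 ^ (c N - j)) f"
    let ?Z = "\<lambda>N. v (a N) (c N) (k * 2 ^ (c N - j)) ?g"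
    have lim: "?X \<longlonglongrightarrow> u f ?s" "?Y \<longlonglongrightarrow> u f ?t" "?Z \<longlonglongrightarrow> u ?g ?t"
      using ac(1) by (auto intro!: LIMSEQ_of_close)
    \<comment> \<open>For fixed duration h, the C1 error and the gap between ring probability and
      slot length are of order h times the mesh and disappear; only the C2 term survives.\<close>
    have bound: "\<bar>?X N - ?Y N - ?h * ?Z N\<bar> \<le> C2 * ?h\<^sup>2 + ?h * (C1 + Cg) * (1/2) ^ N" for N
    proof -
      let ?m = "c N" and ?B = "b * 2 ^ (c N - j)"
      have n: "S \<subseteq> square (a N)" and j: "j \<le> ?m" using ac(1)[of N] by auto
      have Bh: "real ?B * (1/2) ^ ?m = ?h"
      proof -
        have "?m = (?m - j) + j" using j by simp
        then have "(1/2 :: real) ^ ?m = (1/2) ^ (?m - j) * (1/2) ^ j" by (metis power_add)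
        then show ?thesis by (simp add: power_divide)
      qed
      have Bq: "real ?B * mesh_prob ?m \<le> ?h"
        unfolding Bh[symmetric] using mesh_prob(3)[of ?m] by (intro mult_left_mono) auto
      have Bq0: "0 \<le> real ?B * mesh_prob ?m" using mesh_prob(1)[of ?m] by simp
      have sm: "(1/2 :: real) ^ ?m \<le> (1/2) ^ N" using ac(2)[of N] by (intro power_decreasing) auto
      have "\<bar>?X N - ?Y N - real ?B * mesh_prob ?m * ?Z N\<bar> \<le> real ?B * C1 * (mesh_prob ?m)\<^sup>2 + (real ?B * mesh_prob ?m)\<^sup>2 * C2"
        using v_forward[OF S C n, of ?m "k * 2 ^ (c N - j)" ?B] unfolding C1_def C2_def
        by (simp add: algebra_simps)
      moreover have "real ?B * C1 * (mesh_prob ?m)\<^sup>2 \<le> ?h * C1 * (1/2) ^ N"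
      proof -
        have "real ?B * C1 * (mesh_prob ?m)\<^sup>2 = (real ?B * mesh_prob ?m) * (C1 * mesh_prob ?m)"
          by (simp add: power2_eq_square)
        also have "\<dots> \<le> ?h * (C1 * (1/2) ^ N)"
          by (rule mult_mono[OF Bq mult_left_mono[OF order_trans[OF mesh_prob(3) sm] nn(1)]])
            (use nn mesh_prob(1)[of ?m] in simp_all)
        finally show ?thesis by simp
      qed
      moreover have "(real ?B * mesh_prob ?m)\<^sup>2 * C2 \<le> ?h\<^sup>2 * C2"
        using Bq Bq0 nn by (intro mult_right_mono power_mono) auto
      moreover have "\<bar>(?h - real ?B * mesh_prob ?m) * ?Z N\<bar> \<le> ?h * Cg * (1/2) ^ N"
      proof -
        have "?h - real ?B * mesh_prob ?m = real ?B * ((1/2) ^ ?m - mesh_prob ?m)"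
          unfolding Bh[symmetric] by (simp add: algebra_simps)
        also have "\<dots> \<le> real ?B * ((1/2) ^ ?m)\<^sup>2" using mesh_prob(4)[of ?m] by (intro mult_left_mono) auto
        also have "\<dots> = ?h * (1/2) ^ ?m" unfolding Bh[symmetric] by (simp add: power2_eq_square)
        also have "\<dots> \<le> ?h * (1/2) ^ N" using sm by (intro mult_left_mono) auto
        finally have 1: "?h - real ?B * mesh_prob ?m \<le> ?h * (1/2) ^ N" .
        have 2: "\<bar>?Z N\<bar> \<le> Cg" unfolding Cg_def by (rule v_bound[OF Sg cg bg])
        have "\<bar>(?h - real ?B * mesh_prob ?m) * ?Z N\<bar> \<le> (?h * (1/2) ^ N) * Cg"
          unfolding abs_mult using 1 2 Bq by (intro mult_mono) auto
        then show ?thesis by (simp add: mult_ac)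
      qed
      moreover have "?X N - ?Y N - ?h * ?Z N = (?X N - ?Y N - real ?B * mesh_prob ?m * ?Z N) - (?h - real ?B * mesh_prob ?m) * ?Z N"
        by (simp add: algebra_simps)
      ultimately show ?thesis by (simp only: abs_le_iff) (simp add: algebra_simps)
    qed
    have "(\<lambda>N. C2 * ?h\<^sup>2 + ?h * (C1 + Cg) * (1/2) ^ N) \<longlonglongrightarrow> C2 * ?h\<^sup>2 + ?h * (C1 + Cg) * 0"
      by (intro tendsto_intros LIMSEQ_power_zero) auto
    then show ?thesis
      using lim by (intro LIMSEQ_le[where X = "\<lambda>N. \<bar>?X N - ?Y N - ?h * ?Z N\<bar>"] tendsto_rabs tendsto_diff tendsto_mult tendsto_const)
        (use bound in auto)
  qed
  then show ?thesis by blast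
qed

text \<open>The discrete kernels satisfy the inequality and preserve monotonicity, and the product
  initial law satisfies it too. The inequality is a closed condition, so it passes to the
  limit.\<close>

lemma u_association:
  fixes f :: "config \<Rightarrow> real"
  assumes S: "finite S" "cylinder S f" "cylinder S g" and C: "\<And>\<eta>. \<bar>f \<eta>\<bar> \<le> C" "\<And>\<eta>. \<bar>g \<eta>\<bar> \<le> C"
    and inc: "increasing f" "increasing g"
  shows "u f (real k * (1/2) ^ j) * u g (real k * (1/2) ^ j) \<le> u (\<lambda>\<eta>. f \<eta> * g \<eta>) (real k * (1/2) ^ j)"
proof -
  let ?t = "real k * (1/2) ^ j" and ?h = "\<lambda>\<eta>. f \<eta> * g \<eta>"
  have C0: "0 \<le> C" using C(1)[of undefined] by linarith
  have h: "cylinder S ?h" by (rule cylinder_comb[OF S(2,3), of "(*)"])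
  have hb: "\<bar>?h \<eta>\<bar> \<le> C * C" for \<eta>
    unfolding abs_mult using C C0 by (intro mult_mono) auto
  have v: "v n m l f * v n m l g \<le> v n m l ?h" for n m l
  proof -
    let ?R = "resamples (mesh_prob m) (concat (replicate l (box_list n)))"
    obtain S1 S2 S3 where *: "finite S1" "cylinder S1 (?R f)" "finite S2" "cylinder S2 (?R g)" "finite S3" "cylinder S3 (?R ?h)"
      using cylinder_resamples[OF S(1,2), of "mesh_prob m" "concat (replicate l (box_list n))"]
        cylinder_resamples[OF S(1,3), of "mesh_prob m" "concat (replicate l (box_list n))"]
        cylinder_resamples[OF S(1) h, of "mesh_prob m" "concat (replicate l (box_list n))"]
      by (elim exE conjE) (rule that)
    have b: "\<bar>?R f \<eta>\<bar> \<le> max C (C * C)" "\<bar>?R g \<eta>\<bar> \<le> max C (C * C)" "\<bar>?R ?h \<eta>\<bar> \<le> max C (C * C)" for \<eta>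
      using resamples_bound[OF C(1) mesh_prob(1,2)] resamples_bound[OF C(2) mesh_prob(1,2)] resamples_bound[OF hb mesh_prob(1,2)]
      by (simp_all add: le_max_iff_disj)
    show ?thesis
      unfolding v_eq
    proof (rule initial_association[where S = "S1 \<union> S2 \<union> S3" and C = "max C (C * C)"])
      show "cylinder (S1 \<union> S2 \<union> S3) (?R f)" "cylinder (S1 \<union> S2 \<union> S3) (?R g)" "cylinder (S1 \<union> S2 \<union> S3) (?R ?h)"
        using * by (auto intro: cylinder_mono)
      show "increasing (?R f)" "increasing (?R g)"
        using inc by (auto intro!: increasing_resamples mesh_prob)
      show "?R f \<eta> * ?R g \<eta> \<le> ?R ?h \<eta>" if "\<eta> \<in> spins" for \<eta>
        by (rule resamples_mult[OF inc mesh_prob(1,2) that])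
    qed (use * b in auto)
  qed
  have ev: "\<forall>\<^sub>F n in sequentially. \<forall>\<^sub>F m in sequentially.
    \<bar>u f ?t - v n m (k * 2 ^ (m - j)) f\<bar> < \<epsilon> \<and> \<bar>u g ?t - v n m (k * 2 ^ (m - j)) g\<bar> < \<epsilon> \<and>
    \<bar>u ?h ?t - v n m (k * 2 ^ (m - j)) ?h\<bar> < \<epsilon>" if "0 < \<epsilon>" for \<epsilon>
    using u_approx[OF S(1,2) C(1) that, of k j] u_approx[OF S(1,3) C(2) that, of k j] u_approx[OF S(1) h hb that, of k j]
  proof eventually_elim
    case (elim n)
    then show ?case by eventually_elim auto
  qed
  obtain a c where ac: "\<And>N. \<bar>u f ?t - v (a N) (c N) (k * 2 ^ (c N - j)) f\<bar> < 1 / real (Suc N) \<and>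
    \<bar>u g ?t - v (a N) (c N) (k * 2 ^ (c N - j)) g\<bar> < 1 / real (Suc N) \<and>
    \<bar>u ?h ?t - v (a N) (c N) (k * 2 ^ (c N - j)) ?h\<bar> < 1 / real (Suc N)"
    by (rule diagonal_sequences[OF ev]) auto
  have "(\<lambda>N. v (a N) (c N) (k * 2 ^ (c N - j)) f) \<longlonglongrightarrow> u f ?t"
    "(\<lambda>N. v (a N) (c N) (k * 2 ^ (c N - j)) g) \<longlonglongrightarrow> u g ?t"
    "(\<lambda>N. v (a N) (c N) (k * 2 ^ (c N - j)) ?h) \<longlonglongrightarrow> u ?h ?t"
    using ac by (auto intro!: LIMSEQ_of_close)
  then show ?thesis
    using v by (intro LIMSEQ_le[OF tendsto_mult]) auto
qed

text \<open>Between grid times a local function changes only if a clock in S rings, which has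
  probability at most \<open>card S\<close> times the mesh. This carries estimates from dyadic times
  to all times.\<close>

lemma u_continuity:
  fixes f :: "config \<Rightarrow> real"
  assumes S: "finite S" "cylinder S f" and C: "\<And>\<eta>. \<bar>f \<eta>\<bar> \<le> C"
    and t: "real k * (1/2) ^ j \<le> t" "t \<le> real (Suc k) * (1/2) ^ j"
  shows "\<bar>u f t - u f (real k * (1/2) ^ j)\<bar> \<le> 2 * C * (card S * (1/2) ^ j)"
proof -
  let ?s = "real k * (1/2) ^ j" and ?h = "(1/2 :: real) ^ j"
  have C0: "0 \<le> C" using C[of undefined] by linarith
  have s0: "0 \<le> ?s" by simp
  let ?R = "\<lambda>x. {w. slot ?h (w x) k \<noteq> None}"
  have R: "?R x \<in> sets dyn_law" for x
  proof -
    have "{w \<in> space dyn_law. slot ?h (w x) k \<noteq> None} \<in> sets dyn_law" by measurable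
    then show ?thesis by simp
  qed
  define N where "N = (\<Union>x\<in>S. spins \<times> ?R x)"
  have sp: "spins \<in> sets initial_law" unfolding space_initial_law[symmetric] by simp
  have Rx: "spins \<times> ?R x \<in> sets ising_law" for x
    unfolding ising_law_def using R[of x] sp by (rule pair_measureI[rotated])
  have N: "N \<in> sets ising_law" unfolding N_def using S Rx by auto
  have "\<bar>u f t - u f ?s\<bar> \<le> 2 * C * measure ising_law N"
    unfolding u_def
  proof (rule u_diff_bound[OF C _ _ N])
    show "integrable ising_law (\<lambda>\<omega>. f (\<sigma> t \<omega>))" "integrable ising_law (\<lambda>\<omega>. f (\<sigma> ?s \<omega>))"
      by (rule f\<sigma>_integrable[OF S C order_trans[OF s0 t(1)]], rule f\<sigma>_integrable[OF S C s0])
    show "AE \<omega> in ising_law. \<omega> \<notin> N \<longrightarrow> f (\<sigma> t \<omega>) = f (\<sigma> ?s \<omega>)"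
      using AE_good AE_space
    proof eventually_elim
      case (elim \<omega>)
      show ?case
      proof
        assume n: "\<omega> \<notin> N"
        show "f (\<sigma> t \<omega>) = f (\<sigma> ?s \<omega>)"
        proof (rule cylinderD[OF S(2)])
          fix x assume x: "x \<in> S"
          have "slot ?h (snd \<omega> x) k = None"
            using n x elim unfolding N_def by (auto simp: space_ising_law mem_Times_iff)
          then have "\<forall>n. ring (snd \<omega> x) n \<notin> {?s<..real (Suc k) * ?h}"
            using slot_eq_None_iff[of "snd \<omega> x" ?h k] elim by (simp add: good_clocksD(1))
          then have "ring (snd \<omega> x) n \<notin> {?s<..t}" for n using t by auto
          then show "\<sigma> t \<omega> x = \<sigma> ?s \<omega> x"
            using elim t s0 by (intro trajectory_const[of "fst \<omega>" "snd \<omega>" "\<lambda>t. \<sigma> t \<omega>"]) auto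
        qed
      qed
    qed
  qed
  also have "measure ising_law N \<le> card S * ?h"
  proof -
    have "measure ising_law N \<le> (\<Sum>x\<in>S. measure ising_law (spins \<times> ?R x))"
      unfolding N_def using S Rx by (intro ising_law.finite_measure_subadditive_finite) auto
    also have "\<dots> \<le> (\<Sum>x\<in>S. ?h)"
    proof (rule sum_mono)
      fix x
      have "measure ising_law (spins \<times> ?R x) = measure initial_law spins * measure dyn_law (?R x)"
        unfolding ising_law_def using sp R[of x]
        by (simp add: measure_def dyn_law.emeasure_pair_measure_Times enn2real_mult)
      also have "\<dots> = measure dyn_law (?R x)"
        using initial_law.prob_space by (simp add: space_initial_law)
      also have "\<dots> = 1 - exp (- ?h)"
        using all_ring_prob[of "{x}" ?h k] by simp
      also have "\<dots> \<le> ?h" by (rule one_minus_exp_le)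
      finally show "measure ising_law (spins \<times> ?R x) \<le> ?h" .
    qed
    finally show ?thesis by simp
  qed
  finally show ?thesis using C0 by (simp add: mult_left_mono)
qed

end

section \<open>Negligible events\<close>

definition local_fn :: "(config \<Rightarrow> 'b) \<Rightarrow> bool" where
  "local_fn f \<longleftrightarrow> (\<exists>S. finite S \<and> cylinder S f)"

definition bounded_local :: "(config \<Rightarrow> real) \<Rightarrow> bool" where
  "bounded_local f \<longleftrightarrow> local_fn f \<and> (\<exists>C. \<forall>\<eta>. \<bar>f \<eta>\<bar> \<le> C)"

lemma local_fnI: "finite S \<Longrightarrow> cylinder S f \<Longrightarrow> local_fn f"
  unfolding local_fn_def by (intro exI[of _ S] conjI)

lemma local_fnE:
  assumes "local_fn f" obtains S where "finite S" "cylinder S f"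
  using assms unfolding local_fn_def by (elim exE conjE) (rule that)

lemma local_fn_const: "local_fn (\<lambda>_. c)"
  by (rule local_fnI[of "{}"]) (simp_all add: cylinder_def)

lemma cylinder_comp: "cylinder S f \<Longrightarrow> cylinder S (\<lambda>\<eta>. F (f \<eta>))"
  by (simp only: cylinder_def) metis

lemma local_fn_comp: "local_fn f \<Longrightarrow> local_fn (\<lambda>\<eta>. F (f \<eta>))"
  by (elim local_fnE, rule local_fnI, assumption) (rule cylinder_comp)

lemma local_fn_comp2:
  assumes "local_fn f" "local_fn g" shows "local_fn (\<lambda>\<eta>. F (f \<eta>) (g \<eta>))"
proof -
  obtain S T where ST: "finite S" "cylinder S f" "finite T" "cylinder T g"
    using assms by (elim local_fnE) (rule that)
  have "cylinder (S \<union> T) (\<lambda>\<eta>. F (f \<eta>) (g \<eta>))"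
    by (rule cylinder_comb[of "S \<union> T" f g F]) (rule cylinder_mono[OF ST(2)], simp, rule cylinder_mono[OF ST(4)], simp)
  then show ?thesis by (rule local_fnI[rotated]) (use ST in simp)
qed

lemma local_fn_spin: "local_fn (\<lambda>\<eta>. \<eta> x)"
  by (rule local_fnI[of "{x}"]) (simp_all add: cylinder_def)

lemma local_fn_spin_eq: "local_fn (\<lambda>\<eta>. \<eta> x = a)"
  by (rule local_fn_comp[OF local_fn_spin, of "\<lambda>b. b = a"])

lemma local_fn_not: "local_fn P \<Longrightarrow> local_fn (\<lambda>\<eta>. \<not> P \<eta>)"
  by (rule local_fn_comp)

lemma local_fn_conj: "local_fn P \<Longrightarrow> local_fn Q \<Longrightarrow> local_fn (\<lambda>\<eta>. P \<eta> \<and> Q \<eta>)"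
  by (rule local_fn_comp2)

lemma local_fn_disj: "local_fn P \<Longrightarrow> local_fn Q \<Longrightarrow> local_fn (\<lambda>\<eta>. P \<eta> \<or> Q \<eta>)"
  by (rule local_fn_comp2)

lemma local_fn_Ball:
  assumes "finite A" "\<And>x. x \<in> A \<Longrightarrow> local_fn (P x)" shows "local_fn (\<lambda>\<eta>. \<forall>x\<in>A. P x \<eta>)"
  using assms
proof (induction A)
  case (insert x A)
  then have "local_fn (\<lambda>\<eta>. P x \<eta> \<and> (\<forall>x\<in>A. P x \<eta>))" by (intro local_fn_conj) auto
  then show ?case by simp
qed (simp add: local_fn_const)

lemma cylinder_disagreements: "cylinder ({x} \<union> neighbours x) (\<lambda>\<eta>. disagreements \<eta> x)"
  unfolding cylinder_def disagreements_def
  by (intro allI impI arg_cong[where f = card]) auto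

lemma local_fn_disagreements: "local_fn (\<lambda>\<eta>. disagreements \<eta> x)"
  by (rule local_fnI[OF _ cylinder_disagreements]) simp

lemma cylinder_flip: "cylinder S f \<Longrightarrow> cylinder (insert x S) (\<lambda>\<eta>. f (flip x \<eta>))"
  unfolding cylinder_def flip_def
proof (intro allI impI)
  fix \<eta> \<zeta> :: config
  assume f: "\<forall>\<eta> \<zeta>. (\<forall>x\<in>S. \<eta> x = \<zeta> x) \<longrightarrow> f \<eta> = f \<zeta>" and e: "\<forall>y\<in>insert x S. \<eta> y = \<zeta> y"
  show "f (\<eta>(x := - \<eta> x)) = f (\<zeta>(x := - \<zeta> x))" using e by (intro f[rule_format]) auto
qed

lemma local_fn_flip: "local_fn f \<Longrightarrow> local_fn (\<lambda>\<eta>. f (flip x \<eta>))"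
  by (elim local_fnE, rule local_fnI[OF _ cylinder_flip]) auto

lemma local_fn_transform: "local_fn f \<Longrightarrow> local_fn (\<lambda>\<eta>. f (transform e \<phi> \<eta>))"
proof (elim local_fnE)
  fix S assume S: "finite S" "cylinder S f"
  have "cylinder (\<phi> ` S) (\<lambda>\<eta>. f (transform e \<phi> \<eta>))"
    unfolding cylinder_def
  proof (intro allI impI cylinderD[OF S(2)])
    fix \<eta> \<zeta> :: config and x assume "\<forall>x\<in>\<phi> ` S. \<eta> x = \<zeta> x" "x \<in> S"
    then show "transform e \<phi> \<eta> x = transform e \<phi> \<zeta> x" unfolding transform_def by auto
  qed
  then show ?thesis by (rule local_fnI[rotated]) (use S in simp)
qed

lemma bounded_local_of_bool: "local_fn P \<Longrightarrow> bounded_local (\<lambda>\<eta>. of_bool (P \<eta>))"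
  unfolding bounded_local_def by (intro conjI local_fn_comp[of P of_bool] exI[of _ 1]) auto

lemma bounded_local_const: "bounded_local (\<lambda>_. c)"
  unfolding bounded_local_def by (intro conjI local_fn_const exI[of _ "\<bar>c\<bar>"]) auto

lemma bounded_local_add:
  assumes "bounded_local f" "bounded_local g" shows "bounded_local (\<lambda>\<eta>. f \<eta> + g \<eta>)"
proof -
  obtain C D where "\<forall>\<eta>. \<bar>f \<eta>\<bar> \<le> C" "\<forall>\<eta>. \<bar>g \<eta>\<bar> \<le> D" using assms unfolding bounded_local_def by blast
  then have "\<bar>f \<eta> + g \<eta>\<bar> \<le> C + D" for \<eta> by (meson abs_triangle_ineq add_mono order_trans)
  moreover have "local_fn (\<lambda>\<eta>. f \<eta> + g \<eta>)"
    using assms by (intro local_fn_comp2[of f g "(+)"]) (auto simp: bounded_local_def)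
  ultimately show ?thesis unfolding bounded_local_def by blast
qed

lemma bounded_local_cmult:
  assumes "bounded_local f" shows "bounded_local (\<lambda>\<eta>. c * f \<eta>)"
proof -
  obtain C where "\<forall>\<eta>. \<bar>f \<eta>\<bar> \<le> C" using assms unfolding bounded_local_def by blast
  then have "\<bar>c * f \<eta>\<bar> \<le> \<bar>c\<bar> * C" for \<eta> by (simp add: abs_mult mult_left_mono)
  moreover have "local_fn (\<lambda>\<eta>. c * f \<eta>)"
    using assms by (intro local_fn_comp[of f "(*) c"]) (auto simp: bounded_local_def)
  ultimately show ?thesis unfolding bounded_local_def by blast
qed

lemma bounded_local_sum:
  "finite A \<Longrightarrow> (\<And>x. x \<in> A \<Longrightarrow> bounded_local (f x)) \<Longrightarrow> bounded_local (\<lambda>\<eta>. \<Sum>x\<in>A. f x \<eta>)"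
proof (induction A rule: finite_induct)
  case (insert x A)
  then show ?case using bounded_local_add[of "f x"] by simp
qed (simp add: bounded_local_const)

lemma bounded_local_drift: "bounded_local f \<Longrightarrow> bounded_local (drift x f)"
  unfolding bounded_local_def
proof (elim conjE exE local_fnE, intro conjI)
  fix C S assume C: "\<forall>\<eta>. \<bar>f \<eta>\<bar> \<le> C" and S: "finite S" "cylinder S f"
  show "local_fn (drift x f)" by (rule local_fnI[OF _ cylinder_drift[OF S(2)]]) (use S in simp)
  show "\<exists>C. \<forall>\<eta>. \<bar>drift x f \<eta>\<bar> \<le> C" using drift_bound[of f C x] C by blast
qed

lemma bounded_local_generator: "finite S \<Longrightarrow> bounded_local f \<Longrightarrow> bounded_local (generator S f)"
  unfolding generator_def[abs_def] by (intro bounded_local_sum bounded_local_drift)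

lemma automorphismI:
  assumes "\<And>x. \<psi> (\<phi> x) = x" "\<And>x. \<phi> (\<psi> x) = x" "\<And>x. neighbours (\<phi> x) = \<phi> ` neighbours x"
  shows "automorphism \<phi>"
proof -
  have "\<psi> \<circ> \<phi> = id" "\<phi> \<circ> \<psi> = id"
    using assms(1,2) by (simp_all add: fun_eq_iff del: split_paired_All)
  then have "bij \<phi>" by (rule o_bij)
  then show ?thesis unfolding automorphism_def using assms(3) by blast
qed

lemma automorphism_affine:
  assumes "a = 1 \<or> a = -1" "b = 1 \<or> b = -1"
  shows "automorphism (\<lambda>x. (fst z + a * fst x, snd z + b * snd x))"
proof (rule automorphismI[where \<psi> = "\<lambda>x. (a * (fst x - fst z), b * (snd x - snd z))"])
  show "(fst z + a * fst (a * (fst x - fst z), b * (snd x - snd z)), snd z + b * snd (a * (fst x - fst z), b * (snd x - snd z))) = x" for x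
    using assms by (elim disjE) simp_all
  show "(a * (fst (fst z + a * fst x, snd z + b * snd x) - fst z), b * (snd (fst z + a * fst x, snd z + b * snd x) - snd z)) = x" for x
    using assms by (elim disjE) simp_all
  show "neighbours (fst z + a * fst x, snd z + b * snd x) = (\<lambda>x. (fst z + a * fst x, snd z + b * snd x)) ` neighbours x" for x
    using assms by (elim disjE) (simp_all add: neighbours_alt insert_commute algebra_simps)
qed

lemma automorphism_swap: "automorphism prod.swap"
  by (rule automorphismI[where \<psi> = prod.swap]) (auto simp: neighbours_alt)

lemma update_transform:
  assumes "automorphism \<phi>" "e = 1 \<or> e = -1"
  shows "update x c (transform e \<phi> \<eta>) = transform e \<phi> (update (\<phi> x) c \<eta>)"
proof
  fix y
  have "inj \<phi>" using assms(1) unfolding automorphism_def by (auto dest: bij_is_inj)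
  then have "\<phi> y = \<phi> x \<longleftrightarrow> y = x" by (simp add: inj_eq)
  moreover have "updated_spin c (transform e \<phi> \<eta>) x = e * updated_spin c \<eta> (\<phi> x)"
    by (rule updated_spin_transform[OF assms])
  ultimately show "update x c (transform e \<phi> \<eta>) y = transform e \<phi> (update (\<phi> x) c \<eta>) y"
    unfolding update_def transform_def by auto
qed

lemma drift_transform:
  assumes "automorphism \<phi>" "e = 1 \<or> e = -1"
  shows "drift x f (transform e \<phi> \<eta>) = drift (\<phi> x) (\<lambda>\<zeta>. f (transform e \<phi> \<zeta>)) \<eta>"
  by (simp add: drift_def update_transform[OF assms])

lemma flip_eq_update: "\<eta> \<in> spins \<Longrightarrow> 2 \<le> disagreements \<eta> x \<Longrightarrow> update x True \<eta> = flip x \<eta>"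
  by (auto simp: update_def flip_def updated_spin_def)

context ising
begin

section \<open>Expectations of local functions at late times\<close>

abbreviation dyadic :: "nat \<Rightarrow> nat \<Rightarrow> real" where
  "dyadic j k \<equiv> real k * (1/2) ^ j"

lemma dyadic_refine: "i \<le> j \<Longrightarrow> dyadic i k = dyadic j (k * 2 ^ (j - i))"
proof -
  assume "i \<le> j"
  then have "j = (j - i) + i" by simp
  then have "(1/2 :: real) ^ j = (1/2) ^ (j - i) * (1/2) ^ i" by (metis power_add)
  then show ?thesis by (simp add: power_divide)
qed

lemma u_integrable:
  assumes "bounded_local f" "0 \<le> t" shows "integrable ising_law (\<lambda>\<omega>. f (\<sigma> t \<omega>))"
  using assms(1) unfolding bounded_local_def
proof (elim conjE exE local_fnE)
  fix C S assume "\<forall>\<eta>. \<bar>f \<eta>\<bar> \<le> C" "finite S" "cylinder S f"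
  then show ?thesis using f\<sigma>_integrable[of S f C t] assms(2) by blast
qed

lemma u_add: "bounded_local f \<Longrightarrow> bounded_local g \<Longrightarrow> 0 \<le> t \<Longrightarrow> u (\<lambda>\<eta>. f \<eta> + g \<eta>) t = u f t + u g t"
  unfolding u_def using u_integrable by simp

lemma u_cmult: "u (\<lambda>\<eta>. c * f \<eta>) t = c * u f t"
  unfolding u_def by simp

lemma u_const: "u (\<lambda>_. c) t = c"
  unfolding u_def using ising_law.prob_space by simp

lemma u_sum:
  "finite A \<Longrightarrow> (\<And>x. x \<in> A \<Longrightarrow> bounded_local (f x)) \<Longrightarrow> 0 \<le> t \<Longrightarrow> u (\<lambda>\<eta>. \<Sum>x\<in>A. f x \<eta>) t = (\<Sum>x\<in>A. u (f x) t)"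
  unfolding u_def using u_integrable by (intro Bochner_Integration.integral_sum) auto

lemma u_mono:
  assumes "bounded_local f" "bounded_local g" "0 \<le> t" "\<And>\<eta>. \<eta> \<in> spins \<Longrightarrow> f \<eta> \<le> g \<eta>"
  shows "u f t \<le> u g t"
  unfolding u_def using assms u_integrable \<sigma>_spins by (intro integral_mono) auto

lemma u_invariant:
  assumes "bounded_local f" "0 \<le> t" "automorphism \<phi>" "e = 1 \<or> e = -1"
  shows "u (\<lambda>\<eta>. f (transform e \<phi> \<eta>)) t = u f t"
  using assms(1) unfolding bounded_local_def by (elim conjE local_fnE) (rule u_transform[OF _ _ assms(2-4)])

text \<open>The expectations are controlled at dyadic times, so decay is demanded along each dyadic
  grid separately.\<close>

definition vanishing :: "(config \<Rightarrow> real) \<Rightarrow> bool" where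
  "vanishing f \<longleftrightarrow> (\<forall>j. (\<lambda>k. u f (dyadic j k)) \<longlonglongrightarrow> 0)"

text \<open>On a grid of mesh h the increments of a convergent expectation tend to 0, and they equal
  h times the generator term up to K times the square of h. So the generator term is eventually of
  order K h, with h as small as desired.\<close>

lemma generator_vanishing:
  assumes S: "finite S" "cylinder S f" and C: "\<And>\<eta>. \<bar>f \<eta>\<bar> \<le> C"
    and conv: "\<And>j. convergent (\<lambda>k. u f (dyadic j k))"
  shows "vanishing (generator S f)"
  unfolding vanishing_def
proof (intro allI LIMSEQ_I)
  fix i and \<epsilon> :: real assume \<epsilon>: "0 < \<epsilon>"
  obtain K where K: "\<And>j k b. \<bar>u f (dyadic j (k + b)) - u f (dyadic j k) - dyadic j b * u (generator S f) (dyadic j k)\<bar> \<le> K * (dyadic j b)\<^sup>2"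
    using u_forward[OF S C] by blast
  have "0 < \<epsilon> / (2 * (\<bar>K\<bar> + 1))" using \<epsilon> by simp
  then obtain j0 where j0: "(1/2 :: real) ^ j0 < \<epsilon> / (2 * (\<bar>K\<bar> + 1))"
    using real_arch_pow_inv[of _ "1/2"] by auto
  \<comment> \<open>The grid j refines the given grid i and makes K times the mesh smaller than
    \<epsilon> / 2.\<close>
  define j where "j = max i j0"
  let ?h = "(1/2 :: real) ^ j"
  have "?h \<le> (1/2) ^ j0" unfolding j_def by (intro power_decreasing) auto
  then have h: "?h < \<epsilon> / (2 * (\<bar>K\<bar> + 1))" using j0 by (rule order.strict_trans1)
  have Kh: "K * ?h < \<epsilon> / 2"
  proof -
    have "K * ?h \<le> (\<bar>K\<bar> + 1) * ?h" by (intro mult_right_mono) auto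
    also have "\<dots> < (\<bar>K\<bar> + 1) * (\<epsilon> / (2 * (\<bar>K\<bar> + 1)))" using h by (intro mult_strict_left_mono) auto
    also have "\<dots> = \<epsilon> / 2" by (simp add: field_simps)
    finally show ?thesis .
  qed
  obtain l where l: "(\<lambda>k. u f (dyadic j k)) \<longlonglongrightarrow> l" using conv[of j] unfolding convergent_def by blast
  have "(\<lambda>k. u f (dyadic j (Suc k)) - u f (dyadic j k)) \<longlonglongrightarrow> l - l"
    using l LIMSEQ_Suc[OF l] by (rule tendsto_diff[rotated])
  moreover have "0 < \<epsilon> / 2 * ?h" using \<epsilon> by simp
  ultimately obtain k0 where k0: "\<And>k. k0 \<le> k \<Longrightarrow> \<bar>u f (dyadic j (Suc k)) - u f (dyadic j k)\<bar> < \<epsilon> / 2 * ?h"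
    using LIMSEQ_D[of "\<lambda>k. u f (dyadic j (Suc k)) - u f (dyadic j k)" "l - l" "\<epsilon> / 2 * ?h"] by auto
  have "norm (u (generator S f) (dyadic i k) - 0) < \<epsilon>" if "k0 \<le> k" for k
  proof -
    let ?l = "k * 2 ^ (j - i)"
    have eq: "dyadic i k = dyadic j ?l" by (rule dyadic_refine) (simp add: j_def)
    have "k * 1 \<le> ?l" by (rule mult_left_mono) auto
    then have "k \<le> ?l" by (simp only: mult_1_right)
    with that have "k0 \<le> ?l" by (rule order_trans)
    then have 1: "\<bar>u f (dyadic j (Suc ?l)) - u f (dyadic j ?l)\<bar> < \<epsilon> / 2 * ?h" by (rule k0)
    have 2: "\<bar>u f (dyadic j (Suc ?l)) - u f (dyadic j ?l) - ?h * u (generator S f) (dyadic j ?l)\<bar> \<le> K * ?h * ?h"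
      using K[where j = j and k = ?l and b = 1] by (simp add: power2_eq_square)
    have "K * ?h * ?h < \<epsilon> / 2 * ?h" using Kh by (intro mult_strict_right_mono) auto
    with 1 2 have "\<bar>?h * u (generator S f) (dyadic j ?l)\<bar> < \<epsilon> * ?h" by linarith
    then have "?h * \<bar>u (generator S f) (dyadic j ?l)\<bar> < ?h * \<epsilon>" by (simp add: abs_mult mult.commute)
    then show ?thesis unfolding eq by simp
  qed
  then show "\<exists>no. \<forall>k\<ge>no. norm (u (generator S f) (dyadic i k) - 0) < \<epsilon>" by blast
qed

text \<open>The forward equation excludes an increase only up to K times the squared step. Cutting a
  step into \<open>2 ^ N\<close> pieces leaves an error of order \<open>(1/2) ^ N\<close>, so the
  expectation does decrease; being bounded below, it converges.\<close>

lemma u_decreasing: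
  assumes S: "finite S" "cylinder S f" and C: "\<And>\<eta>. \<bar>f \<eta>\<bar> \<le> C"
    and neg: "\<And>t. 0 \<le> t \<Longrightarrow> u (generator S f) t \<le> 0"
  shows "convergent (\<lambda>k. u f (dyadic j k))"
proof -
  obtain K where K: "\<And>j k b. \<bar>u f (dyadic j (k + b)) - u f (dyadic j k) - dyadic j b * u (generator S f) (dyadic j k)\<bar> \<le> K * (dyadic j b)\<^sup>2"
    using u_forward[OF S C] by blast
  have step: "u f (dyadic i (k + b)) \<le> u f (dyadic i k) + b * (K * ((1/2) ^ i)\<^sup>2)" for i k b
  proof (induction b)
    case (Suc b)
    have "(1/2) ^ i * u (generator S f) (dyadic i (k + b)) \<le> 0"
      by (intro mult_nonneg_nonpos neg) auto
    then have "u f (dyadic i (k + b + 1)) \<le> u f (dyadic i (k + b)) + K * ((1/2) ^ i)\<^sup>2"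
      using K[where j = i and k = "k + b" and b = 1] by (simp add: abs_le_iff)
    then show ?case using Suc by (simp add: algebra_simps)
  qed simp
  have "u f (dyadic j (Suc k)) \<le> u f (dyadic j k)" for k
  proof -
    have "u f (dyadic j (Suc k)) \<le> u f (dyadic j k) + \<bar>K\<bar> * (1/2) ^ N" for N
    proof -
      have e1: "dyadic j (Suc k) = dyadic (j + N) (k * 2 ^ N + 2 ^ N)"
        using dyadic_refine[of j "j + N" "Suc k"] by (simp add: add.commute)
      have e2: "dyadic j k = dyadic (j + N) (k * 2 ^ N)"
        using dyadic_refine[of j "j + N" k] by simp
      have "u f (dyadic j (Suc k)) \<le> u f (dyadic j k) + real (2 ^ N) * (K * ((1/2) ^ (j + N))\<^sup>2)"
        unfolding e1 e2 by (rule step)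
      also have "real (2 ^ N) * (K * ((1/2) ^ (j + N))\<^sup>2) = K * ((1/2) ^ j)\<^sup>2 * (1/2) ^ N"
        by (simp add: power_add power2_eq_square power_divide)
      also have "\<dots> \<le> \<bar>K\<bar> * 1 * (1/2) ^ N"
        by (intro mult_right_mono mult_mono power_le_one) auto
      finally show ?thesis by simp
    qed
    moreover have "(\<lambda>N. u f (dyadic j k) + \<bar>K\<bar> * (1/2) ^ N) \<longlonglongrightarrow> u f (dyadic j k) + \<bar>K\<bar> * 0"
      by (intro tendsto_intros LIMSEQ_power_zero) auto
    ultimately have "u f (dyadic j (Suc k)) \<le> u f (dyadic j k) + \<bar>K\<bar> * 0"
      by (intro LIMSEQ_le_const) auto
    then show ?thesis by simp
  qed
  then have "decseq (\<lambda>k. u f (dyadic j k))" by (intro decseq_SucI)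
  moreover have "- C \<le> u f (dyadic j k)" for k
  proof -
    have "- C = (\<integral>\<omega>. - C \<partial>ising_law)" using ising_law.prob_space by simp
    also have "\<dots> \<le> u f (dyadic j k)"
      unfolding u_def using f\<sigma>_integrable[OF S C, of "dyadic j k"]
    proof (intro integral_mono)
      show "- C \<le> f (\<sigma> (dyadic j k) \<omega>)" for \<omega> using C[of "\<sigma> (dyadic j k) \<omega>"] by linarith
    qed auto
    finally show ?thesis .
  qed
  ultimately show ?thesis
    using decseq_convergent[of "\<lambda>k. u f (dyadic j k)" "- C"] unfolding convergent_def by metis
qed

lemma vanishing_mono:
  assumes "vanishing g" "bounded_local f" "bounded_local g" "\<And>\<eta>. \<eta> \<in> spins \<Longrightarrow> 0 \<le> f \<eta>" "\<And>\<eta>. \<eta> \<in> spins \<Longrightarrow> f \<eta> \<le> g \<eta>"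
  shows "vanishing f"
  unfolding vanishing_def
proof
  fix j
  have 0: "0 \<le> u f (dyadic j k)" for k
    using u_mono[OF bounded_local_const[of 0] assms(2), of "dyadic j k"] assms(4) by (simp add: u_const)
  have le: "u f (dyadic j k) \<le> u g (dyadic j k)" for k
    by (rule u_mono[OF assms(2,3) _ assms(5)]) auto
  have lim: "(\<lambda>k. u g (dyadic j k)) \<longlonglongrightarrow> 0" using assms(1) unfolding vanishing_def by blast
  show "(\<lambda>k. u f (dyadic j k)) \<longlonglongrightarrow> 0"
    by (rule tendsto_sandwich[OF _ _ tendsto_const lim]) (simp_all only: 0 le eventually_True)
qed

lemma vanishing_add:
  "vanishing f \<Longrightarrow> vanishing g \<Longrightarrow> bounded_local f \<Longrightarrow> bounded_local g \<Longrightarrow> vanishing (\<lambda>\<eta>. f \<eta> + g \<eta>)"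
  unfolding vanishing_def by (auto simp: u_add intro!: tendsto_add_zero)

lemma vanishing_cmult: "vanishing f \<Longrightarrow> vanishing (\<lambda>\<eta>. c * f \<eta>)"
  unfolding vanishing_def by (auto simp: u_cmult intro!: tendsto_mult_right_zero)

definition negligible_event :: "(config \<Rightarrow> bool) \<Rightarrow> bool" where
  "negligible_event P \<longleftrightarrow> local_fn P \<and> vanishing (\<lambda>\<eta>. of_bool (P \<eta>))"

lemma negligible_subset:
  assumes "negligible_event Q" "local_fn P" "\<And>\<eta>. \<eta> \<in> spins \<Longrightarrow> P \<eta> \<Longrightarrow> Q \<eta>" shows "negligible_event P"
  unfolding negligible_event_def
proof (intro conjI assms(2))
  show "vanishing (\<lambda>\<eta>. of_bool (P \<eta>))"
    by (rule vanishing_mono[where g = "\<lambda>\<eta>. of_bool (Q \<eta>)"])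
      (use assms in \<open>auto simp: negligible_event_def intro!: bounded_local_of_bool\<close>)
qed

lemma negligible_disj:
  assumes "negligible_event P" "negligible_event Q" shows "negligible_event (\<lambda>\<eta>. P \<eta> \<or> Q \<eta>)"
  unfolding negligible_event_def
proof
  show l: "local_fn (\<lambda>\<eta>. P \<eta> \<or> Q \<eta>)" using assms by (intro local_fn_disj) (auto simp: negligible_event_def)
  show "vanishing (\<lambda>\<eta>. of_bool (P \<eta> \<or> Q \<eta>))"
  proof (rule vanishing_mono)
    have b: "bounded_local (\<lambda>\<eta>. of_bool (P \<eta>))" "bounded_local (\<lambda>\<eta>. of_bool (Q \<eta>))"
      using assms by (auto simp: negligible_event_def intro: bounded_local_of_bool)
    then show "bounded_local (\<lambda>\<eta>. of_bool (P \<eta>) + of_bool (Q \<eta>))" by (rule bounded_local_add)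
    show "vanishing (\<lambda>\<eta>. of_bool (P \<eta>) + of_bool (Q \<eta>))"
      using assms b by (intro vanishing_add) (auto simp: negligible_event_def)
    show "bounded_local (\<lambda>\<eta>. of_bool (P \<eta> \<or> Q \<eta>))" by (rule bounded_local_of_bool[OF l])
  qed auto
qed

lemma negligible_False: "negligible_event (\<lambda>_. False)"
  unfolding negligible_event_def vanishing_def by (simp add: local_fn_const u_const)

lemma negligible_Bex:
  "finite A \<Longrightarrow> (\<And>x. x \<in> A \<Longrightarrow> negligible_event (P x)) \<Longrightarrow> negligible_event (\<lambda>\<eta>. \<exists>x\<in>A. P x \<eta>)"
proof (induction A rule: finite_induct)
  case (insert x A)
  then show ?case using negligible_disj[of "P x"] by simp
qed (simp add: negligible_False)

lemma negligible_transform: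
  assumes "negligible_event P" "automorphism \<phi>" "e = 1 \<or> e = -1"
  shows "negligible_event (\<lambda>\<eta>. P (transform e \<phi> \<eta>))"
proof -
  have b: "bounded_local (\<lambda>\<eta>. of_bool (P \<eta>))" using assms(1) by (auto simp: negligible_event_def intro: bounded_local_of_bool)
  have "u (\<lambda>\<eta>. of_bool (P (transform e \<phi> \<eta>))) (dyadic j k) = u (\<lambda>\<eta>. of_bool (P \<eta>)) (dyadic j k)" for j k
    by (rule u_invariant[OF b _ assms(2,3)]) simp
  then show ?thesis
    using assms(1) by (auto simp: negligible_event_def vanishing_def intro: local_fn_transform)
qed

text \<open>A move that is possible with positive rate transports mass, so an event from which a
  negligible event can be reached by one move is itself negligible.\<close>

lemma negligible_move:
  assumes P: "negligible_event P"
  shows "negligible_event (\<lambda>\<eta>. 2 \<le> disagreements \<eta> x \<and> P (flip x \<eta>))"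
proof -
  let ?f = "\<lambda>\<eta>. of_bool (P \<eta>) :: real" and ?Q = "\<lambda>\<eta>. 2 \<le> disagreements \<eta> x \<and> P (flip x \<eta>)"
  have lP: "local_fn P" and vP: "vanishing ?f" using P by (auto simp: negligible_event_def)
  obtain S0 where S0: "finite S0" "cylinder S0 P" using lP by (rule local_fnE)
  define S where "S = insert x S0"
  have S: "finite S" "cylinder S ?f" "x \<in> S"
    using S0 unfolding S_def cylinder_def by auto
  have b: "bounded_local ?f" by (rule bounded_local_of_bool[OF lP])
  have lQ: "local_fn ?Q"
    by (intro local_fn_conj local_fn_flip lP local_fn_comp[OF local_fn_disagreements, of "\<lambda>k. 2 \<le> k"])
  \<comment> \<open>Convergence to 0 is in particular convergence, so no monotonicity has to be
    shown here.\<close>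
  have "vanishing (generator S ?f)"
  proof (rule generator_vanishing[OF S(1,2), of 1])
    show "convergent (\<lambda>k. u ?f (dyadic j k))" for j
      using vP unfolding vanishing_def convergent_def by blast
  qed simp
  then have "vanishing (\<lambda>\<eta>. 2 * generator S ?f \<eta> + 2 * card S * ?f \<eta>)"
    using vP b S by (intro vanishing_add vanishing_cmult bounded_local_cmult bounded_local_generator)
  moreover have "of_bool (?Q \<eta>) \<le> 2 * generator S ?f \<eta> + 2 * card S * ?f \<eta>" if \<eta>: "\<eta> \<in> spins" for \<eta>
  proof -
    \<comment> \<open>A ring can lower an indicator by at most its value; at x the coin
      \<open>True\<close> leads from the event \<open>?Q\<close> into P, with weight 1/2.\<close>
    have 1: "- ?f \<eta> \<le> drift y ?f \<eta>" for y unfolding drift_def by simp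
    have 2: "of_bool (?Q \<eta>) / 2 - ?f \<eta> \<le> drift x ?f \<eta>"
      using flip_eq_update[OF \<eta>, of x] unfolding drift_def by auto
    have "of_bool (?Q \<eta>) / 2 - card S * ?f \<eta> = (of_bool (?Q \<eta>) / 2 - ?f \<eta>) + (\<Sum>y\<in>S - {x}. - ?f \<eta>)"
      unfolding card.remove[OF S(1,3)] by (simp add: algebra_simps del: of_bool_conj)
    also have "\<dots> \<le> drift x ?f \<eta> + (\<Sum>y\<in>S - {x}. drift y ?f \<eta>)"
      by (intro add_mono 2 sum_mono 1)
    also have "\<dots> = generator S ?f \<eta>" unfolding generator_def using S by (simp add: sum.remove[of S x])
    finally show ?thesis by simp
  qed
  ultimately have "vanishing (\<lambda>\<eta>. of_bool (?Q \<eta>))"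
    using b S lQ by (elim vanishing_mono)
      (auto intro!: bounded_local_add bounded_local_cmult bounded_local_generator bounded_local_of_bool)
  then show ?thesis using lQ by (simp add: negligible_event_def)
qed

end

section \<open>Corners are rare\<close>

text \<open>For y = (1, 0) and y = (0, 1) these are the two bonds attributed to the origin; their
  sum is the energy per site.\<close>

definition edge :: "site \<Rightarrow> config \<Rightarrow> real" where
  "edge y \<eta> = of_bool (\<eta> y \<noteq> \<eta> (0, 0))"

lemma cylinder_edge: "cylinder {(0, 0), y} (edge y)"
  by (simp add: cylinder_def edge_def)

lemma bounded_local_edge: "bounded_local (edge y)"
  unfolding bounded_local_def
  by (intro conjI local_fnI[OF _ cylinder_edge] exI[of _ 1]) (auto simp: edge_def)

lemma drift_add: "drift x (\<lambda>\<eta>. f \<eta> + g \<eta>) \<eta> = drift x f \<eta> + drift x g \<eta>"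
  by (simp add: drift_def field_simps)

lemma disagreements_edges:
  "real (disagreements \<eta> (0, 0)) = edge (1, 0) \<eta> + edge (0, 1) \<eta> + edge (-1, 0) \<eta> + edge (0, -1) \<eta>"
proof -
  have "real (disagreements \<eta> (0, 0)) = (\<Sum>y\<in>neighbours (0, 0). edge y \<eta>)"
    unfolding disagreements_def edge_def by (simp add: sum_of_bool_eq Int_def)
  then show ?thesis by (simp add: neighbours_eq)
qed

text \<open>Flipping the origin turns \<open>k\<close> disagreements into \<open>4 - k\<close>.\<close>

lemma drift_disagreements:
  assumes \<eta>: "\<eta> \<in> spins"
  shows "drift (0, 0) (\<lambda>\<eta>. real (disagreements \<eta> (0, 0))) \<eta> \<le> - 2 * of_bool (3 \<le> disagreements \<eta> (0, 0))"
proof -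
  let ?k = "disagreements \<eta> (0, 0)"
  have "disagreements (flip (0, 0) \<eta>) (0, 0) + ?k = 4"
  proof -
    have "\<eta> y = - \<eta> (0, 0) \<longleftrightarrow> \<eta> y \<noteq> \<eta> (0, 0)" for y
      using spinsD[OF \<eta>, of y] spinsD[OF \<eta>, of "(0, 0)"] by auto
    then have "{y \<in> neighbours (0, 0). flip (0, 0) \<eta> y \<noteq> flip (0, 0) \<eta> (0, 0)} = neighbours (0, 0) - {y \<in> neighbours (0, 0). \<eta> y \<noteq> \<eta> (0, 0)}"
      by (auto simp: flip_def)
    then have "disagreements (flip (0, 0) \<eta>) (0, 0) = 4 - ?k"
      unfolding disagreements_def by (simp add: card_Diff_subset card_neighbours)
    moreover have "?k \<le> 4"
      unfolding disagreements_def card_neighbours[of "(0, 0)", symmetric] by (intro card_mono) auto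
    ultimately show ?thesis by simp
  qed
  then have f: "real (disagreements (flip (0, 0) \<eta>) (0, 0)) = 4 - real ?k" by linarith
  have u: "update (0, 0) c \<eta> = (if ?k \<ge> 3 \<or> (?k = 2 \<and> c) then flip (0, 0) \<eta> else \<eta>)" for c
    by (auto simp: update_def updated_spin_def flip_def)
  consider "?k \<ge> 3" | "?k = 2" | "?k \<le> 1" by linarith
  then show ?thesis
  proof cases
    case 1
    then have "3 \<le> real ?k" by simp
    with 1 show ?thesis by (simp add: drift_def u f field_simps)
  qed (simp_all add: drift_def u f)
qed

text \<open>\<open>reducible\<close> with a bounded number of moves, so that the transport principle
  for a single move can be iterated.\<close>

primrec reducible_in :: "nat \<Rightarrow> site set \<Rightarrow> config \<Rightarrow> bool" where
  "reducible_in 0 W \<eta> \<longleftrightarrow> (\<exists>x\<in>W. 3 \<le> disagreements \<eta> x)"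
| "reducible_in (Suc n) W \<eta> \<longleftrightarrow> reducible_in n W \<eta> \<or> (\<exists>x\<in>W. 2 \<le> disagreements \<eta> x \<and> reducible_in n W (flip x \<eta>))"

lemma reducible_in_mono: "n \<le> m \<Longrightarrow> reducible_in n W \<eta> \<Longrightarrow> reducible_in m W \<eta>"
  by (induction rule: dec_induct) auto

lemma reducible_imp: "reducible W \<eta> \<Longrightarrow> \<exists>n. reducible_in n W \<eta>"
proof (induction rule: reducible.induct)
  case (drop x \<eta>)
  then have "reducible_in 0 W \<eta>" by auto
  then show ?case ..
next
  case (move x \<eta>)
  then obtain n where "reducible_in n W (flip x \<eta>)" by blast
  with move have "reducible_in (Suc n) W \<eta>" by auto
  then show ?case ..
qed

lemma reducible_in_imp: "reducible_in n W \<eta> \<Longrightarrow> reducible W \<eta>"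
proof (induction n arbitrary: \<eta>)
  case 0
  then show ?case by (auto intro: reducible.drop)
next
  case (Suc n)
  then show ?case by (auto intro: reducible.move)
qed

lemma cylinder_reducible_in:
  assumes "W \<subseteq> S" "\<And>x. x \<in> W \<Longrightarrow> neighbours x \<subseteq> S" shows "cylinder S (reducible_in n W)"
proof (induction n)
  case 0
  show ?case unfolding cylinder_def
  proof (intro allI impI)
    fix \<eta> \<zeta> :: config assume e: "\<forall>x\<in>S. \<eta> x = \<zeta> x"
    have "disagreements \<eta> x = disagreements \<zeta> x" if "x \<in> W" for x
      by (rule cylinderD[OF cylinder_disagreements[of x]]) (use e assms that in blast)
    then show "reducible_in 0 W \<eta> = reducible_in 0 W \<zeta>" by simp
  qed
next
  case (Suc n)
  show ?case unfolding cylinder_def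
  proof (intro allI impI)
    fix \<eta> \<zeta> :: config assume e: "\<forall>x\<in>S. \<eta> x = \<zeta> x"
    have 1: "disagreements \<eta> x = disagreements \<zeta> x" if "x \<in> W" for x
      by (rule cylinderD[OF cylinder_disagreements[of x]]) (use e assms that in blast)
    have 2: "reducible_in n W (flip x \<eta>) = reducible_in n W (flip x \<zeta>)" if "x \<in> W" for x
      by (rule cylinderD[OF Suc]) (use e assms that in \<open>auto simp: flip_def\<close>)
    have 3: "reducible_in n W \<eta> = reducible_in n W \<zeta>" by (rule cylinderD[OF Suc]) (use e in blast)
    show "reducible_in (Suc n) W \<eta> = reducible_in (Suc n) W \<zeta>" using 1 2 3 by simp
  qed
qed

text \<open>Reducibility in a finite W depends on finitely many spins, so it is decided on finitely
  many patterns, and the largest number of moves among these serves for all.\<close>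

lemma reducible_bounded:
  assumes "finite W" shows "\<exists>N. \<forall>\<eta>\<in>spins. reducible W \<eta> \<longrightarrow> reducible_in N W \<eta>"
proof -
  define S where "S = (\<Union>x\<in>W. {x} \<union> neighbours x)"
  have S: "finite S" "W \<subseteq> S" "\<And>x. x \<in> W \<Longrightarrow> neighbours x \<subseteq> S" using assms by (auto simp: S_def)
  \<comment> \<open>One representative of each pattern on S, continued by 1 outside.\<close>
  define F where "F = {\<eta> :: config. \<forall>x. (x \<in> S \<longrightarrow> \<eta> x \<in> {-1, 1}) \<and> (x \<notin> S \<longrightarrow> \<eta> x = 1)}"
  have F: "finite F" unfolding F_def by (rule finite_set_of_finite_funs) (use S in auto)
  have "\<exists>N. \<forall>\<eta>\<in>F. reducible W \<eta> \<longrightarrow> reducible_in N W \<eta>"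
    using F
  proof (induction F)
    case (insert \<eta> F)
    then obtain N where N: "\<forall>\<eta>\<in>F. reducible W \<eta> \<longrightarrow> reducible_in N W \<eta>" by blast
    obtain n where n: "reducible W \<eta> \<longrightarrow> reducible_in n W \<eta>" using reducible_imp by blast
    show ?case
      by (rule exI[of _ "max N n"]) (use N n reducible_in_mono[of N "max N n"] reducible_in_mono[of n "max N n"] in auto)
  qed simp
  then obtain N where N: "\<forall>\<eta>\<in>F. reducible W \<eta> \<longrightarrow> reducible_in N W \<eta>" by blast
  have "reducible_in N W \<eta>" if \<eta>: "\<eta> \<in> spins" "reducible W \<eta>" for \<eta>
  proof -
    let ?z = "\<lambda>x. if x \<in> S then \<eta> x else 1"
    have "?z \<in> F" using spinsD[OF \<eta>(1)] unfolding F_def mem_Collect_eq by (simp add: disj_commute)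
    have eq: "reducible_in m W \<eta> = reducible_in m W ?z" for m
      by (rule cylinderD[OF cylinder_reducible_in[OF S(2,3)]]) auto
    obtain n where "reducible_in n W \<eta>" using reducible_imp[OF \<eta>(2)] by blast
    then have "reducible W ?z" using eq reducible_in_imp by blast
    with N \<open>?z \<in> F\<close> show ?thesis using eq by blast
  qed
  then show ?thesis by blast
qed

definition gen_corner :: "int \<Rightarrow> int \<Rightarrow> int \<Rightarrow> site \<Rightarrow> config \<Rightarrow> bool" where
  "gen_corner a p q z \<eta> \<longleftrightarrow> \<eta> z = a \<and> \<eta> (fst z + p, snd z) = - a \<and> \<eta> (fst z, snd z + q) = - a"

lemma local_fn_gen_corner: "local_fn (gen_corner a p q z)"
  unfolding gen_corner_def[abs_def] by (intro local_fn_conj local_fn_spin_eq)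

lemma gen_corner_eq_corner: "corner \<eta> z \<longleftrightarrow> gen_corner 1 1 1 z \<eta>"
  by (simp add: corner_def gen_corner_def)

lemma gen_corner_transform:
  assumes "a = 1 \<or> a = -1"
  shows "gen_corner 1 1 1 (0, 0) (transform a (\<lambda>x. (fst z + p * fst x, snd z + q * snd x)) \<eta>) \<longleftrightarrow> gen_corner a p q z \<eta>"
  using assms unfolding gen_corner_def transform_def by (elim disjE) auto

context ising
begin

text \<open>The generator of the energy per site contains flips at both ends of the right and upper
  bonds of the origin. Translating the far ends to the origin turns its expectation into that of the
  drift of all four bonds when the origin flips. This drift is nonpositive, and at most -2 when
  energy is lost; so the energy per site decreases, converges, and its generator vanishes.\<close>

lemma negligible_energy_drop: "negligible_event (\<lambda>\<eta>. 3 \<le> disagreements \<eta> (0, 0))"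
proof -
  let ?e = "\<lambda>\<eta>. edge (1, 0) \<eta> + edge (0, 1) \<eta>" and ?S = "{(0, 0), (1, 0), (0, 1)} :: site set"
  let ?D = "\<lambda>\<eta>. real (disagreements \<eta> (0, 0))"
  have be: "bounded_local (drift x (edge y))" for x y by (intro bounded_local_drift bounded_local_edge)
  have S: "finite ?S" by simp
  have cyl: "cylinder ?S ?e"
    unfolding cylinder_def edge_def by simp
  have bnd: "\<bar>?e \<eta>\<bar> \<le> 2" for \<eta> by (simp add: edge_def)
  have bD: "bounded_local ?D" unfolding disagreements_edges by (intro bounded_local_add bounded_local_edge)
  have inv: "u (drift z (edge z)) t = u (drift (0, 0) (edge (- fst z, - snd z))) t" if t: "0 \<le> t" for z t
  proof -
    let ?\<phi> = "\<lambda>x. (fst (- fst z, - snd z) + 1 * fst x, snd (- fst z, - snd z) + 1 * snd x)"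
    have aut: "automorphism ?\<phi>" by (rule automorphism_affine) auto
    have "edge z (transform 1 ?\<phi> \<zeta>) = edge (- fst z, - snd z) \<zeta>" for \<zeta>
      by (auto simp: edge_def transform_def)
    moreover have "?\<phi> z = (0, 0)" by simp
    ultimately have "drift z (edge z) (transform 1 ?\<phi> \<eta>) = drift (0, 0) (edge (- fst z, - snd z)) \<eta>" for \<eta>
      using drift_transform[OF aut, of 1 z "edge z" \<eta>] by simp
    then show ?thesis using u_invariant[OF be[of z z] t aut, of 1] by simp
  qed
  have gen: "u (generator ?S ?e) t = u (drift (0, 0) ?D) t" if t: "0 \<le> t" for t
  proof -
    have 0: "drift (1, 0) (edge (0, 1)) \<eta> = 0" "drift (0, 1) (edge (1, 0)) \<eta> = 0" for \<eta>
      by (rule drift_outside[OF cylinder_edge]; simp)+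
    have "generator ?S ?e = (\<lambda>\<eta>. drift (0, 0) (edge (1, 0)) \<eta> + drift (0, 0) (edge (0, 1)) \<eta> + drift (1, 0) (edge (1, 0)) \<eta> + drift (0, 1) (edge (0, 1)) \<eta>)"
      by (simp add: generator_def fun_eq_iff drift_add 0)
    then have "u (generator ?S ?e) t = u (drift (0, 0) (edge (1, 0))) t + u (drift (0, 0) (edge (0, 1))) t
      + u (drift (1, 0) (edge (1, 0))) t + u (drift (0, 1) (edge (0, 1))) t"
      using t by (simp add: u_add bounded_local_add be)
    also have "\<dots> = u (drift (0, 0) (edge (1, 0))) t + u (drift (0, 0) (edge (0, 1))) t
      + u (drift (0, 0) (edge (-1, 0))) t + u (drift (0, 0) (edge (0, -1))) t"
      using inv[OF t, of "(1, 0)"] inv[OF t, of "(0, 1)"] by simp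
    also have "\<dots> = u (drift (0, 0) ?D) t"
      using t by (simp add: disagreements_edges u_add bounded_local_add be drift_add[abs_def])
    finally show ?thesis .
  qed
  have bd: "bounded_local (drift (0, 0) ?D)" by (rule bounded_local_drift[OF bD])
  have "u (drift (0, 0) ?D) t \<le> 0" if "0 \<le> t" for t
  proof -
    have "u (drift (0, 0) ?D) t \<le> u (\<lambda>_. 0) t"
    proof (rule u_mono[OF bd bounded_local_const that])
      show "drift (0, 0) ?D \<eta> \<le> 0" if "\<eta> \<in> spins" for \<eta>
        using drift_disagreements[OF that] by (simp add: of_bool_def split: if_splits)
    qed
    then show ?thesis by (simp add: u_const)
  qed
  then have "vanishing (generator ?S ?e)"
    by (intro generator_vanishing[OF S cyl bnd] u_decreasing[OF S cyl bnd]) (simp add: gen)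
  then have "vanishing (drift (0, 0) ?D)" unfolding vanishing_def by (simp add: gen)
  then have v: "vanishing (\<lambda>\<eta>. - (1/2) * drift (0, 0) ?D \<eta>)" by (rule vanishing_cmult)
  have l: "local_fn (\<lambda>\<eta>. 3 \<le> disagreements \<eta> (0, 0))"
    by (rule local_fn_comp[OF local_fn_disagreements, of "\<lambda>k. 3 \<le> k"])
  show ?thesis
    unfolding negligible_event_def
  proof (intro conjI l vanishing_mono[OF v])
    show "of_bool (3 \<le> disagreements \<eta> (0, 0)) \<le> - (1/2) * drift (0, 0) ?D \<eta>" if "\<eta> \<in> spins" for \<eta>
      using drift_disagreements[OF that] by (simp add: field_simps)
  qed (rule bounded_local_of_bool[OF l] bounded_local_cmult[OF bd] | simp)+
qed

lemma translation: "automorphism (\<lambda>x. (fst z + fst x, snd z + snd x))"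
  using automorphism_affine[of 1 1 z] by simp

lemma negligible_reducible:
  assumes "finite W" shows "negligible_event (reducible W)"
proof -
  have "negligible_event (reducible_in n W)" for n
  proof (induction n)
    case 0
    have "negligible_event (\<lambda>\<eta>. 3 \<le> disagreements \<eta> z)" for z
      using negligible_transform[OF negligible_energy_drop translation[of z], of 1]
      by (simp add: disagreements_transform[OF translation])
    then have "negligible_event (\<lambda>\<eta>. \<exists>x\<in>W. 3 \<le> disagreements \<eta> x)" by (intro negligible_Bex assms)
    then show ?case by simp
  next
    case (Suc n)
    have "negligible_event (\<lambda>\<eta>. reducible_in n W \<eta> \<or> (\<exists>x\<in>W. 2 \<le> disagreements \<eta> x \<and> reducible_in n W (flip x \<eta>)))"
      by (intro negligible_disj Suc negligible_Bex assms negligible_move)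
    then show ?case by simp
  qed
  moreover obtain N where N: "\<forall>\<eta>\<in>spins. reducible W \<eta> \<longrightarrow> reducible_in N W \<eta>" using reducible_bounded[OF assms] by blast
  moreover have "local_fn (reducible W)"
  proof (rule local_fnI)
    let ?S = "\<Union>x\<in>W. {x} \<union> neighbours x"
    show "finite ?S" using assms by auto
    have c: "cylinder ?S (reducible_in n W)" for n by (rule cylinder_reducible_in) auto
    show "cylinder ?S (reducible W)"
      unfolding cylinder_def
    proof (intro allI impI)
      fix \<eta> \<zeta> :: config assume "\<forall>x\<in>?S. \<eta> x = \<zeta> x"
      then have "reducible_in n W \<eta> = reducible_in n W \<zeta>" for n by (intro cylinderD[OF c]) blast
      then show "reducible W \<eta> = reducible W \<zeta>" using reducible_imp reducible_in_imp by metis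
    qed
  qed
  ultimately show ?thesis using negligible_subset by blast
qed

text \<open>At most one of \<open>M + 1\<close> consecutive sites can be the last corner within distance \<open>M\<close>.\<close>

lemma last_corner_rare:
  fixes d :: site
  assumes t: "0 \<le> t"
  shows "u (\<lambda>\<eta>. of_bool (corner \<eta> (0, 0) \<and> (\<forall>i\<in>{1..M}. \<not> corner \<eta> (int i * fst d, int i * snd d)))) t \<le> 1 / real (Suc M)"
proof -
  let ?c = "\<lambda>j \<eta>. corner \<eta> (int j * fst d, int j * snd d)"
  let ?P = "\<lambda>j \<eta>. ?c j \<eta> \<and> (\<forall>i\<in>{1..M}. \<not> ?c (j + i) \<eta>)"
  let ?f = "\<lambda>\<eta>. of_bool (corner \<eta> (0, 0) \<and> (\<forall>i\<in>{1..M}. \<not> ?c i \<eta>)) :: real"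
  have lc: "local_fn (?c j)" for j unfolding gen_corner_eq_corner by (rule local_fn_gen_corner)
  have lP: "local_fn (?P j)" for j by (intro local_fn_conj lc local_fn_Ball local_fn_not) auto
  have lf: "bounded_local ?f"
    using bounded_local_of_bool[OF lP[of 0]] by simp
  have "u (\<lambda>\<eta>. of_bool (?P j \<eta>)) t = u ?f t" for j
  proof -
    let ?\<phi> = "\<lambda>x. (fst (int j * fst d, int j * snd d) + fst x, snd (int j * fst d, int j * snd d) + snd x)"
    have "?f (transform 1 ?\<phi> \<eta>) = of_bool (?P j \<eta>)" for \<eta>
      by (simp add: corner_def transform_def algebra_simps)
    then show ?thesis using u_invariant[OF lf t translation, of 1 "(int j * fst d, int j * snd d)"] by simp
  qed
  then have "real (Suc M) * u ?f t = (\<Sum>j\<in>{..M}. u (\<lambda>\<eta>. of_bool (?P j \<eta>)) t)" by simp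
  also have "\<dots> = u (\<lambda>\<eta>. \<Sum>j\<in>{..M}. of_bool (?P j \<eta>)) t"
    using t by (intro u_sum[symmetric] bounded_local_of_bool[OF lP]) auto
  also have "\<dots> \<le> u (\<lambda>_. 1) t"
  proof (rule u_mono[OF bounded_local_sum bounded_local_const t])
    show "bounded_local (\<lambda>\<eta>. of_bool (?P j \<eta>))" for j by (rule bounded_local_of_bool[OF lP])
    fix \<eta> :: config
    \<comment> \<open>Of two such sites, the earlier would have the later among its next M
      sites.\<close>
    have uniq: "j = j'" if "j \<le> M" "j' \<le> M" "?P j \<eta>" "?P j' \<eta>" for j j'
    proof (rule ccontr)
      assume "j \<noteq> j'"
      have *: False if "a < b" "b \<le> M" "?P a \<eta>" "?P b \<eta>" for a b
      proof -
        have "b - a \<in> {1..M}" using that by auto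
        then have "\<not> ?c (a + (b - a)) \<eta>" using that(3) by blast
        then show False using that by simp
      qed
      from \<open>j \<noteq> j'\<close> consider "j < j'" | "j' < j" by linarith
      then show False by cases (use * that in blast)+
    qed
    have "\<forall>a\<in>{..M} \<inter> {j. ?P j \<eta>}. \<forall>b\<in>{..M} \<inter> {j. ?P j \<eta>}. a = b"
    proof (intro ballI)
      fix a b assume "a \<in> {..M} \<inter> {j. ?P j \<eta>}" "b \<in> {..M} \<inter> {j. ?P j \<eta>}"
      then have "a \<le> M" "b \<le> M" "?P a \<eta>" "?P b \<eta>"
        by (auto simp only: Int_iff atMost_iff mem_Collect_eq)
      then show "a = b" by (rule uniq)
    qed
    then have "card ({..M} \<inter> {j. ?P j \<eta>}) \<le> Suc 0"
      by (rule iffD2[OF card_le_Suc0_iff_eq, rotated]) simp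
    then have "real (card ({..M} \<inter> {j. ?P j \<eta>})) \<le> 1" by simp
    then show "(\<Sum>j\<in>{..M}. of_bool (?P j \<eta>) :: real) \<le> 1" by (simp add: sum_of_bool_eq del: of_bool_conj)
  qed simp
  finally show ?thesis by (simp add: u_const field_simps)
qed

lemma negligible_corner: "negligible_event (gen_corner 1 1 1 (0, 0))"
  unfolding negligible_event_def vanishing_def
proof (intro conjI allI local_fn_gen_corner LIMSEQ_I)
  fix j and \<epsilon> :: real assume \<epsilon>: "0 < \<epsilon>"
  \<comment> \<open>Each of the two rays contributes less than \<epsilon> / 4, and the reducible
    window less than \<epsilon> / 2.\<close>
  obtain M where M: "inverse (real (Suc M)) < \<epsilon> / 4" using reals_Archimedean[of "\<epsilon> / 4"] \<epsilon> by auto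
  let ?W = "{0..int M} \<times> {0..int M}"
  let ?A = "\<lambda>d \<eta>. corner \<eta> (0, 0) \<and> (\<forall>i\<in>{1..M}. \<not> corner \<eta> (int i * fst d, int i * snd d))"
  have lA: "local_fn (?A d)" for d
    unfolding gen_corner_eq_corner by (intro local_fn_conj local_fn_gen_corner local_fn_Ball local_fn_not) auto
  have nr: "negligible_event (reducible ?W)" by (rule negligible_reducible) simp
  then have "(\<lambda>k. u (\<lambda>\<eta>. of_bool (reducible ?W \<eta>)) (dyadic j k)) \<longlonglongrightarrow> 0"
    unfolding negligible_event_def vanishing_def by blast
  then obtain k0 where k0: "\<And>k. k0 \<le> k \<Longrightarrow> \<bar>u (\<lambda>\<eta>. of_bool (reducible ?W \<eta>)) (dyadic j k)\<bar> < \<epsilon> / 2"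
    using LIMSEQ_D[of _ 0 "\<epsilon> / 2"] \<epsilon> by fastforce
  have "norm (u (\<lambda>\<eta>. of_bool (gen_corner 1 1 1 (0, 0) \<eta>)) (dyadic j k) - 0) < \<epsilon>" if k: "k0 \<le> k" for k
  proof -
    let ?t = "dyadic j k"
    let ?a = "\<lambda>\<eta>. of_bool (?A (1, 0) \<eta>) :: real" and ?b = "\<lambda>\<eta>. of_bool (?A (0, 1) \<eta>) :: real" and ?r = "\<lambda>\<eta>. of_bool (reducible ?W \<eta>) :: real"
    have b: "bounded_local ?a" "bounded_local ?b" "bounded_local ?r"
      by (rule bounded_local_of_bool[OF lA], rule bounded_local_of_bool[OF lA],
        rule bounded_local_of_bool) (use nr in \<open>simp add: negligible_event_def\<close>)
    have c: "bounded_local (\<lambda>\<eta>. of_bool (gen_corner 1 1 1 (0, 0) \<eta>))"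
      by (rule bounded_local_of_bool[OF local_fn_gen_corner])
    have t: "0 \<le> ?t" by simp
    have "u (\<lambda>\<eta>. of_bool (gen_corner 1 1 1 (0, 0) \<eta>)) ?t \<le> u (\<lambda>\<eta>. ?a \<eta> + ?b \<eta> + ?r \<eta>) ?t"
    proof (rule u_mono[OF c _ t])
      show "bounded_local (\<lambda>\<eta>. ?a \<eta> + ?b \<eta> + ?r \<eta>)" by (intro bounded_local_add b)
      fix \<eta> assume \<eta>: "\<eta> \<in> spins"
      show "of_bool (gen_corner 1 1 1 (0, 0) \<eta>) \<le> ?a \<eta> + ?b \<eta> + ?r \<eta>"
      proof (cases "gen_corner 1 1 1 (0, 0) \<eta> \<and> \<not> ?A (1, 0) \<eta> \<and> \<not> ?A (0, 1) \<eta>")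
        case True
        then have O: "corner \<eta> (0, 0)" by (simp add: gen_corner_eq_corner)
        \<comment> \<open>The origin is the last corner on neither ray, so both carry a further
          corner within distance M.\<close>
        with True obtain i i' where i: "i \<in> {1..M}" "corner \<eta> (int i, 0)" "i' \<in> {1..M}" "corner \<eta> (0, int i')" by auto
        have "reducible ?W \<eta>"
          by (rule corners_reducible[OF \<eta> O i(2) _ _ i(4)]) (use i in auto)
        then show ?thesis by simp
      next
        case False
        then show ?thesis by auto
      qed
    qed
    also have "\<dots> = u ?a ?t + u ?b ?t + u ?r ?t" using b t by (simp add: u_add bounded_local_add del: of_bool_conj)
    also have "\<dots> < \<epsilon> / 4 + \<epsilon> / 4 + \<epsilon> / 2"
      using last_corner_rare[OF t, where d = "(1, 0)" and M = M] last_corner_rare[OF t, where d = "(0, 1)" and M = M] M k0[OF k]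
      by (simp add: inverse_eq_divide abs_less_iff)
    finally have "u (\<lambda>\<eta>. of_bool (gen_corner 1 1 1 (0, 0) \<eta>)) ?t < \<epsilon>" by simp
    moreover have "0 \<le> u (\<lambda>\<eta>. of_bool (gen_corner 1 1 1 (0, 0) \<eta>)) ?t"
      using u_mono[OF bounded_local_const[of 0] c t] by (simp add: u_const)
    ultimately show ?thesis by simp
  qed
  then show "\<exists>no. \<forall>k\<ge>no. norm (u (\<lambda>\<eta>. of_bool (gen_corner 1 1 1 (0, 0) \<eta>)) (dyadic j k) - 0) < \<epsilon>" by blast
qed

lemma negligible_gen_corner:
  assumes "a = 1 \<or> a = -1" "p = 1 \<or> p = -1" "q = 1 \<or> q = -1"
  shows "negligible_event (gen_corner a p q z)"
  using negligible_transform[OF negligible_corner automorphism_affine[OF assms(2,3)] assms(1), of z]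
  by (simp only: gen_corner_transform[OF assms(1)])

end

section \<open>Crossings\<close>

lemma two_disagreements:
  assumes "y \<in> neighbours x" "z \<in> neighbours x" "y \<noteq> z" "\<eta> y \<noteq> \<eta> x" "\<eta> z \<noteq> \<eta> x"
  shows "2 \<le> disagreements \<eta> x"
proof -
  have "card {y, z} \<le> disagreements \<eta> x" by (rule disagreements_ge) (use assms in blast)+
  then show ?thesis using assms(3) by simp
qed

lemma three_disagreements:
  assumes "{y, z, v} \<subseteq> neighbours x" "y \<noteq> z" "y \<noteq> v" "z \<noteq> v" "\<eta> y \<noteq> \<eta> x" "\<eta> z \<noteq> \<eta> x" "\<eta> v \<noteq> \<eta> x"
  shows "3 \<le> disagreements \<eta> x"
proof -
  have "card {y, z, v} \<le> disagreements \<eta> x" by (rule disagreements_ge) (use assms in blast)+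
  then show ?thesis using assms(2-4) by simp
qed

text \<open>A site in a tie is a corner, or it lies on a strip of width one. In the latter case one of
  the four sites next to it is a corner, or flipping it leaves a site of the strip with three
  disagreeing neighbours.\<close>

lemma tie_cases:
  assumes \<eta>: "\<eta> \<in> spins" and tie: "2 \<le> disagreements \<eta> (0, 0)"
  shows "(\<exists>z\<in>{-1..1} \<times> {-1..1}. \<exists>a\<in>{1, -1}. \<exists>p\<in>{1, -1}. \<exists>q\<in>{1, -1}. gen_corner a p q z \<eta>)
    \<or> reducible ({-1..1} \<times> {-1..1}) \<eta>" (is "?C \<or> ?R")
proof (rule ccontr)
  assume "\<not> (?C \<or> ?R)"
  then have nc: "\<not> gen_corner a p q z \<eta>" if "z \<in> {-1..1} \<times> {-1..1}" "a = 1 \<or> a = -1" "p = 1 \<or> p = -1" "q = 1 \<or> q = -1" for a p q z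
    using that by blast
  have nr: "\<not> ?R" using \<open>\<not> (?C \<or> ?R)\<close> by blast
  define a where "a = \<eta> (0, 0)"
  have a: "a = 1 \<or> a = -1" unfolding a_def by (rule spinsD[OF \<eta>])
  have ne: "\<eta> z \<noteq> a \<longleftrightarrow> \<eta> z = - a" "\<eta> z \<noteq> - a \<longleftrightarrow> \<eta> z = a" for z
    using spinsD[OF \<eta>, of z] a by auto
  have no: "\<not> (\<eta> (p, 0) = - a \<and> \<eta> (0, q) = - a)" if "p = 1 \<or> p = -1" "q = 1 \<or> q = -1" for p q
    using nc[of "(0, 0)" a p q] a that by (auto simp: gen_corner_def a_def)
  \<comment> \<open>If \<open>(p, q)\<close> had the sign of the origin, \<open>(p, 0)\<close> would
    be a corner of the opposite sign.\<close>
  have side: "\<eta> (p, q) = - a" if "\<eta> (p, 0) = - a" "p = 1 \<or> p = -1" "q = 1 \<or> q = -1" for p q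
    using nc[of "(p, 0)" "- a" "- p" q] that a ne(1)[of "(p, q)"] by (auto simp: gen_corner_def a_def)
  have side': "\<eta> (p, q) = - a" if "\<eta> (0, q) = - a" "p = 1 \<or> p = -1" "q = 1 \<or> q = -1" for p q
    using nc[of "(0, q)" "- a" p "- q"] that a ne(1)[of "(p, q)"] by (auto simp: gen_corner_def a_def)
  have e: "edge y \<eta> = (if \<eta> y = - a then 1 else 0)" for y
    using ne(1)[of y] by (simp add: edge_def a_def)
  have "2 \<le> real (disagreements \<eta> (0, 0))" using tie by simp
  \<comment> \<open>Disagreeing neighbours in perpendicular directions would make the origin a
    corner, so two opposite neighbours disagree.\<close>
  then have "(\<eta> (1, 0) = - a \<and> \<eta> (-1, 0) = - a) \<or> (\<eta> (0, 1) = - a \<and> \<eta> (0, -1) = - a)"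
    using no[of 1 1] no[of 1 "-1"] no[of "-1" 1] no[of "-1" "-1"]
    unfolding disagreements_edges e by (auto split: if_splits)
  then show False
  proof
    assume h: "\<eta> (1, 0) = - a \<and> \<eta> (-1, 0) = - a"
    then have u: "\<eta> (0, 1) = a" using no[of 1 1] ne(2)[of "(0, 1)"] by simp
    \<comment> \<open>By \<open>side\<close> the strip is one site wide at \<open>(0, 1)\<close>
      too, so after the flip this site disagrees with the origin and both lateral
      neighbours.\<close>
    have "3 \<le> disagreements (flip (0, 0) \<eta>) (0, 1)"
      using h u side[of 1 1] side[of "-1" 1] a
      by (intro three_disagreements[of "(0, 0)" "(1, 1)" "(-1, 1)"]) (auto simp: neighbours_alt flip_def a_def)
    then have "reducible ({-1..1} \<times> {-1..1}) (flip (0, 0) \<eta>)" by (rule reducible.drop[rotated]) simp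
    then have ?R by (rule reducible.move[OF _ tie, rotated]) simp
    with nr show False ..
  next
    assume h: "\<eta> (0, 1) = - a \<and> \<eta> (0, -1) = - a"
    then have u: "\<eta> (1, 0) = a" using no[of 1 1] ne(2)[of "(1, 0)"] by simp
    have "3 \<le> disagreements (flip (0, 0) \<eta>) (1, 0)"
      using h u side'[of 1 1] side'[of "-1" 1] a
      by (intro three_disagreements[of "(0, 0)" "(1, 1)" "(1, -1)"]) (auto simp: neighbours_alt flip_def a_def)
    then have "reducible ({-1..1} \<times> {-1..1}) (flip (0, 0) \<eta>)" by (rule reducible.drop[rotated]) simp
    then have ?R by (rule reducible.move[OF _ tie, rotated]) simp
    with nr show False ..
  qed
qed

lemma interval_propagate:
  fixes L :: int
  assumes "\<And>i. - L \<le> i \<Longrightarrow> i < L \<Longrightarrow> P i \<longleftrightarrow> P (i + 1)" "- L \<le> i" "i \<le> L" "- L \<le> j" "j \<le> L"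
  shows "P i \<longleftrightarrow> P j"
proof -
  have "k \<le> L \<Longrightarrow> P k \<longleftrightarrow> P (- L)" if "- L \<le> k" for k
    using that
  proof (induction k rule: int_ge_induct)
    case (step k)
    then show ?case using assms(1)[of k] by auto
  qed simp
  then show ?thesis using assms by blast
qed

text \<open>Without ties all domain walls inside the square are straight, and walls of both
  directions cannot coexist.\<close>

lemma rows_or_columns_constant:
  fixes L :: int
  assumes calm: "\<And>x y. x \<in> {-L..L} \<Longrightarrow> y \<in> {-L..L} \<Longrightarrow> disagreements \<eta> (x, y) \<le> 1"
  shows "(\<forall>x\<in>{-L..L}. \<forall>x'\<in>{-L..L}. \<forall>y\<in>{-L..L}. \<eta> (x, y) = \<eta> (x', y)) \<or>
    (\<forall>x\<in>{-L..L}. \<forall>y\<in>{-L..L}. \<forall>y'\<in>{-L..L}. \<eta> (x, y) = \<eta> (x, y'))"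
proof -
  have two: False if "x \<in> {-L..L}" "y \<in> {-L..L}" "\<eta> (x + p, y) \<noteq> \<eta> (x, y)" "\<eta> (x, y + q) \<noteq> \<eta> (x, y)"
    "p = 1 \<or> p = -1" "q = 1 \<or> q = -1" for x y p q
    using two_disagreements[of "(x + p, y)" "(x, y)" "(x, y + q)" \<eta>] calm[OF that(1,2)] that(3-)
    by (auto simp: neighbours_alt)
  let ?h = "\<lambda>x y. \<eta> (x, y) \<noteq> \<eta> (x + 1, y)" and ?v = "\<lambda>x y. \<eta> (x, y) \<noteq> \<eta> (x, y + 1)"
  \<comment> \<open>Two horizontally adjacent sites that disagree have each used their one permitted
    disagreement, so the wall between them runs straight through the square of four sites.\<close>
  have step: "(?h x y \<longrightarrow> \<eta> (x, y + 1) = \<eta> (x, y) \<and> \<eta> (x + 1, y + 1) = \<eta> (x + 1, y)) \<and>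
    (?h x (y + 1) \<longrightarrow> \<eta> (x, y) = \<eta> (x, y + 1) \<and> \<eta> (x + 1, y) = \<eta> (x + 1, y + 1))"
    if "- L \<le> x" "x < L" "- L \<le> y" "y < L" for x y
    using two[of x y 1 1] two[of "x + 1" y "-1" 1] two[of x "y + 1" 1 "-1"] two[of "x + 1" "y + 1" "-1" "-1"] that
    by (auto; metis)
  have h: "?h x y \<longleftrightarrow> ?h x (y + 1)" if "- L \<le> x" "x < L" "- L \<le> y" "y < L" for x y
    using step[OF that] by metis
  have v: "?v x y \<longleftrightarrow> ?v (x + 1) y" if "- L \<le> x" "x < L" "- L \<le> y" "y < L" for x y
    using step[OF that] by metis
  show ?thesis
  proof (cases "\<exists>x y. - L \<le> x \<and> x < L \<and> y \<in> {-L..L} \<and> ?h x y")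
    case False
    have "\<eta> (x, y) = \<eta> (x', y)" if "x \<in> {-L..L}" "x' \<in> {-L..L}" "y \<in> {-L..L}" for x x' y
      using interval_propagate[of L "\<lambda>i. \<eta> (i, y) = \<eta> (x, y)" x x'] False that by auto
    then show ?thesis by blast
  next
    case True
    then obtain x y where xy: "- L \<le> x" "x < L" "y \<in> {-L..L}" "?h x y" by blast
    have hx: "?h x y'" if "y' \<in> {-L..L}" for y'
      using interval_propagate[of L "?h x" y y'] h xy that by auto
    \<comment> \<open>A horizontal wall would extend across the square and meet the vertical wall at
      a site with two disagreements.\<close>
    have "\<not> ?v x' y'" if "x' \<in> {-L..L}" "- L \<le> y'" "y' < L" for x' y'
    proof
      assume "?v x' y'"
      then have "?v x y'" using interval_propagate[of L "\<lambda>i. ?v i y'" x' x] v[of _ y'] that xy by auto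
      then show False using two[of x y' 1 1] hx[of y'] xy that by auto
    qed
    then have "\<eta> (x', y1) = \<eta> (x', y2)" if "x' \<in> {-L..L}" "y1 \<in> {-L..L}" "y2 \<in> {-L..L}" for x' y1 y2
      using interval_propagate[of L "\<lambda>i. \<eta> (x', i) = \<eta> (x', y1)" y1 y2] that by auto
    then show ?thesis by blast
  qed
qed

section \<open>Straight crossings and the constant 1/4\<close>

definition row_crossing :: "nat \<Rightarrow> int \<Rightarrow> config \<Rightarrow> bool" where
  "row_crossing L a \<eta> \<longleftrightarrow> (\<exists>y\<in>{-int L..int L}. \<forall>x\<in>{-int L..int L}. \<eta> (x, y) = a)"

definition column_crossing :: "nat \<Rightarrow> int \<Rightarrow> config \<Rightarrow> bool" where
  "column_crossing L a \<eta> \<longleftrightarrow> (\<exists>x\<in>{-int L..int L}. \<forall>y\<in>{-int L..int L}. \<eta> (x, y) = a)"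

definition tie_in :: "nat \<Rightarrow> config \<Rightarrow> bool" where
  "tie_in L \<eta> \<longleftrightarrow> (\<exists>z\<in>square L. 2 \<le> disagreements \<eta> z)"

definition const_config :: "nat \<Rightarrow> int \<Rightarrow> config \<Rightarrow> bool" where
  "const_config L a \<eta> \<longleftrightarrow> (\<forall>z\<in>square L. \<eta> z = a)"

lemma no_tie_cases:
  assumes "\<not> tie_in L \<eta>"
  shows "(\<forall>x\<in>{-int L..int L}. \<forall>x'\<in>{-int L..int L}. \<forall>y\<in>{-int L..int L}. \<eta> (x, y) = \<eta> (x', y)) \<or>
    (\<forall>x\<in>{-int L..int L}. \<forall>y\<in>{-int L..int L}. \<forall>y'\<in>{-int L..int L}. \<eta> (x, y) = \<eta> (x, y'))"
proof (rule rows_or_columns_constant)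
  fix x y assume "x \<in> {-int L..int L}" "y \<in> {-int L..int L}"
  then have "(x, y) \<in> square L" by (simp add: square_def)
  then have "\<not> 2 \<le> disagreements \<eta> (x, y)" using assms unfolding tie_in_def by blast
  then show "disagreements \<eta> (x, y) \<le> 1" by simp
qed

text \<open>If rows are constant and none is plus, the square is all minus and any column serves;
  the other case is dual. Plus rows are paired with minus columns because exchanging coordinates and
  reversing spins maps one event to the other.\<close>

lemma crossing_dichotomy:
  assumes \<eta>: "\<eta> \<in> spins" and "\<not> tie_in L \<eta>"
  shows "row_crossing L 1 \<eta> \<or> column_crossing L (-1) \<eta>"
  using no_tie_cases[OF assms(2)]
proof
  assume rows: "\<forall>x\<in>{-int L..int L}. \<forall>x'\<in>{-int L..int L}. \<forall>y\<in>{-int L..int L}. \<eta> (x, y) = \<eta> (x', y)"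
  show ?thesis
  proof (cases "\<exists>y\<in>{-int L..int L}. \<eta> (0, y) = 1")
    case True
    then obtain y where y: "y \<in> {-int L..int L}" "\<eta> (0, y) = 1" by blast
    have "\<eta> (x, y) = 1" if "x \<in> {-int L..int L}" for x
      using rows[rule_format, of x 0 y] that y by simp
    then show ?thesis using y unfolding row_crossing_def by blast
  next
    case False
    then have "\<forall>y\<in>{-int L..int L}. \<eta> (0, y) = -1" using spinsD[OF \<eta>] by blast
    then show ?thesis unfolding column_crossing_def by (intro disjI2 bexI[of _ 0]) auto
  qed
next
  assume cols: "\<forall>x\<in>{-int L..int L}. \<forall>y\<in>{-int L..int L}. \<forall>y'\<in>{-int L..int L}. \<eta> (x, y) = \<eta> (x, y')"
  show ?thesis
  proof (cases "\<exists>x\<in>{-int L..int L}. \<eta> (x, 0) = -1")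
    case True
    then obtain x where x: "x \<in> {-int L..int L}" "\<eta> (x, 0) = -1" by blast
    have "\<eta> (x, y) = -1" if "y \<in> {-int L..int L}" for y
      using cols[rule_format, of x y 0] that x by simp
    then show ?thesis using x unfolding column_crossing_def by blast
  next
    case False
    then have "\<forall>x\<in>{-int L..int L}. \<eta> (x, 0) = 1" using spinsD[OF \<eta>] by blast
    then show ?thesis unfolding row_crossing_def by (intro disjI1 bexI[of _ 0]) auto
  qed
qed

lemma crossings_const:
  assumes "\<not> tie_in L \<eta>" "row_crossing L a \<eta>" "column_crossing L a \<eta>"
  shows "const_config L a \<eta>"
proof -
  obtain y0 where y0: "y0 \<in> {-int L..int L}" "\<forall>x\<in>{-int L..int L}. \<eta> (x, y0) = a"
    using assms(2) unfolding row_crossing_def by blast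
  obtain x0 where x0: "x0 \<in> {-int L..int L}" "\<forall>y\<in>{-int L..int L}. \<eta> (x0, y) = a"
    using assms(3) unfolding column_crossing_def by blast
  have "\<eta> (x, y) = a" if "x \<in> {-int L..int L}" "y \<in> {-int L..int L}" for x y
    using no_tie_cases[OF assms(1)]
  proof
    assume "\<forall>x\<in>{-int L..int L}. \<forall>x'\<in>{-int L..int L}. \<forall>y\<in>{-int L..int L}. \<eta> (x, y) = \<eta> (x', y)"
    from this[rule_format, of x x0 y] show ?thesis using x0 that by simp
  next
    assume "\<forall>x\<in>{-int L..int L}. \<forall>y\<in>{-int L..int L}. \<forall>y'\<in>{-int L..int L}. \<eta> (x, y) = \<eta> (x, y')"
    from this[rule_format, of x y y0] show ?thesis using y0 that by simp
  qed
  then show ?thesis unfolding const_config_def square_def by blast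
qed

lemma cylinder_crossings:
  "cylinder (square L) (row_crossing L a)" "cylinder (square L) (column_crossing L a)"
proof -
  have *: "\<eta> (x, y) = \<zeta> (x, y)" if "\<forall>z\<in>square L. \<eta> z = \<zeta> z" "x \<in> {-int L..int L}" "y \<in> {-int L..int L}" for \<eta> \<zeta> :: config and x y
    using that by (simp add: square_def)
  show "cylinder (square L) (row_crossing L a)"
    unfolding cylinder_def row_crossing_def by (intro allI impI bex_cong ball_cong refl) (simp only: *)
  show "cylinder (square L) (column_crossing L a)"
    unfolding cylinder_def column_crossing_def by (intro allI impI bex_cong ball_cong refl) (simp only: *)
qed

lemma neg_eq_1: "-1 * k = 1 \<longleftrightarrow> k = (-1 :: int)"
  by linarith

lemma increasing_crossings:
  "increasing (\<lambda>\<eta>. of_bool (row_crossing L 1 \<eta>))" "increasing (\<lambda>\<eta>. of_bool (column_crossing L 1 \<eta>))"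
proof -
  have one: "\<zeta> z = 1" if "\<eta> \<le> \<zeta>" "\<zeta> \<in> spins" "\<eta> z = 1" for \<eta> \<zeta> :: config and z
    using le_funD[OF that(1), of z] spinsD[OF that(2), of z] that(3) by auto
  have "row_crossing L 1 \<zeta>" if "\<eta> \<le> \<zeta>" "\<zeta> \<in> spins" "row_crossing L 1 \<eta>" for \<eta> \<zeta>
    using that one unfolding row_crossing_def by blast
  then show "increasing (\<lambda>\<eta>. of_bool (row_crossing L 1 \<eta>))" unfolding increasing_def by auto
  have "column_crossing L 1 \<zeta>" if "\<eta> \<le> \<zeta>" "\<zeta> \<in> spins" "column_crossing L 1 \<eta>" for \<eta> \<zeta>
    using that one unfolding column_crossing_def by blast
  then show "increasing (\<lambda>\<eta>. of_bool (column_crossing L 1 \<eta>))" unfolding increasing_def by auto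
qed

lemma local_fn_const_config: "local_fn (const_config L a)"
  unfolding const_config_def[abs_def] by (intro local_fn_Ball local_fn_spin_eq) simp

context ising
begin

lemma negligible_tie: "negligible_event (tie_in L)"
proof -
  have "negligible_event (\<lambda>\<eta>. (\<exists>z\<in>{-1..1} \<times> {-1..1}. \<exists>a\<in>{1, -1}. \<exists>p\<in>{1, -1}. \<exists>q\<in>{1, -1}. gen_corner a p q z \<eta>)
    \<or> reducible ({-1..1} \<times> {-1..1}) \<eta>)"
    by (intro negligible_disj negligible_Bex negligible_gen_corner negligible_reducible) auto
  then have 0: "negligible_event (\<lambda>\<eta>. 2 \<le> disagreements \<eta> (0, 0))"
    by (rule negligible_subset) (use tie_cases in \<open>auto intro!: local_fn_comp[OF local_fn_disagreements, of "\<lambda>k. 2 \<le> k"]\<close>)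
  have "negligible_event (\<lambda>\<eta>. 2 \<le> disagreements \<eta> z)" for z
    using negligible_transform[OF 0 translation[of z], of 1]
    by (simp add: disagreements_transform[OF translation])
  then show ?thesis unfolding tie_in_def[abs_def] by (intro negligible_Bex) auto
qed

text \<open>Let H be the probability of a plus row and b that of a tie. Dichotomy and symmetry bound
  2 H + b below by 1; association of the row and column events bounds the square of H by the
  probability of the constant square plus b.\<close>

lemma const_config_bound:
  assumes t: "t = dyadic j k"
  shows "1/4 - 3/2 * u (\<lambda>\<eta>. of_bool (tie_in L \<eta>)) t \<le> u (\<lambda>\<eta>. of_bool (const_config L 1 \<eta>)) t"
proof -
  let ?b = "\<lambda>\<eta>. of_bool (tie_in L \<eta>) :: real" and ?H = "\<lambda>\<eta>. of_bool (row_crossing L 1 \<eta>) :: real"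
    and ?V = "\<lambda>\<eta>. of_bool (column_crossing L 1 \<eta>) :: real" and ?V' = "\<lambda>\<eta>. of_bool (column_crossing L (-1) \<eta>) :: real"
    and ?C = "\<lambda>\<eta>. of_bool (const_config L 1 \<eta>) :: real"
  have t0: "0 \<le> t" using t by simp
  have lt: "local_fn (tie_in L)" using negligible_tie by (simp add: negligible_event_def)
  have lh: "local_fn (row_crossing L a)" "local_fn (column_crossing L a)" for a
    by (rule local_fnI[OF finite_square cylinder_crossings(1)], rule local_fnI[OF finite_square cylinder_crossings(2)])
  note bl = bounded_local_of_bool[OF lt] bounded_local_of_bool[OF lh(1)] bounded_local_of_bool[OF lh(2)]
    bounded_local_of_bool[OF local_fn_const_config]
  have V: "u ?V t = u ?H t"
  proof -
    have "?H (transform 1 prod.swap \<eta>) = ?V \<eta>" for \<eta>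
      by (simp add: row_crossing_def column_crossing_def transform_def)
    then show ?thesis using u_invariant[OF bl(2)[of 1] t0 automorphism_swap, of 1] by simp
  qed
  have V': "u ?V' t = u ?H t"
  proof -
    have "?H (transform (-1) prod.swap \<eta>) = ?V' \<eta>" for \<eta>
      by (simp only: row_crossing_def column_crossing_def transform_def neg_eq_1 swap_simp)
    then show ?thesis using u_invariant[OF bl(2)[of 1] t0 automorphism_swap, of "-1"] by simp
  qed
  have "u (\<lambda>_. 1) t \<le> u (\<lambda>\<eta>. ?H \<eta> + ?V' \<eta> + ?b \<eta>) t"
  proof (rule u_mono[OF bounded_local_const _ t0])
    show "bounded_local (\<lambda>\<eta>. ?H \<eta> + ?V' \<eta> + ?b \<eta>)" by (intro bounded_local_add bl)
    fix \<eta> assume "\<eta> \<in> spins"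
    then show "1 \<le> ?H \<eta> + ?V' \<eta> + ?b \<eta>" using crossing_dichotomy[of \<eta> L] by (auto simp: of_bool_def)
  qed
  then have H: "1 - u ?b t \<le> 2 * u ?H t"
    using t0 by (simp add: u_const u_add bounded_local_add bl V')
  have b: "0 \<le> u ?b t" "u ?b t \<le> 1"
    using u_mono[OF bounded_local_const[of 0] bl(1) t0] u_mono[OF bl(1) bounded_local_const[of 1] t0] by (simp_all add: u_const)
  have HV: "u ?H t * u ?V t \<le> u (\<lambda>\<eta>. ?H \<eta> * ?V \<eta>) t"
    unfolding t
  proof (rule u_association[OF finite_square _ _ _ _ increasing_crossings])
    show "cylinder (square L) ?H" "cylinder (square L) ?V"
      by (rule cylinder_comp[OF cylinder_crossings(1)], rule cylinder_comp[OF cylinder_crossings(2)])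
  qed (auto intro: order_refl)
  have bHV: "bounded_local (\<lambda>\<eta>. ?H \<eta> * ?V \<eta>)"
    using bounded_local_of_bool[OF local_fn_conj[OF lh(1)[of 1] lh(2)[of 1]]] by (simp add: of_bool_conj)
  have "u (\<lambda>\<eta>. ?H \<eta> * ?V \<eta>) t \<le> u (\<lambda>\<eta>. ?C \<eta> + ?b \<eta>) t"
  proof (rule u_mono[OF bHV _ t0])
    show "bounded_local (\<lambda>\<eta>. ?C \<eta> + ?b \<eta>)" by (intro bounded_local_add bl)
    show "?H \<eta> * ?V \<eta> \<le> ?C \<eta> + ?b \<eta>" for \<eta> using crossings_const[of L \<eta> 1] by (auto simp: of_bool_def)
  qed
  then have C: "u ?H t * u ?H t \<le> u ?C t + u ?b t"
    using HV t0 by (simp add: u_add bl V)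
  have "((1 - u ?b t) / 2)\<^sup>2 \<le> (u ?H t)\<^sup>2"
    using H b by (intro power_mono) auto
  then have "(1 - u ?b t)\<^sup>2 / 4 - u ?b t \<le> u ?C t"
    using C by (simp add: power2_eq_square)
  \<comment> \<open>The two sides differ by a quarter of the square of
    \<open>u ?b t\<close>.\<close>
  moreover have "1/4 - 3/2 * u ?b t \<le> (1 - u ?b t)\<^sup>2 / 4 - u ?b t"
    by (simp add: power2_eq_square algebra_simps)
  ultimately show ?thesis by linarith
qed

lemma const_config_eventually:
  assumes \<epsilon>: "0 < \<epsilon>"
  shows "\<forall>\<^sub>F t in at_top. 1/4 - \<epsilon> < u (\<lambda>\<eta>. of_bool (const_config L 1 \<eta>)) t"
proof -
  let ?C = "\<lambda>\<eta>. of_bool (const_config L 1 \<eta>) :: real"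
  have cyl: "cylinder (square L) ?C"
    by (rule cylinder_comp[of _ "const_config L 1"]) (simp add: cylinder_def const_config_def)
  \<comment> \<open>Half of \<epsilon> is spent on moving t to a grid time, the other half on ties,
    whose bound \<epsilon> / 3 is multiplied by 3/2.\<close>
  have "0 < \<epsilon> / (4 * (real (card (square L)) + 1))" using \<epsilon> by simp
  then obtain j where j: "(1/2 :: real) ^ j < \<epsilon> / (4 * (real (card (square L)) + 1))"
    using real_arch_pow_inv[of _ "1/2"] by auto
  have small: "2 * 1 * (card (square L) * (1/2 :: real) ^ j) < \<epsilon> / 2"
  proof -
    have "2 * 1 * (card (square L) * (1/2 :: real) ^ j) \<le> 2 * (real (card (square L)) + 1) * (1/2) ^ j" by (simp add: algebra_simps)
    also have "\<dots> < 2 * (real (card (square L)) + 1) * (\<epsilon> / (4 * (real (card (square L)) + 1)))"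
      using j by (intro mult_strict_left_mono) auto
    also have "\<dots> = \<epsilon> / 2" by (simp add: field_simps)
    finally show ?thesis .
  qed
  have "(\<lambda>k. u (\<lambda>\<eta>. of_bool (tie_in L \<eta>)) (dyadic j k)) \<longlonglongrightarrow> 0"
    using negligible_tie unfolding negligible_event_def vanishing_def by blast
  then obtain k0 where k0: "\<And>k. k0 \<le> k \<Longrightarrow> \<bar>u (\<lambda>\<eta>. of_bool (tie_in L \<eta>)) (dyadic j k)\<bar> < \<epsilon> / 3"
    using LIMSEQ_D[of _ 0 "\<epsilon> / 3"] \<epsilon> by fastforce
  show ?thesis
    using eventually_ge_at_top[of "dyadic j k0"]
  proof eventually_elim
    case (elim t)
    define k where "k = nat \<lfloor>t * 2 ^ j\<rfloor>"
    have t0: "0 \<le> t" using elim by (meson order_trans mult_nonneg_nonneg of_nat_0_le_iff zero_le_power zero_le_divide_1_iff zero_le_numeral)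
    have k: "real k \<le> t * 2 ^ j" "t * 2 ^ j \<le> real (Suc k)"
    proof -
      have "real k = of_int \<lfloor>t * 2 ^ j\<rfloor>" using t0 unfolding k_def by simp
      then show "real k \<le> t * 2 ^ j" "t * 2 ^ j \<le> real (Suc k)" by linarith+
    qed
    have "real k0 = dyadic j k0 * 2 ^ j" by (simp add: power_divide)
    also have "\<dots> \<le> t * 2 ^ j" using elim by (intro mult_right_mono) auto
    finally have "k0 \<le> k" unfolding k_def by (simp add: le_nat_floor)
    have tk: "dyadic j k \<le> t" "t \<le> dyadic j (Suc k)"
      using k by (simp_all add: power_divide field_simps)
    have "\<bar>u ?C t - u ?C (dyadic j k)\<bar> \<le> 2 * 1 * (card (square L) * (1/2) ^ j)"
      by (rule u_continuity[OF finite_square cyl _ tk]) simp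
    moreover have "1/4 - 3/2 * u (\<lambda>\<eta>. of_bool (tie_in L \<eta>)) (dyadic j k) \<le> u ?C (dyadic j k)"
      by (rule const_config_bound) simp
    ultimately show ?case using small k0[OF \<open>k0 \<le> k\<close>] by linarith
  qed
qed

lemma const_config_flip:
  assumes "0 \<le> t"
  shows "u (\<lambda>\<eta>. of_bool (const_config L (-1) \<eta>)) t = u (\<lambda>\<eta>. of_bool (const_config L 1 \<eta>)) t"
proof -
  \<comment> \<open>Pure spin reversal, written as the translation by 0 with sign -1.\<close>
  have "const_config L 1 (transform (-1) (\<lambda>x. (fst (0, 0) + fst x, snd (0, 0) + snd x)) \<eta>) \<longleftrightarrow> const_config L (-1) \<eta>" for \<eta>
    by (simp add: const_config_def transform_def neg_eq_1[simplified])
  then show ?thesis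
    using u_invariant[OF bounded_local_of_bool[OF local_fn_const_config[of L 1]] assms translation[of "(0, 0)"], of "-1"] by simp
qed

lemma measure_const_on_square:
  assumes "0 \<le> t"
  shows "measure ising_law (const_on_square \<sigma> L a t) = u (\<lambda>\<eta>. of_bool (const_config L a \<eta>)) t"
proof -
  have m: "const_on_square \<sigma> L a t \<in> sets ising_law"
    by (rule sets_const_on_square[OF process assms])
  have "u (\<lambda>\<eta>. of_bool (const_config L a \<eta>)) t = (\<integral>\<omega>. indicator (const_on_square \<sigma> L a t) \<omega> \<partial>ising_law)"
    unfolding u_def
    by (intro Bochner_Integration.integral_cong refl) (simp add: const_config_def const_on_square_def indicator_def)
  then show ?thesis using m by simp
qed

end

theorem theorem3:
  fixes \<sigma> :: "real \<Rightarrow> config \<times> clocks \<Rightarrow> config" and L :: nat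
  assumes "ising_process \<sigma>"
  shows "Liminf at_top (\<lambda>t. ereal (measure ising_law (const_on_square \<sigma> L 1 t)))
           = Liminf at_top (\<lambda>t. ereal (measure ising_law (const_on_square \<sigma> L (-1) t)))
         \<and> Liminf at_top (\<lambda>t. ereal (measure ising_law (const_on_square \<sigma> L (-1) t))) \<ge> 1/4"
proof -
  interpret ising \<sigma> by unfold_locales (rule assms)
  have eq: "measure ising_law (const_on_square \<sigma> L 1 t) = measure ising_law (const_on_square \<sigma> L (-1) t)" if "0 \<le> t" for t
    using that by (simp add: measure_const_on_square const_config_flip)
  \<comment> \<open>The process is specified at nonnegative times, and the limit at infinity sees
    only these.\<close>
  have 1: "Liminf at_top (\<lambda>t. ereal (measure ising_law (const_on_square \<sigma> L 1 t)))
    = Liminf at_top (\<lambda>t. ereal (measure ising_law (const_on_square \<sigma> L (-1) t)))"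
    by (rule Liminf_eq) (use eventually_ge_at_top[of "0 :: real"] in \<open>eventually_elim, simp add: eq\<close>)
  have "ereal (1/4) \<le> Liminf at_top (\<lambda>t. ereal (measure ising_law (const_on_square \<sigma> L (-1) t)))"
    unfolding le_Liminf_iff
  proof (intro allI impI)
    fix y assume y: "y < ereal (1/4)"
    show "\<forall>\<^sub>F t in at_top. y < ereal (measure ising_law (const_on_square \<sigma> L (-1) t))"
    proof (cases y)
      case (real r)
      then have "0 < 1/4 - r" using y by simp
      from const_config_eventually[OF this, of L] eventually_ge_at_top[of "0 :: real"]
      show ?thesis
        by eventually_elim (simp add: real measure_const_on_square const_config_flip)
    qed (use y in auto)
  qed
  moreover have "ereal (1/4) = 1/4" by (simp add: one_ereal_def numeral_eq_ereal)
  ultimately show ?thesis using 1 by simp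
qed

end
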